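(* Let $A=\begin{pmatrix}0 & a_{12} \\ a_{21} & 0\end{pmatrix}$ with $a_{12},a_{21}\in\mathbb{C}_\infty$. If $\operatorname{ord}a_{12}>-\frac{q^2}{q-1}$ and $\operatorname{ord}a_{21}>-\frac{q^2}{q-1}$, then $M(A)$ is uniformizable.
   Context: Let $q$ be a power of a prime and $\theta$ a variable. $\mathbb{C}_\infty$ is the completion of an algebraic closure of the completion of $\mathbb{F}_q(\theta)$ at the valuation at infinity $\operatorname{ord}$, normalized by $\operatorname{ord}\theta=-1$ (and $\operatorname{ord}0=+\infty$). $\mathbb{C}_\infty[T,\tau]$ is the ring of non-commutative polynomials with relations $Ta=aT$, $T\tau=\tau T$, $\tau a=a^q\tau$ for $a\in\mathbb{C}_\infty$; $\mathbb{C}_\infty\{\tau\}$ is the subring generated over $\mathbb{C}_\infty$ by $\tau$. For a $2\times2$ matrix $A$ over $\mathbb{C}_\infty$, $M(A)$ is the left $\mathbb{C}_\infty[T,\tau]$-module (Anderson t-motive of dimension 2 and rank 4) which is free over $\mathbb{C}_\infty\{\tau\}$ with basis $e_1,e_2$, where multiplication by $T$ is given, for the column $e_*=(e_1,e_2)^t$, by $Te_*=\theta e_*+A\tau e_*+\tau^2e_*$. It is free of rank 4 over $\mathbb{C}_\infty[T]$. $\mathbb{C}_\infty\{T\}$ is the ring of power series $\sum_{i\ge0}a_iT^i$ with $a_i\in\mathbb{C}_\infty$, $a_i\to0$, on which $\tau$ acts by $\tau(\sum a_iT^i)=\sum a_i^qT^i$. On $M\otimes_{\mathbb{C}_\infty[T]}\mathbb{C}_\infty\{T\}$,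 $\tau$ acts by $\tau(m\otimes f)=\tau(m)\otimes\tau(f)$. $H^1(M)$ is the $\mathbb{F}_q[T]$-module of $\tau$-invariant elements of $M\otimes_{\mathbb{C}_\infty[T]}\mathbb{C}_\infty\{T\}$; it is free, and $h^1(M)$ is its rank over $\mathbb{F}_q[T]$. $M(A)$ is called uniformizable if $h^1(M(A))$ equals its rank, i.e. $h^1(M(A))=4$. *)

theory Defs
  imports
    "HOL-Library.Extended_Real"
    "HOL-Analysis.Cartesian_Space"
    "HOL-Algebra.Free_Abelian_Groups"
    "HOL-Algebra.Generated_Groups"
    "HOL-Computational_Algebra.Computational_Algebra"
begin

text \<open>
  For a module \<open>M\<close> (all of the type \<open>'m\<close>) with \<open>R\<close>-action \<open>actM\<close> and an \<open>R\<close>-module \<open>S\<close>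
  (a subset of the type \<open>'s\<close>) with \<open>R\<close>-action \<open>actS\<close>, where \<open>R\<close> is all of the type \<open>'r\<close> and is
  commutative, the tensor product of \<open>M\<close> and \<open>S\<close> over \<open>R\<close> is the free abelian group on
  \<open>M \<times> S\<close> modulo the bilinearity relations. Its elements are cosets.
\<close>

definition tensor_relations ::
    "('r \<Rightarrow> 'm::ab_group_add \<Rightarrow> 'm) \<Rightarrow> ('r \<Rightarrow> 's::ab_group_add \<Rightarrow> 's) \<Rightarrow> 's set
     \<Rightarrow> (('m \<times> 's) \<Rightarrow>\<^sub>0 int) set"
  where "tensor_relations actM actS S =
     {frag_of (m + m', f) - frag_of (m, f) - frag_of (m', f) | m m' f. f \<in> S}
   \<union> {frag_of (m, f + f') - frag_of (m, f) - frag_of (m, f') | m f f'. f \<in> S \<and> f' \<in> S}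
   \<union> {frag_of (actM r m, f) - frag_of (m, actS r f) | r m f. f \<in> S}"

definition tensor_kernel ::
    "('r \<Rightarrow> 'm::ab_group_add \<Rightarrow> 'm) \<Rightarrow> ('r \<Rightarrow> 's::ab_group_add \<Rightarrow> 's) \<Rightarrow> 's set
     \<Rightarrow> (('m \<times> 's) \<Rightarrow>\<^sub>0 int) set"
  where "tensor_kernel actM actS S =
     generate (free_Abelian_group (UNIV \<times> S)) (tensor_relations actM actS S)"

definition tensor_group ::
    "('r \<Rightarrow> 'm::ab_group_add \<Rightarrow> 'm) \<Rightarrow> ('r \<Rightarrow> 's::ab_group_add \<Rightarrow> 's) \<Rightarrow> 's set
     \<Rightarrow> (('m \<times> 's) \<Rightarrow>\<^sub>0 int) set monoid"
  where "tensor_group actM actS S =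
     free_Abelian_group (UNIV \<times> S) Mod tensor_kernel actM actS S"

text \<open>
  The map of cosets induced by \<open>m \<otimes> f \<mapsto> \<phi> m \<otimes> \<psi> f\<close>. The union below is a single coset
  whenever this assignment respects the relations.
\<close>

definition tensor_map ::
    "('r \<Rightarrow> 'm::ab_group_add \<Rightarrow> 'm) \<Rightarrow> ('r \<Rightarrow> 's::ab_group_add \<Rightarrow> 's) \<Rightarrow> 's set
     \<Rightarrow> ('m \<Rightarrow> 'm) \<Rightarrow> ('s \<Rightarrow> 's) \<Rightarrow> (('m \<times> 's) \<Rightarrow>\<^sub>0 int) set \<Rightarrow> (('m \<times> 's) \<Rightarrow>\<^sub>0 int) set"
  where "tensor_map actM actS S \<phi> \<psi> X =
     (\<Union>x\<in>X. tensor_kernel actM actS S #>\<^bsub>free_Abelian_group (UNIV \<times> S)\<^esub>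
        frag_extend (\<lambda>(m, f). frag_of (\<phi> m, \<psi> f)) x)"

definition val_closure :: "('c::field \<Rightarrow> ereal) \<Rightarrow> 'c set \<Rightarrow> 'c set"
  where "val_closure ord S = {x. \<forall>B::real. \<exists>y\<in>S. ord (x - y) > ereal B}"

definition algebraic_elements :: "'c::field set \<Rightarrow> 'c set"
  where "algebraic_elements K =
     {x. \<exists>p. p \<noteq> 0 \<and> (\<forall>i. coeff p i \<in> K) \<and> poly p x = 0}"

text \<open>The field with \<open>q\<close> elements inside a field of characteristic \<open>p\<close>, for \<open>q\<close> a power of \<open>p\<close>.\<close>

definition Fq :: "nat \<Rightarrow> 'c::field set"
  where "Fq q = {x. x ^ q = x}"

definition Fq_poly :: "nat \<Rightarrow> 'c::field poly set"
  where "Fq_poly q = {g. \<forall>i. coeff g i \<in> Fq q}"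

definition Fq_rational :: "nat \<Rightarrow> 'c::field \<Rightarrow> 'c set"
  where "Fq_rational q \<theta> =
     {poly f \<theta> / poly g \<theta> | f g. f \<in> Fq_poly q \<and> g \<in> Fq_poly q \<and> g \<noteq> 0}"

definition K_infinity :: "nat \<Rightarrow> 'c::field \<Rightarrow> ('c \<Rightarrow> ereal) \<Rightarrow> 'c set"
  where "K_infinity q \<theta> ord = val_closure ord (Fq_rational q \<theta>)"

definition K_infinity_bar :: "nat \<Rightarrow> 'c::field \<Rightarrow> ('c \<Rightarrow> ereal) \<Rightarrow> 'c set"
  where "K_infinity_bar q \<theta> ord = algebraic_elements (K_infinity q \<theta> ord)"

text \<open>
  The type \<open>'c\<close> with the valuation \<open>ord\<close> is a completion of an algebraic closure of the completion
  of \<open>F\<^sub>q(\<theta>)\<close> at infinity. Since \<open>'c\<close> is complete, the completion of \<open>F\<^sub>q(\<theta>)\<close> is its closure in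
  \<open>'c\<close>. These conditions determine \<open>('c, \<theta>, ord)\<close> up to isomorphism: \<open>ord \<theta> = -1\<close> forces \<open>ord\<close>
  to be the valuation at infinity on \<open>F\<^sub>q(\<theta>)\<close> and \<open>\<theta>\<close> to be transcendental over \<open>F\<^sub>q\<close>.
\<close>

locale C_infinity =
  fixes q :: nat and \<theta> :: "'c::field" and ord :: "'c \<Rightarrow> ereal"
  assumes q_prime_power: "prime CHAR('c)" "\<exists>r>0. q = CHAR('c) ^ r"
    and card_Fq: "card (Fq q :: 'c set) = q"
    and ord_zero: "ord 0 = \<infinity>"
    and ord_finite: "x \<noteq> 0 \<Longrightarrow> \<bar>ord x\<bar> \<noteq> \<infinity>"
    and ord_mult: "ord (x * y) = ord x + ord y"
    and ord_add: "ord (x + y) \<ge> min (ord x) (ord y)"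
    and ord_theta: "ord \<theta> = -1"
    and complete: "(\<forall>B::real. \<exists>N. \<forall>m\<ge>N. \<forall>n\<ge>N. ord (X m - X n) > ereal B)
      \<Longrightarrow> \<exists>x. (\<lambda>n. ord (X n - x)) \<longlonglongrightarrow> \<infinity>"
    and K_infinity_bar_closed: "degree f > 0 \<Longrightarrow> (\<forall>i. coeff f i \<in> K_infinity_bar q \<theta> ord)
      \<Longrightarrow> \<exists>x\<in>K_infinity_bar q \<theta> ord. poly f x = 0"
    and K_infinity_bar_dense: "val_closure ord (K_infinity_bar q \<theta> ord) = UNIV"
begin

text \<open>
  A polynomial \<open>\<Sum> a\<^sub>i x\<^sup>i\<close> of type \<open>'c poly\<close> represents \<open>\<Sum> a\<^sub>i \<tau>\<^sup>i\<close>; the product of the skew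
  polynomial ring is \<open>skew_mult\<close>, determined by \<open>\<tau> a = a\<^sup>q \<tau>\<close>.
\<close>

definition skew_mult :: "'c poly \<Rightarrow> 'c poly \<Rightarrow> 'c poly"
  where "skew_mult f g =
     (\<Sum>i\<le>degree f. \<Sum>j\<le>degree g. monom (coeff f i * coeff g j ^ (q ^ i)) (i + j))"

text \<open>
  The module \<open>M(A)\<close> is the type \<open>'c poly^2\<close>, where \<open>m\<close> stands for \<open>m$1 e\<^sub>1 + m$2 e\<^sub>2\<close>.
  The row \<open>i\<close> of \<open>T_matrix A = \<theta> + A \<tau> + \<tau>\<^sup>2\<close> consists of the coordinates of \<open>T e\<^sub>i\<close>. Since \<open>T\<close>
  commutes with \<open>\<tau>\<close> and with constants, \<open>T (m$1 e\<^sub>1 + m$2 e\<^sub>2) = m$1 (T e\<^sub>1) + m$2 (T e\<^sub>2)\<close>.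
\<close>

definition T_matrix :: "'c^2^2 \<Rightarrow> 'c poly^2^2"
  where "T_matrix A =
     (\<chi> i j. (if i = j then [:\<theta>:] else 0) + monom (A $ i $ j) 1 + (if i = j then monom 1 2 else 0))"

definition M_T :: "'c^2^2 \<Rightarrow> 'c poly^2 \<Rightarrow> 'c poly^2"
  where "M_T A m = (\<chi> j. \<Sum>i\<in>UNIV. skew_mult (m $ i) (T_matrix A $ i $ j))"

definition M_tau :: "'c poly^2 \<Rightarrow> 'c poly^2"
  where "M_tau m = (\<chi> i. skew_mult (monom 1 1) (m $ i))"

definition M_const :: "'c \<Rightarrow> 'c poly^2 \<Rightarrow> 'c poly^2"
  where "M_const c m = (\<chi> i. skew_mult [:c:] (m $ i))"

definition M_poly :: "'c^2^2 \<Rightarrow> 'c poly \<Rightarrow> 'c poly^2 \<Rightarrow> 'c poly^2"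
  where "M_poly A g m = (\<Sum>k\<le>degree g. M_const (coeff g k) ((M_T A ^^ k) m))"

definition tate :: "'c fps set"
  where "tate = {f. (\<lambda>i. ord (fps_nth f i)) \<longlonglongrightarrow> \<infinity>}"

definition tate_tau :: "'c fps \<Rightarrow> 'c fps"
  where "tate_tau f = Abs_fps (\<lambda>i. fps_nth f i ^ q)"

definition tate_poly :: "'c poly \<Rightarrow> 'c fps \<Rightarrow> 'c fps"
  where "tate_poly g f = fps_of_poly g * f"

definition M_tate :: "'c^2^2 \<Rightarrow> ((('c poly^2) \<times> 'c fps) \<Rightarrow>\<^sub>0 int) set monoid"
  where "M_tate A = tensor_group (M_poly A) tate_poly tate"

definition M_tate_tau :: "'c^2^2 \<Rightarrow> ((('c poly^2) \<times> 'c fps) \<Rightarrow>\<^sub>0 int) set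
    \<Rightarrow> ((('c poly^2) \<times> 'c fps) \<Rightarrow>\<^sub>0 int) set"
  where "M_tate_tau A = tensor_map (M_poly A) tate_poly tate M_tau tate_tau"

definition M_tate_poly :: "'c^2^2 \<Rightarrow> 'c poly \<Rightarrow> ((('c poly^2) \<times> 'c fps) \<Rightarrow>\<^sub>0 int) set
    \<Rightarrow> ((('c poly^2) \<times> 'c fps) \<Rightarrow>\<^sub>0 int) set"
  where "M_tate_poly A g = tensor_map (M_poly A) tate_poly tate id (tate_poly g)"

definition H1 :: "'c^2^2 \<Rightarrow> ((('c poly^2) \<times> 'c fps) \<Rightarrow>\<^sub>0 int) set set"
  where "H1 A = {x \<in> carrier (M_tate A). M_tate_tau A x = x}"

text \<open>
  \<open>b 0, \<dots>, b (n - 1)\<close> is a basis of \<open>H1 A\<close> over \<open>F\<^sub>q[T]\<close>; the group of \<open>M_tate A\<close> is written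
  multiplicatively, so \<open>finprod\<close> is the sum of the module.
\<close>

definition H1_basis ::
    "'c^2^2 \<Rightarrow> nat \<Rightarrow> (nat \<Rightarrow> ((('c poly^2) \<times> 'c fps) \<Rightarrow>\<^sub>0 int) set) \<Rightarrow> bool"
  where "H1_basis A n b \<longleftrightarrow>
     b \<in> {..<n} \<rightarrow> H1 A \<and>
     (\<forall>x\<in>H1 A. \<exists>!c. c \<in> {..<n} \<rightarrow>\<^sub>E Fq_poly q \<and>
        x = finprod (M_tate A) (\<lambda>i. M_tate_poly A (c i) (b i)) {..<n})"

definition H1_free_of_rank :: "'c^2^2 \<Rightarrow> nat \<Rightarrow> bool"
  where "H1_free_of_rank A n \<longleftrightarrow> (\<exists>b. H1_basis A n b)"

definition uniformizable :: "'c^2^2 \<Rightarrow> bool"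
  where "uniformizable A \<longleftrightarrow> H1_free_of_rank A 4"

end

end

theory Submission
  imports Defs
begin

text \<open>
  In the basis \<open>e\<^sub>1, e\<^sub>2, \<tau> e\<^sub>1, \<tau> e\<^sub>2\<close> an invariant element is determined by its coordinates \<open>f, g\<close> at
  \<open>\<tau> e\<^sub>1, \<tau> e\<^sub>2\<close>, whose coefficients satisfy
  \<open>\<theta>\<^sup>q x\<^sub>i\<^sup>Q + b y\<^sub>i\<^sup>q + x\<^sub>i = x\<^sub>i\<^sub>-\<^sub>1\<^sup>Q\<close> and \<open>\<theta>\<^sup>q y\<^sub>i\<^sup>Q + a x\<^sub>i\<^sup>q + y\<^sub>i = y\<^sub>i\<^sub>-\<^sub>1\<^sup>Q\<close>,
  where \<open>Q = q\<^sup>2\<close>, \<open>a = a\<^sub>1\<^sub>2\<close>, \<open>b = a\<^sub>2\<^sub>1\<close>. The constant terms lie in the finite kernel of an additive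
  system, which has \<open>q\<^sup>4\<close> elements, so it suffices that every kernel element extends to a
  solution tending to \<open>0\<close>.

  If \<open>b \<noteq> 0\<close>, then eliminating \<open>y\<close> leaves a scalar recursion \<open>P(x\<^sub>i) = R(x\<^sub>i\<^sub>-\<^sub>1, x\<^sub>i\<^sub>-\<^sub>2)\<close> with
  \<open>P = A\<^sub>2 x\<^sup>Q\<^sup>Q + A\<^sub>1 x\<^sup>Q + A\<^sub>0 x\<close>. The end points of the Newton polygon of \<open>P\<close> give the valuation
  \<open>Z = (q\<^sup>2/(q-1) + ord b)/(q\<^sup>2+1)\<close>, so the bound in the theorem says exactly \<open>Z > 0\<close>. When also
  \<open>ord b < 1/(q-1)\<close>, that is \<open>Z > ord b\<close>, the right-hand side is so small that \<open>x\<^sub>i\<close> can be chosen with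
  valuations growing linearly in \<open>i\<close>, whatever \<open>A\<^sub>1\<close> and \<open>a\<close> are. By symmetry this leaves the case that
  \<open>a\<close> and \<open>b\<close> both have valuation at least \<open>1/(q-1)\<close>, where \<open>A\<^sub>1\<close> is dominated by \<open>\<theta>\<^sup>Q\<close> or \<open>a = b = 0\<close>.

  A basis over \<open>F\<^sub>q[T]\<close> is obtained from lifts of minimal degree, the degree of a solution being the
  index from which on its coefficients are small enough for the system to be injective there.
\<close>

text \<open>The delicate term of the scalar recursion is
  \<open>(1 + b ^ (q\<^sup>2 - 1)) * y ^ q\<^sup>2\<close> on the right, with \<open>y\<close> the
  previous coefficient. Measured against the linear term of \<open>elim_poly\<close>, its summand
  \<open>y ^ q\<^sup>2\<close> gains valuation when \<open>val y > val b\<close>, and its other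
  summand gains when \<open>val y > 0\<close>. At the starting level Z these are the conditions Z >
  val b and Z > 0. The middle coefficient does no harm: if its valuation is at least that of both 1
  and \<open>b ^ (q\<^sup>2 - 1)\<close>, it stays above the segment joining the end points of the
  Newton polygon; if it is smaller, the middle term outweighs the delicate term, and the new
  coefficient can be found from it.

  Arbitrary lifts of a basis of the kernel would generate the solutions only over power series in T,
  because subtracting a combination and dividing by T need never stop. With lifts of minimal degree
  every division lowers the degree, so the process ends with polynomials.\<close>

definition pair_scale :: "'a::times \<Rightarrow> 'a \<times> 'a \<Rightarrow> 'a \<times> 'a"
  where "pair_scale c v = (c * fst v, c * snd v)"

lemma fst_pair_scale [simp]: "fst (pair_scale c v) = c * fst v"
  and snd_pair_scale [simp]: "snd (pair_scale c v) = c * snd v"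
  by (simp_all add: pair_scale_def)

lemma pair_scale_add_right: "pair_scale c (v + w) = pair_scale c v + pair_scale c (w :: 'a::semiring \<times> 'a)"
  and pair_scale_mult: "pair_scale (c * d) v = pair_scale c (pair_scale d v)"
  by (simp_all add: prod_eq_iff algebra_simps)

lemma pair_scale_zero [simp]: "pair_scale 0 v = (0 :: 'a::mult_zero \<times> 'a)"
  and pair_scale_zero_right [simp]: "pair_scale c 0 = (0 :: 'a \<times> 'a)"
  and pair_scale_one [simp]: "pair_scale 1 w = (w :: 'b::monoid_mult \<times> 'b)"
  by (simp_all add: prod_eq_iff)

lemma pair_scale_minus_left: "pair_scale (- c) v = - pair_scale c (v :: 'a::ring \<times> 'a)"
  by (simp add: prod_eq_iff)

lemma pair_scale_sum: "pair_scale c (sum f I) = (\<Sum>i\<in>I. pair_scale c (f i :: 'a::semiring_0 \<times> 'a))"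
  by (induction I rule: infinite_finite_induct) (simp_all add: pair_scale_add_right)

definition pair_nth :: "'a fps \<times> 'a fps \<Rightarrow> nat \<Rightarrow> 'a \<times> 'a"
  where "pair_nth v i = (fps_nth (fst v) i, fps_nth (snd v) i)"

lemma pair_nth_add: "pair_nth (v + w) i = pair_nth v i + pair_nth (w :: 'a::monoid_add fps \<times> 'a fps) i"
  and pair_nth_zero [simp]: "pair_nth 0 i = (0 :: 'b::zero \<times> 'b)"
  by (simp_all add: pair_nth_def prod_eq_iff)

lemma pair_nth_sum: "pair_nth (sum f I) i = (\<Sum>j\<in>I. pair_nth (f j :: 'a::comm_monoid_add fps \<times> 'a fps) i)"
  by (induction I rule: infinite_finite_induct) (simp_all add: pair_nth_add)

lemma pair_nth_const: "pair_nth (pair_scale (fps_const c) v) i = pair_scale (c::'a::comm_semiring_1) (pair_nth v i)"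
  by (simp add: pair_nth_def prod_eq_iff)

lemma pair_scale_diff_left: "pair_scale (c - d) v = pair_scale c v - pair_scale d (v :: 'a::ring \<times> 'a)"
  by (simp add: prod_eq_iff left_diff_distrib)

context C_infinity
begin

subsection \<open>The valuation\<close>

definition val_ball :: "real \<Rightarrow> 'c set"
  where "val_ball r = {x. ereal r \<le> ord x}"

text \<open>Real values keep the later inequalities in linear real arithmetic. The price is the
  default \<open>val 0 = 0\<close>; results that have to include 0 are phrased with
  \<open>val_ball\<close>, which contains 0 for every radius.\<close>

definition val :: "'c \<Rightarrow> real"
  where "val x = real_of_ereal (ord x)"

lemma ord_eq_val: "x \<noteq> 0 \<Longrightarrow> ord x = ereal (val x)"
  using ord_finite[of x] by (simp add: val_def ereal_real')

lemma val_mult: "x \<noteq> 0 \<Longrightarrow> y \<noteq> 0 \<Longrightarrow> val (x * y) = val x + val y"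
  using ord_mult[of x y] ord_eq_val[of x] ord_eq_val[of y] ord_eq_val[of "x * y"] by simp

lemma val_one: "val 1 = 0"
  using val_mult[of 1 1] by simp

lemma val_power: "x \<noteq> 0 \<Longrightarrow> val (x ^ n) = real n * val x"
  by (induction n) (simp_all add: val_one val_mult algebra_simps)

lemma val_minus: "val (- x) = val x"
proof (cases "x = 0")
  case False
  have "val (-1) + val (-1) = 0"
    using val_mult[of "-1" "-1"] val_one by simp
  then have "val (-1) = 0" by simp
  then show ?thesis using val_mult[of "-1" x] False by simp
qed simp

lemma val_theta: "val \<theta> = -1"
  using ord_theta by (simp add: val_def)

lemma theta_nonzero: "\<theta> \<noteq> 0"
  using ord_theta ord_zero by (metis PInfty_neq_ereal(1) ereal_uminus_eq_reorder one_ereal_def uminus_ereal.simps(1))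

lemma in_ball_iff: "x \<in> val_ball r \<longleftrightarrow> x = 0 \<or> r \<le> val x"
  using ord_zero ord_eq_val[of x] by (cases "x = 0") (auto simp: val_ball_def)

lemma ball_zero [simp]: "0 \<in> val_ball r"
  by (simp add: in_ball_iff)

lemma ball_add: "x \<in> val_ball r \<Longrightarrow> y \<in> val_ball r \<Longrightarrow> x + y \<in> val_ball r"
  using ord_add[of x y] by (auto simp: val_ball_def min_def split: if_splits)

lemma ball_minus_iff [simp]: "- x \<in> val_ball r \<longleftrightarrow> x \<in> val_ball r"
  by (simp add: in_ball_iff val_minus)

lemma ball_diff: "x \<in> val_ball r \<Longrightarrow> y \<in> val_ball r \<Longrightarrow> x - y \<in> val_ball r"
  using ball_add[of x r "- y"] by simp

lemma ball_mult: "x \<in> val_ball r \<Longrightarrow> y \<in> val_ball s \<Longrightarrow> x * y \<in> val_ball (r + s)"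
  by (cases "x = 0 \<or> y = 0") (auto simp: in_ball_iff val_mult)

lemma ball_power: "x \<in> val_ball r \<Longrightarrow> n > 0 \<Longrightarrow> x ^ n \<in> val_ball (real n * r)"
  by (cases "x = 0") (auto simp: in_ball_iff val_power mult_left_mono)

lemma ball_mono: "x \<in> val_ball r \<Longrightarrow> s \<le> r \<Longrightarrow> x \<in> val_ball s"
  by (auto simp: in_ball_iff)

lemma ball_sum: "(\<And>i. i \<in> I \<Longrightarrow> f i \<in> val_ball r) \<Longrightarrow> sum f I \<in> val_ball r"
  by (induction I rule: infinite_finite_induct) (auto intro: ball_add)

lemma zero_if_in_all_balls: "(\<And>r. x \<in> val_ball r) \<Longrightarrow> x = 0"
  by (metis in_ball_iff gt_ex not_le)

lemma ball_val_cancel: "x \<noteq> 0 \<Longrightarrow> x * y \<in> val_ball r \<longleftrightarrow> y \<in> val_ball (r - val x)"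
  by (cases "y = 0") (auto simp: in_ball_iff val_mult)

lemma val_closure_iff: "x \<in> val_closure ord S \<longleftrightarrow> (\<forall>B. \<exists>y\<in>S. x - y \<in> val_ball B)"
proof -
  have "\<exists>y\<in>S. ereal B < ord (x - y)" if H: "\<forall>B. \<exists>y\<in>S. x - y \<in> val_ball B" for B
  proof -
    obtain y where "y \<in> S" "x - y \<in> val_ball (B + 1)" using H by blast
    moreover have "ereal B < ereal (B + 1)" by simp
    ultimately show ?thesis unfolding val_ball_def by (metis mem_Collect_eq order_less_le_trans)
  qed
  then show ?thesis unfolding val_closure_def val_ball_def
    by (auto intro: less_imp_le) (meson less_imp_le)
qed

lemma tendsto_infinity_iff:
  "(\<lambda>n. ord (X n)) \<longlonglongrightarrow> \<infinity> \<longleftrightarrow> (\<forall>r. \<exists>N. \<forall>n\<ge>N. X n \<in> val_ball r)"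
proof
  assume "(\<lambda>n. ord (X n)) \<longlonglongrightarrow> \<infinity>"
  then have "\<exists>N. \<forall>n\<ge>N. ereal r \<le> ord (X n)" for r by (simp add: Lim_PInfty)
  then show "\<forall>r. \<exists>N. \<forall>n\<ge>N. X n \<in> val_ball r" by (simp add: val_ball_def)
next
  assume "\<forall>r. \<exists>N. \<forall>n\<ge>N. X n \<in> val_ball r"
  then show "(\<lambda>n. ord (X n)) \<longlonglongrightarrow> \<infinity>" by (simp add: Lim_PInfty val_ball_def)
qed

text \<open>By the ultrametric inequality, bounds on consecutive differences bound all later
  differences, and the limit inherits the bound of each tail.\<close>

lemma Cauchy_limit:
  assumes "\<And>n. X (Suc n) - X n \<in> val_ball (real n)"
  obtains x where "\<And>n. x - X n \<in> val_ball (real n)"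
proof -
  have diff: "X (n + k) - X n \<in> val_ball (real n)" for n k
  proof (induction k)
    case (Suc k)
    have "X (Suc (n + k)) - X (n + k) \<in> val_ball (real n)"
      using ball_mono[OF assms[of "n + k"]] by simp
    from ball_add[OF this Suc] show ?case by simp
  qed simp
  have "\<exists>N. \<forall>m\<ge>N. \<forall>n\<ge>N. ord (X m - X n) > ereal B" for B
  proof -
    obtain N where N: "real N > B" using reals_Archimedean2 by blast
    have "ord (X m - X n) > ereal B" if "m \<ge> N" "n \<ge> N" for m n
    proof -
      have "(X m - X N) - (X n - X N) \<in> val_ball (real N)"
        using diff[of N "m - N"] diff[of N "n - N"] that
        by (intro ball_diff[of "X m - X N"]) simp_all
      then have "ereal N \<le> ord (X m - X n)" by (simp add: val_ball_def)
      moreover have "ereal B < ereal N" using N by simp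
      ultimately show ?thesis by (rule order_less_le_trans[rotated])
    qed
    then show ?thesis by blast
  qed
  then obtain x where "(\<lambda>n. ord (X n - x)) \<longlonglongrightarrow> \<infinity>" using complete[of X] by blast
  then have lim: "\<exists>N. \<forall>n\<ge>N. X n - x \<in> val_ball r" for r by (simp add: tendsto_infinity_iff)
  have "x - X n \<in> val_ball (real n)" for n
  proof -
    obtain N where "\<forall>m\<ge>N. X m - x \<in> val_ball (real n)" using lim by blast
    then have "X (n + N) - x \<in> val_ball (real n)" by simp
    from ball_diff[OF diff[of n N] this] show ?thesis by simp
  qed
  then show thesis by (rule that)
qed

section \<open>The Frobenius map and the finite field of constants\<close>

lemma q_eq: "\<exists>r>0. q = CHAR('c) ^ r" and q_ge_2: "q \<ge> 2"
proof -
  show "\<exists>r>0. q = CHAR('c) ^ r" by (rule q_prime_power)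
  then obtain r where r: "r > 0" "q = CHAR('c) ^ r" by blast
  have "CHAR('c) \<ge> 2" using q_prime_power(1) by (rule prime_ge_2_nat)
  moreover have "CHAR('c) ^ 1 \<le> CHAR('c) ^ r" using r calculation by (intro power_increasing) auto
  ultimately show "q \<ge> 2" using r by simp
qed

lemma q_pos [simp]: "q > 0" using q_ge_2 by simp

lemma frob_add: "(x + y) ^ q ^ k = x ^ q ^ k + (y::'c) ^ q ^ k"
proof -
  obtain r where "q = CHAR('c) ^ r" using q_eq by blast
  then have "q ^ k = CHAR('c) ^ (r * k)" by (simp add: power_mult)
  then show ?thesis by (rule freshmans_dream'[OF q_prime_power(1)])
qed

lemma frob_minus: "(- x) ^ q ^ k = - ((x::'c) ^ q ^ k)"
proof -
  have "q ^ k > 0" by simp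
  then show ?thesis using frob_add[of x "- x" k] by (simp add: zero_power add_eq_0_iff2)
qed

lemma frob_diff: "(x - y) ^ q ^ k = x ^ q ^ k - (y::'c) ^ q ^ k"
  using frob_add[of x "- y" k] frob_minus[of y k] by simp

lemma frob_zero: "(0::'c) ^ q ^ k = 0"
  by (simp add: zero_power)

lemma frob_sum: "(\<Sum>i\<in>I. f i) ^ q ^ k = (\<Sum>i\<in>I. (f i :: 'c) ^ q ^ k)"
  by (induction I rule: infinite_finite_induct) (simp_all add: frob_zero frob_add)

lemmas frob_q_add = frob_add[of _ _ 1, simplified]
lemmas frob_q_diff = frob_diff[of _ _ 1, simplified]
lemmas frob_q_minus = frob_minus[of _ 1, simplified]
lemmas frob_q_sum = frob_sum[of _ _ 1, simplified]

lemma frob_q_inj: "(x::'c) ^ q = y ^ q \<Longrightarrow> x = y"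
  using frob_q_diff[of x y] by simp

lemma q_char_zero: "(of_nat q :: 'c) = 0"
  using q_eq by (auto simp: of_nat_eq_0_iff_char_dvd intro: dvd_power)

lemma Fq_zero [simp]: "0 \<in> (Fq q :: 'c set)" and Fq_one [simp]: "1 \<in> (Fq q :: 'c set)"
  by (simp_all add: Fq_def zero_power)

lemma Fq_add: "x \<in> Fq q \<Longrightarrow> y \<in> Fq q \<Longrightarrow> x + y \<in> (Fq q :: 'c set)"
  by (simp add: Fq_def frob_q_add)

lemma Fq_minus: "x \<in> Fq q \<Longrightarrow> - x \<in> (Fq q :: 'c set)"
  by (simp add: Fq_def frob_q_minus)

lemma Fq_diff: "x \<in> Fq q \<Longrightarrow> y \<in> Fq q \<Longrightarrow> x - y \<in> (Fq q :: 'c set)"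
  by (simp add: Fq_def frob_q_diff)

lemma Fq_mult: "x \<in> Fq q \<Longrightarrow> y \<in> Fq q \<Longrightarrow> x * y \<in> (Fq q :: 'c set)"
  by (simp add: Fq_def power_mult_distrib)

lemma Fq_inverse: "x \<in> Fq q \<Longrightarrow> inverse x \<in> (Fq q :: 'c set)"
  by (simp add: Fq_def power_inverse)

lemma Fq_sum: "(\<And>i. i \<in> I \<Longrightarrow> f i \<in> Fq q) \<Longrightarrow> sum f I \<in> (Fq q :: 'c set)"
  by (induction I rule: infinite_finite_induct) (auto intro: Fq_add)

lemma Fq_frob: "x \<in> Fq q \<Longrightarrow> x ^ q = (x::'c)"
  by (simp add: Fq_def)

lemma val_Fq: "x \<in> Fq q \<Longrightarrow> x \<noteq> 0 \<Longrightarrow> val x = 0"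
proof -
  assume "x \<in> Fq q" and x: "x \<noteq> 0"
  then have "real q * val x = val x" using val_power[OF x, of q] by (simp add: Fq_def)
  then have "(real q - 1) * val x = 0" by (simp add: algebra_simps)
  then show ?thesis using q_ge_2 by simp
qed

lemma Fq_in_ball: "x \<in> Fq q \<Longrightarrow> x \<in> val_ball 0"
  using val_Fq[of x] by (cases "x = 0") (simp_all add: in_ball_iff)

lemma Fq_mult_ball: "x \<in> Fq q \<Longrightarrow> y \<in> val_ball r \<Longrightarrow> x * y \<in> val_ball r"
  using ball_mult[OF Fq_in_ball, of x y r] by simp

subsection \<open>Algebraic closedness\<close>

lemma Fq_poly_add: "f \<in> Fq_poly q \<Longrightarrow> g \<in> Fq_poly q \<Longrightarrow> f + g \<in> (Fq_poly q :: 'c poly set)"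
  by (simp add: Fq_poly_def Fq_add)

lemma Fq_poly_minus: "f \<in> Fq_poly q \<Longrightarrow> - f \<in> (Fq_poly q :: 'c poly set)"
  by (simp add: Fq_poly_def Fq_minus)

lemma Fq_poly_mult: "f \<in> Fq_poly q \<Longrightarrow> g \<in> Fq_poly q \<Longrightarrow> f * g \<in> (Fq_poly q :: 'c poly set)"
  by (simp add: Fq_poly_def coeff_mult Fq_mult Fq_sum)

lemma Fq_poly_const: "c \<in> Fq q \<Longrightarrow> [:c:] \<in> (Fq_poly q :: 'c poly set)"
  by (auto simp: Fq_poly_def coeff_pCons split: nat.split)

lemma Fq_rational_const: "c \<in> Fq q \<Longrightarrow> c \<in> Fq_rational q (\<theta>::'c)"
  unfolding Fq_rational_def mem_Collect_eq
  using Fq_poly_const[of c] Fq_poly_const[of 1]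
  by (intro exI[of _ "[:c:]"] exI[of _ "1::'c poly"]) (simp add: one_pCons)

text \<open>The definition only provides \<open>g \<noteq> 0\<close> as a polynomial. Transcendence
  of \<theta> is bypassed: if the denominator vanishes at \<theta>, the quotient is 0 by the
  convention for division, and 0 = 0 / 1.\<close>

lemma Fq_rational_cases:
  assumes "x \<in> Fq_rational q (\<theta>::'c)"
  obtains f g where "f \<in> Fq_poly q" "g \<in> Fq_poly q" "poly g \<theta> \<noteq> 0" "x = poly f \<theta> / poly g \<theta>"
proof -
  obtain f g where fg: "f \<in> Fq_poly q" "g \<in> Fq_poly q" "x = poly f \<theta> / poly g \<theta>"
    using assms by (auto simp: Fq_rational_def)
  show thesis
  proof (cases "poly g \<theta> = 0")
    case True
    then have "x = poly 0 \<theta> / poly 1 \<theta>" using fg by simp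
    moreover have "0 \<in> (Fq_poly q :: 'c poly set)" "1 \<in> (Fq_poly q :: 'c poly set)"
      using Fq_poly_const[of 0] Fq_poly_const[of 1] by (simp_all add: one_pCons)
    ultimately show thesis using that[of 0 1] by simp
  qed (use fg that in auto)
qed

lemma Fq_rationalI:
  "f \<in> Fq_poly q \<Longrightarrow> g \<in> Fq_poly q \<Longrightarrow> poly g \<theta> \<noteq> 0 \<Longrightarrow> poly f \<theta> / poly g \<theta> \<in> Fq_rational q (\<theta>::'c)"
  unfolding Fq_rational_def mem_Collect_eq by (metis poly_0)

lemma Fq_rational_add: "x \<in> Fq_rational q \<theta> \<Longrightarrow> y \<in> Fq_rational q \<theta> \<Longrightarrow> x + y \<in> Fq_rational q (\<theta>::'c)"
proof -
  assume "x \<in> Fq_rational q \<theta>" "y \<in> Fq_rational q \<theta>"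
  then obtain f g h k where
    x: "f \<in> Fq_poly q" "g \<in> Fq_poly q" "poly g \<theta> \<noteq> 0" "x = poly f \<theta> / poly g \<theta>" and
    y: "h \<in> Fq_poly q" "k \<in> Fq_poly q" "poly k \<theta> \<noteq> 0" "y = poly h \<theta> / poly k \<theta>"
    by (elim Fq_rational_cases)
  have "x + y = poly (f * k + h * g) \<theta> / poly (g * k) \<theta>"
    using x y by (simp add: add_frac_eq mult.commute)
  moreover have "f * k + h * g \<in> Fq_poly q" "g * k \<in> Fq_poly q"
    using x y by (auto intro: Fq_poly_add Fq_poly_mult)
  ultimately show ?thesis using x y Fq_rationalI[of "f * k + h * g" "g * k"] by simp
qed

lemma Fq_rational_mult: "x \<in> Fq_rational q \<theta> \<Longrightarrow> y \<in> Fq_rational q \<theta> \<Longrightarrow> x * y \<in> Fq_rational q (\<theta>::'c)"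
proof -
  assume "x \<in> Fq_rational q \<theta>" "y \<in> Fq_rational q \<theta>"
  then obtain f g h k where
    x: "f \<in> Fq_poly q" "g \<in> Fq_poly q" "poly g \<theta> \<noteq> 0" "x = poly f \<theta> / poly g \<theta>" and
    y: "h \<in> Fq_poly q" "k \<in> Fq_poly q" "poly k \<theta> \<noteq> 0" "y = poly h \<theta> / poly k \<theta>"
    by (elim Fq_rational_cases)
  have "x * y = poly (f * h) \<theta> / poly (g * k) \<theta>" using x y by simp
  then show ?thesis using x y Fq_rationalI[of "f * h" "g * k"] by (simp add: Fq_poly_mult)
qed

section \<open>Arithmetic in the completion of the rational functions and in its algebraic
  closure\<close>

abbreviation K_inf :: "'c set" where "K_inf \<equiv> K_infinity q \<theta> ord"
abbreviation K_bar :: "'c set" where "K_bar \<equiv> K_infinity_bar q \<theta> ord"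

lemma K_inf_iff: "x \<in> K_inf \<longleftrightarrow> (\<forall>B. \<exists>y\<in>Fq_rational q \<theta>. x - y \<in> val_ball B)"
  by (simp add: K_infinity_def val_closure_iff)

lemma K_inf_const: "c \<in> Fq q \<Longrightarrow> c \<in> K_inf"
  using Fq_rational_const[of c] by (force simp: K_inf_iff)

lemma K_inf_add: "x \<in> K_inf \<Longrightarrow> y \<in> K_inf \<Longrightarrow> x + y \<in> K_inf"
proof -
  assume x: "x \<in> K_inf" and y: "y \<in> K_inf"
  show "x + y \<in> K_inf" unfolding K_inf_iff
  proof
    fix B
    obtain x' y' where *: "x' \<in> Fq_rational q \<theta>" "x - x' \<in> val_ball B"
      "y' \<in> Fq_rational q \<theta>" "y - y' \<in> val_ball B" using x y by (meson K_inf_iff)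
    have "(x - x') + (y - y') \<in> val_ball B" using * by (intro ball_add)
    then show "\<exists>z\<in>Fq_rational q \<theta>. x + y - z \<in> val_ball B"
      using * by (intro bexI[of _ "x' + y'"]) (simp_all add: Fq_rational_add algebra_simps)
  qed
qed

lemma K_inf_mult: "x \<in> K_inf \<Longrightarrow> y \<in> K_inf \<Longrightarrow> x * y \<in> K_inf"
proof -
  assume x: "x \<in> K_inf" and y: "y \<in> K_inf"
  show "x * y \<in> K_inf" unfolding K_inf_iff
  proof
    fix B
    \<comment> \<open>The error is \<open>x * (y - y') + (x - x') * y'\<close>, so \<open>y'\<close>
      is chosen relative to the size of \<open>x\<close>, and only then \<open>x'\<close> relative
      to the size of \<open>y'\<close>.\<close>
    define r where "r = min 0 (val x)"
    have rx: "x \<in> val_ball r" by (simp add: in_ball_iff r_def)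
    obtain y' where y': "y' \<in> Fq_rational q \<theta>" "y - y' \<in> val_ball (B - r)"
      using y by (meson K_inf_iff)
    define s where "s = min 0 (val y')"
    have sy: "y' \<in> val_ball s" by (simp add: in_ball_iff s_def)
    obtain x' where x': "x' \<in> Fq_rational q \<theta>" "x - x' \<in> val_ball (B - s)"
      using x by (meson K_inf_iff)
    have "x * (y - y') + (x - x') * y' \<in> val_ball B"
      using ball_mult[OF rx y'(2)] ball_mult[OF x'(2) sy] by (intro ball_add) simp_all
    then show "\<exists>z\<in>Fq_rational q \<theta>. x * y - z \<in> val_ball B"
      using x' y' by (intro bexI[of _ "x' * y'"]) (simp_all add: Fq_rational_mult algebra_simps)
  qed
qed

lemma K_inf_diff: "x \<in> K_inf \<Longrightarrow> y \<in> K_inf \<Longrightarrow> x - y \<in> K_inf"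
  using K_inf_add[OF _ K_inf_mult[OF K_inf_const[OF Fq_minus[OF Fq_one]]]] by simp

lemma K_bar_iff: "x \<in> K_bar \<longleftrightarrow> (\<exists>p. p \<noteq> 0 \<and> (\<forall>i. coeff p i \<in> K_inf) \<and> poly p x = 0)"
  by (simp add: K_infinity_bar_def algebraic_elements_def)

lemma K_inf_subset_bar: "x \<in> K_inf \<Longrightarrow> x \<in> K_bar"
proof -
  assume x: "x \<in> K_inf"
  have "- x \<in> K_inf" using K_inf_mult[OF K_inf_const[OF Fq_minus[OF Fq_one]] x] by simp
  then show ?thesis unfolding K_bar_iff
    by (intro exI[of _ "[:-x, 1:]"]) (auto simp: coeff_pCons K_inf_const split: nat.split)
qed

lemma K_bar_zero: "0 \<in> K_bar" and K_bar_one: "1 \<in> K_bar"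
  by (simp_all add: K_inf_subset_bar K_inf_const)

text \<open>Polynomials over \<open>K_bar\<close> have roots in \<open>K_bar\<close> by assumption,
  so a quotient is obtained as the root of a linear polynomial. Products then come from two
  quotients, without resultants or degrees of extensions.\<close>

lemma K_bar_linear: "x \<in> K_bar \<Longrightarrow> y \<in> K_bar \<Longrightarrow> y \<noteq> 0 \<Longrightarrow> - (x / y) \<in> K_bar"
proof -
  assume *: "x \<in> K_bar" "y \<in> K_bar" "y \<noteq> 0"
  have "\<exists>z\<in>K_bar. poly [:x, y:] z = 0"
    using * by (intro K_infinity_bar_closed) (auto simp: coeff_pCons K_bar_zero split: nat.split)
  then obtain z where z: "z \<in> K_bar" "x + z * y = 0" by auto
  then have "z = - (x / y)" using * by (simp add: field_simps add_eq_0_iff2)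
  then show ?thesis using z by simp
qed

lemma K_bar_minus: "x \<in> K_bar \<Longrightarrow> - x \<in> K_bar"
  using K_bar_linear[OF _ K_bar_one] by simp

lemma K_bar_divide: "x \<in> K_bar \<Longrightarrow> y \<in> K_bar \<Longrightarrow> x / y \<in> K_bar"
  using K_bar_minus[OF K_bar_linear] by (cases "y = 0") (simp_all add: K_bar_zero)

lemma K_bar_mult: "x \<in> K_bar \<Longrightarrow> y \<in> K_bar \<Longrightarrow> x * y \<in> K_bar"
  using K_bar_divide[OF _ K_bar_divide[OF K_bar_one]] by simp

text \<open>If p annihilates x, then p(X - 1) annihilates x + 1, still with coefficients in
  \<open>K_inf\<close>. Translation by 1 is enough for sums, since x + y = y (x / y + 1).\<close>

lemma K_bar_plus_one: "x \<in> K_bar \<Longrightarrow> x + 1 \<in> K_bar"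
proof -
  assume "x \<in> K_bar"
  then obtain p where p: "p \<noteq> 0" "\<And>i. coeff p i \<in> K_inf" "poly p x = 0" by (auto simp: K_bar_iff)
  have "coeff (pcompose f [:-1, 1:]) i \<in> K_inf" if "\<And>i. coeff f i \<in> K_inf" for f i
    using that
  proof (induction f arbitrary: i)
    case 0 then show ?case by (simp add: K_inf_const)
  next
    case (pCons a f)
    have f: "coeff f i \<in> K_inf" for i using pCons.prems[of "Suc i"] by simp
    have a: "a \<in> K_inf" using pCons.prems[of 0] by simp
    show ?case
    proof (cases i)
      case 0
      then show ?thesis using K_inf_diff[OF a pCons.IH[OF f, of 0]] by (simp add: pcompose_pCons)
    next
      case (Suc j)
      then show ?thesis using K_inf_diff[OF pCons.IH[OF f, of j] pCons.IH[OF f, of i]]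
        by (simp add: pcompose_pCons)
    qed
  qed
  moreover have "pcompose p [:-1, 1:] \<noteq> 0" using p(1) by (simp add: pcompose_eq_0_iff)
  ultimately show "x + 1 \<in> K_bar" unfolding K_bar_iff using p
    by (intro exI[of _ "pcompose p [:-1, 1:]"]) (simp add: poly_pcompose)
qed

lemma K_bar_add: "x \<in> K_bar \<Longrightarrow> y \<in> K_bar \<Longrightarrow> x + y \<in> K_bar"
proof (cases "y = 0")
  case False
  assume "x \<in> K_bar" "y \<in> K_bar"
  then have "y * (x / y + 1) \<in> K_bar" by (intro K_bar_mult K_bar_plus_one K_bar_divide)
  then show ?thesis using False by (simp add: distrib_left)
qed simp

text \<open>The set \<open>F\<close> is a parameter because the result serves \<open>K_bar\<close>
  first and the whole field later. The quotient by X - r stays over \<open>F\<close> since Horner's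
  scheme computes its coefficients from the top without any division.\<close>

lemma splits_over:
  assumes add: "\<And>x y. x \<in> F \<Longrightarrow> y \<in> F \<Longrightarrow> x + y \<in> (F::'c set)"
    and mult: "\<And>x y. x \<in> F \<Longrightarrow> y \<in> F \<Longrightarrow> x * y \<in> F" and zero: "0 \<in> F"
    and root: "\<And>f. degree f > 0 \<Longrightarrow> (\<And>i. coeff f i \<in> F) \<Longrightarrow> \<exists>x\<in>F. poly f x = 0"
    and "f \<noteq> 0" "\<And>i. coeff f i \<in> F"
  shows "\<exists>rs. set rs \<subseteq> F \<and> length rs = degree f \<and> 
     f = smult (lead_coeff f) (prod_list (map (\<lambda>r. [:- r, 1:]) rs))"
  using assms(5,6)
proof (induction "degree f" arbitrary: f)
  case 0
  then obtain c where "f = [:c:]" by (metis degree_eq_zeroE)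
  then show ?case by (intro exI[of _ "[]"]) simp
next
  case (Suc n)
  obtain r where r: "r \<in> F" "poly f r = 0" using root[of f] Suc by auto
  then obtain g where g: "f = [:- r, 1:] * g" by (auto simp: poly_eq_0_iff_dvd)
  then have g0: "g \<noteq> 0" using Suc.prems by auto
  have deg: "degree f = Suc (degree g)" unfolding g using g0 by (subst degree_mult_eq) auto
  have rec: "coeff g k = coeff f (Suc k) + r * coeff g (Suc k)" for k
    unfolding g by simp
  have gF: "coeff g i \<in> F" for i
  proof (cases "i \<le> Suc (degree g)")
    case True
    then show ?thesis
    proof (induction i rule: inc_induct)
      case base show ?case using zero by (simp add: coeff_eq_0)
    next
      case (step k) then show ?case using rec[of k] r Suc.prems by (metis add mult)
    qed
  qed (simp add: coeff_eq_0 zero)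
  obtain rs where rs: "set rs \<subseteq> F" "length rs = degree g"
    "g = smult (lead_coeff g) (prod_list (map (\<lambda>r. [:- r, 1:]) rs))"
    using Suc.hyps(1)[of g] Suc.hyps(2) deg g0 gF by auto
  have lead: "lead_coeff f = lead_coeff g" unfolding g by (subst lead_coeff_mult) simp
  have "f = [:- r, 1:] * smult (lead_coeff g) (prod_list (map (\<lambda>r. [:- r, 1:]) rs))"
    using g rs(3) by (rule subst[rotated])
  then have "f = smult (lead_coeff f) (prod_list (map (\<lambda>r. [:- r, 1:]) (r # rs)))"
    unfolding lead mult_smult_right by (simp only: list.map prod_list.Cons)
  then show ?case using rs r deg by (intro exI[of _ "r # rs"]) auto
qed

text \<open>On a ball a polynomial loses only a fixed amount of valuation. With p = a + X f the
  induction rests on x f(x) - y f(y) = (x - y) f(x) + y (f(x) - f(y)).\<close>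

lemma poly_Lipschitz: "\<exists>D. \<forall>x y t. x \<in> val_ball C \<longrightarrow> y \<in> val_ball C \<longrightarrow> x - y \<in> val_ball t
    \<longrightarrow> poly f x - poly f y \<in> val_ball (t + D)"
proof (induction f)
  case 0 then show ?case by simp
next
  case (pCons a f)
  then obtain D where D: "\<And>x y t. x \<in> val_ball C \<Longrightarrow> y \<in> val_ball C \<Longrightarrow> x - y \<in> val_ball t
    \<Longrightarrow> poly f x - poly f y \<in> val_ball (t + D)" by blast
  have "\<exists>E. \<forall>x. x \<in> val_ball C \<longrightarrow> poly f x \<in> val_ball E"
  proof (induction f)
    case 0 then show ?case by simp
  next
    case (pCons b g)
    then obtain E where E: "\<And>x. x \<in> val_ball C \<Longrightarrow> poly g x \<in> val_ball E" by blast
    show ?case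
    proof (intro exI allI impI)
      fix x assume x: "x \<in> val_ball C"
      have "b \<in> val_ball (min (val b) (C + E))" by (simp add: in_ball_iff)
      moreover have "x * poly g x \<in> val_ball (min (val b) (C + E))"
        using ball_mono[OF ball_mult[OF x E[OF x]]] by simp
      ultimately show "poly (pCons b g) x \<in> val_ball (min (val b) (C + E))"
        by (simp add: ball_add)
    qed
  qed
  then obtain E where E: "\<And>x. x \<in> val_ball C \<Longrightarrow> poly f x \<in> val_ball E" by blast
  show ?case
  proof (intro exI allI impI)
    fix x y t assume x: "x \<in> val_ball C" and y: "y \<in> val_ball C" and t: "x - y \<in> val_ball t"
    have "(x - y) * poly f x \<in> val_ball (t + min E (C + D))"
      using ball_mult[OF t E[OF x]] by (rule ball_mono) simp
    moreover have "y * (poly f x - poly f y) \<in> val_ball (t + min E (C + D))"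
      using ball_mult[OF y D[OF x y t]] by (rule ball_mono) simp
    ultimately have "(x - y) * poly f x + y * (poly f x - poly f y) \<in> val_ball (t + min E (C + D))"
      by (rule ball_add)
    then show "poly (pCons a f) x - poly (pCons a f) y \<in> val_ball (t + min E (C + D))"
      by (simp add: algebra_simps)
  qed
qed

text \<open>Meant for its contrapositive: if a product of n factors has valuation at least n t, then
  some factor has valuation at least t.\<close>

lemma val_prod_list_less:
  "xs \<noteq> [] \<Longrightarrow> (\<And>x. x \<in> set xs \<Longrightarrow> x \<notin> val_ball t) \<Longrightarrow>
    prod_list xs \<noteq> 0 \<and> val (prod_list xs) < real (length xs) * t"
proof (induction xs)
  case (Cons x xs)
  have x: "x \<noteq> 0" "val x < t" using Cons.prems(2)[of x] by (auto simp: in_ball_iff)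
  show ?case
  proof (cases "xs = []")
    case False
    then have "prod_list xs \<noteq> 0 \<and> val (prod_list xs) < real (length xs) * t" using Cons by auto
    then show ?thesis using x by (simp add: val_mult algebra_simps)
  qed (use x in simp)
qed simp

text \<open>
  Approximate the polynomial by polynomials over \<open>K_bar\<close>; since these split over \<open>K_bar\<close>, a root of
  one approximation is close to some root of the next one, so roots can be chosen to be Cauchy.
\<close>

lemma monic_has_root:
  assumes deg: "degree f = n" "n > 0" and monic: "coeff f n = (1::'c)"
  shows "\<exists>x. poly f x = 0"
proof -
  \<comment> \<open>All coefficients have valuation at least \<open>- C\<close>; this confines the
    roots of all approximations to one ball.\<close>
  define C where "C = Max (insert 0 ((\<lambda>i. - val (coeff f i)) ` {..n}))"
  have C0: "C \<ge> 0" unfolding C_def by simp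
  have "- val (coeff f i) \<le> C" if "i \<le> n" for i unfolding C_def using that by (intro Max_ge) auto
  then have fC: "coeff f i \<in> val_ball (- C)" for i
  proof (cases "i \<le> n")
    case True
    from \<open>\<And>i. i \<le> n \<Longrightarrow> - val (coeff f i) \<le> C\<close>[OF this] show ?thesis
      by (simp add: in_ball_iff)
  qed (simp add: deg coeff_eq_0)
  \<comment> \<open>Evaluating at a point of that ball costs at most \<open>n * C\<close>. The
    remaining \<open>n * k\<close> is spread over n linear factors, so one of them has valuation at
    least \<open>k\<close>.\<close>
  define B where "B k = real n * C + real n * real k" for k :: nat
  have B0: "B k \<ge> 0" for k using C0 by (simp add: B_def)
  define c where "c k i = (SOME z. z \<in> K_bar \<and> coeff f i - z \<in> val_ball (B k))" for k i
  have "\<exists>z. z \<in> K_bar \<and> coeff f i - z \<in> val_ball (B k)" for i k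
    using K_infinity_bar_dense val_closure_iff[of "coeff f i" K_bar] by auto
  then have "c k i \<in> K_bar \<and> coeff f i - c k i \<in> val_ball (B k)" for k i
    unfolding c_def by (rule someI_ex)
  then have cK: "c k i \<in> K_bar" and cB: "coeff f i - c k i \<in> val_ball (B k)" for k i
    by blast+
  have cC: "c k i \<in> val_ball (- C)" for k i
  proof -
    have "coeff f i - (coeff f i - c k i) \<in> val_ball (- C)"
      using C0 B0[of k] by (intro ball_diff fC ball_mono[OF cB]) simp
    then show ?thesis by simp
  qed
  define F where "F k = (\<Sum>i<n. monom (c k i) i) + monom 1 n" for k
  have coeff_F: "coeff (F k) i = (if i < n then c k i else if i = n then 1 else 0)" for k i
    by (auto simp: F_def coeff_sum)
  have F_deg: "degree (F k) = n" for k
  proof (rule antisym)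
    show "degree (F k) \<le> n" by (rule degree_le) (simp add: coeff_F)
    show "n \<le> degree (F k)" by (rule le_degree) (simp add: coeff_F)
  qed
  have F_ne: "F k \<noteq> 0" for k using deg F_deg[of k] by auto
  have poly_F: "poly (F k) x = (\<Sum>i<n. c k i * x ^ i) + x ^ n" for k x
    by (simp add: F_def poly_sum poly_monom)
  have poly_f: "poly f x = (\<Sum>i<n. coeff f i * x ^ i) + x ^ n" for x
    unfolding poly_altdef deg(1) using monic by (simp add: lessThan_Suc_atMost[symmetric])
  have term_bound: "a * x ^ i \<in> val_ball (t - real n * C)"
    if "a \<in> val_ball t" "x \<in> val_ball (- C)" "i < n" for a x t i
  proof (cases "i = 0")
    case True then show ?thesis using ball_mono[OF that(1)] C0 by simp
  next
    case False
    then have "x ^ i \<in> val_ball (real i * - C)" using that by (intro ball_power) auto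
    from ball_mult[OF that(1) this] show ?thesis
      by (rule ball_mono) (use that C0 in \<open>simp add: mult_right_mono\<close>)
  qed
  have fF: "poly f x - poly (F k) x \<in> val_ball (real n * real k)" if "x \<in> val_ball (- C)" for x k
  proof -
    have "(\<Sum>i<n. (coeff f i - c k i) * x ^ i) \<in> val_ball (B k - real n * C)"
      using term_bound[OF cB that] by (intro ball_sum) simp
    then show ?thesis by (simp add: poly_f poly_F B_def left_diff_distrib sum_subtractf)
  qed
  have root_ball: "x \<in> val_ball (- C)" if "poly (F k) x = 0" for x k
  proof (rule ccontr)
    assume "x \<notin> val_ball (- C)"
    then have x: "x \<noteq> 0" "val x < - C" by (auto simp: in_ball_iff)
    \<comment> \<open>A lower bound for the terms of degree below n, attained at degree n - 1
      because \<open>val x\<close> is negative. Outside the ball \<open>x ^ n\<close> lies strictly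
      below it and cannot be cancelled.\<close>
    define t where "t = - C + (real n - 1) * val x"
    have "c k i * x ^ i \<in> val_ball t" if "i < n" for i
    proof (cases "c k i = 0")
      case False
      have "(real n - 1) * val x \<le> real i * val x"
        using x C0 that by (intro mult_right_mono_neg) auto
      moreover have "- C \<le> val (c k i)" using cC[of k i] False by (simp add: in_ball_iff)
      ultimately show ?thesis using x False by (simp add: in_ball_iff val_mult val_power t_def)
    qed simp
    then have "(\<Sum>i<n. c k i * x ^ i) \<in> val_ball t" by (intro ball_sum) simp
    moreover have "x ^ n = - (\<Sum>i<n. c k i * x ^ i)"
      using that by (simp add: poly_F add_eq_0_iff)
    ultimately have "x ^ n \<in> val_ball t" by simp
    then have "t \<le> real n * val x" using x by (simp add: in_ball_iff val_power)
    then show False using x by (simp add: t_def algebra_simps)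
  qed
  have next_root: "\<exists>s. poly (F (Suc k)) s = 0 \<and> s - r \<in> val_ball (real k)"
    if r: "poly (F k) r = 0" for k r
  proof -
    obtain rs where rs: "length rs = n" "F (Suc k) = prod_list (map (\<lambda>r. [:- r, 1:]) rs)"
    proof -
      have "\<exists>rs. set rs \<subseteq> K_bar \<and> length rs = degree (F (Suc k)) \<and> 
         F (Suc k) = smult (lead_coeff (F (Suc k))) (prod_list (map (\<lambda>r. [:- r, 1:]) rs))"
        by (rule splits_over[OF K_bar_add K_bar_mult K_bar_zero K_infinity_bar_closed F_ne])
          (auto simp: coeff_F cK K_bar_zero K_bar_one)
      then show thesis using that by (auto simp: F_deg coeff_F)
    qed
    have rC: "r \<in> val_ball (- C)" by (rule root_ball[OF r])
    have "poly f r \<in> val_ball (real n * real k)" using fF[OF rC, of k] r by simp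
    moreover have "poly f r - poly (F (Suc k)) r \<in> val_ball (real n * real k)"
      using fF[OF rC, of "Suc k"] by (rule ball_mono) (simp add: mult_left_mono)
    ultimately have "poly (F (Suc k)) r \<in> val_ball (real n * real k)" 
      using ball_diff[of "poly f r" _ "poly f r - poly (F (Suc k)) r"] by simp
    moreover have "poly (prod_list (map (\<lambda>r. [:- r, 1:]) xs)) r = prod_list (map (\<lambda>s. r - s) xs)" for xs
      by (induction xs) (auto simp: left_diff_distrib)
    ultimately have P: "prod_list (map (\<lambda>s. r - s) rs) \<in> val_ball (real n * real k)"
      using rs by simp
    have "\<exists>x\<in>set (map (\<lambda>s. r - s) rs). x \<in> val_ball (real k)"
    proof (rule ccontr)
      assume "\<not> ?thesis"
      then have "prod_list (map (\<lambda>s. r - s) rs) \<noteq> 0 \<and>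
         val (prod_list (map (\<lambda>s. r - s) rs)) < real (length (map (\<lambda>s. r - s) rs)) * real k"
        using rs deg by (intro val_prod_list_less) auto
      then show False using P rs(1) by (simp add: in_ball_iff)
    qed
    then obtain s where s: "s \<in> set rs" "r - s \<in> val_ball (real k)" by auto
    have "poly (prod_list (map (\<lambda>r. [:- r, 1:]) xs)) s = 0" if "s \<in> set xs" for xs
      using that by (induction xs) auto
    then have "poly (F (Suc k)) s = 0" using s rs by simp
    moreover have "s - r \<in> val_ball (real k)" using s ball_minus_iff[of "r - s"] by simp
    ultimately show ?thesis by blast
  qed
  obtain r0 where r0: "poly (F 0) r0 = 0"
  proof -
    have "\<exists>x\<in>K_bar. poly (F 0) x = 0"
      using deg by (intro K_infinity_bar_closed) (auto simp: F_deg coeff_F cK K_bar_zero K_bar_one)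
    then show thesis using that by blast
  qed
  obtain r where r: "\<And>k. poly (F k) (r k) = 0" "\<And>k. r (Suc k) - r k \<in> val_ball (real k)"
    using dependent_nat_choice[of "\<lambda>k x. poly (F k) x = 0" "\<lambda>k x y. y - x \<in> val_ball (real k)"]
      r0 next_root by blast
  obtain x where x: "\<And>k. x - r k \<in> val_ball (real k)" using Cauchy_limit r(2) by blast
  have rC: "r k \<in> val_ball (- C)" for k by (rule root_ball[OF r(1)])
  have xC: "x \<in> val_ball (- C)"
    using ball_add[OF ball_mono[OF x[of 0], of "- C"] rC[of 0]] C0 by simp
  obtain D where D: "\<And>k. poly f x - poly f (r k) \<in> val_ball (real k + D)"
    using poly_Lipschitz[of "- C" f] xC rC x by metis
  have "poly f x \<in> val_ball t" for t
  proof -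
    obtain k :: nat where k: "real k > max t (t - D)" using reals_Archimedean2 by blast
    have "poly f x - poly f (r k) \<in> val_ball t" using D[of k] by (rule ball_mono) (use k in simp)
    moreover have "real k \<le> real n * real k"
      using mult_right_mono[of 1 "real n" "real k"] deg by simp
    then have "poly f (r k) - poly (F k) (r k) \<in> val_ball t"
      using k by (intro ball_mono[OF fF[OF rC]]) simp
    ultimately have "(poly f x - poly f (r k)) + (poly f (r k) - poly (F k) (r k)) \<in> val_ball t"
      by (rule ball_add)
    then show ?thesis using r(1)[of k] by simp
  qed
  then show ?thesis using zero_if_in_all_balls by blast
qed

lemma has_root:
  assumes "degree f > 0"
  shows "\<exists>x::'c. poly f x = 0"
proof -
  have "f \<noteq> 0" using assms by auto
  then have "\<exists>x. poly (smult (inverse (lead_coeff f)) f) x = 0"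
    using assms by (intro monic_has_root[of _ "degree f"]) auto
  then show ?thesis using \<open>f \<noteq> 0\<close> by auto
qed

lemma splits:
  assumes "f \<noteq> (0::'c poly)"
  obtains rs where "length rs = degree f"
    "f = smult (lead_coeff f) (prod_list (map (\<lambda>r. [:- r, 1:]) rs))"
  using splits_over[of UNIV f] assms has_root by auto

subsection \<open>Roots of large valuation\<close>

lemma val_diff_less:
  assumes "x = 0 \<or> t < val x" "y = 0 \<or> t < val y"
  shows "x - y = 0 \<or> t < val (x - y)"
proof -
  define s where "s = min (if x = 0 then t + 1 else val x) (if y = 0 then t + 1 else val y)"
  have "x \<in> val_ball s" "y \<in> val_ball s" by (auto simp: in_ball_iff s_def)
  then have "x - y \<in> val_ball s" by (rule ball_diff)
  moreover have "t < s" using assms by (auto simp: s_def)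
  ultimately show ?thesis by (auto simp: in_ball_iff)
qed

text \<open>When all roots have valuation below \<zeta>, the constant term strictly dominates at the
  level \<zeta>. A further factor X - r preserves this: it multiplies the constant term by -r, and
  since val r < \<zeta>, both contributions to each other coefficient lose against it.\<close>

lemma newton_polygon_linear_factors:
  assumes "\<And>r. r \<in> set rs \<Longrightarrow> r \<notin> val_ball \<zeta>"
  defines "p \<equiv> prod_list (map (\<lambda>r. [:- r, 1:]) rs)"
  shows "coeff p 0 \<noteq> 0 \<and>
    (\<forall>k>0. coeff p k = 0 \<or> val (coeff p 0) < val (coeff p k) + real k * \<zeta>)"
  using assms(1) unfolding p_def
proof (induction rs)
  case Nil then show ?case by simp
next
  case (Cons r rs)
  define p where "p = prod_list (map (\<lambda>r. [:- r, 1:]) rs)"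
  have p: "coeff p 0 \<noteq> 0"
    "k > 0 \<Longrightarrow> coeff p k = 0 \<or> val (coeff p 0) < val (coeff p k) + real k * \<zeta>" for k
    using Cons unfolding p_def by auto
  have r: "r \<noteq> 0" "val r < \<zeta>" using Cons.prems[of r] by (auto simp: in_ball_iff)
  have eq: "prod_list (map (\<lambda>r. [:- r, 1:]) (r # rs)) = [:- r, 1:] * p"
    by (simp only: list.map prod_list.Cons p_def)
  have p0: "coeff ([:- r, 1:] * p) 0 = - (r * coeff p 0)" by simp
  have v0: "val (- (r * coeff p 0)) = val r + val (coeff p 0)"
    using p r by (simp add: val_minus val_mult)
  have step: "coeff p k - r * coeff p (Suc k) = 0 \<or>
    val r + val (coeff p 0) - real (Suc k) * \<zeta> < val (coeff p k - r * coeff p (Suc k))" for k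
  proof (rule val_diff_less)
    show "coeff p k = 0 \<or> val r + val (coeff p 0) - real (Suc k) * \<zeta> < val (coeff p k)"
      using p(2)[of k] r by (cases "k = 0") (auto simp: algebra_simps)
    show "r * coeff p (Suc k) = 0 \<or>
      val r + val (coeff p 0) - real (Suc k) * \<zeta> < val (r * coeff p (Suc k))"
      using p(2)[of "Suc k"] r by (cases "coeff p (Suc k) = 0") (auto simp: val_mult)
  qed
  show ?case unfolding eq p0 v0
  proof (intro conjI allI impI)
    show "- (r * coeff p 0) \<noteq> 0" using r p by simp
    fix k :: nat assume "k > 0"
    then obtain j where k: "k = Suc j" by (cases k) auto
    show "coeff ([:- r, 1:] * p) k = 0 \<or>
        val r + val (coeff p 0) < val (coeff ([:- r, 1:] * p) k) + real k * \<zeta>"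
      using step[of j] by (auto simp: k)
  qed
qed

text \<open>Comparing the constant term with a single other coefficient already yields a root: if
  all roots were outside the ball, the constant term would strictly dominate every other one.
  Neither the full Newton polygon nor a condition on the derivative enters.\<close>

lemma root_in_ball:
  assumes "k > 0" "coeff f k \<noteq> 0" "coeff f 0 \<in> val_ball (val (coeff f k) + real k * \<zeta>)"
  shows "\<exists>x\<in>val_ball \<zeta>. poly f x = (0::'c)"
proof (rule ccontr)
  assume no: "\<not> ?thesis"
  have f0: "f \<noteq> 0" using assms by auto
  then obtain rs where rs:
    "f = smult (lead_coeff f) (prod_list (map (\<lambda>r. [:- r, 1:]) rs))" by (metis splits)
  define p where "p = prod_list (map (\<lambda>r. [:- r, 1:]) rs)"
  define l where "l = lead_coeff f"
  have l: "l \<noteq> 0" using f0 by (simp add: l_def)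
  have f: "f = smult l p" using rs by (simp add: l_def p_def)
  have "poly p r = 0" if "r \<in> set rs" for r
    unfolding p_def using that by (induction rs) auto
  then have "r \<notin> val_ball \<zeta>" if "r \<in> set rs" for r using no that f by auto
  from newton_polygon_linear_factors[of rs, OF this]
  have "coeff p 0 \<noteq> 0" "val (coeff p 0) < val (coeff p k) + real k * \<zeta>"
    using assms f by (auto simp: p_def)
  then show False using assms f l by (auto simp: in_ball_iff val_mult)
qed

lemma card_roots:
  assumes "f \<noteq> (0::'c poly)" "\<And>x. poly f x = 0 \<Longrightarrow> poly (pderiv f) x \<noteq> 0"
  shows "card {x. poly f x = 0} = degree f"
proof -
  obtain rs where rs: "length rs = degree f"
    "f = smult (lead_coeff f) (prod_list (map (\<lambda>r. [:- r, 1:]) rs))" using splits assms(1) by metis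
  have "distinct rs"
  proof (rule ccontr)
    assume "\<not> distinct rs"
    then obtain xs ys zs r where "rs = xs @ [r] @ ys @ [r] @ zs" using not_distinct_decomp by blast
    then have "[:- r, 1:] * [:- r, 1:] dvd prod_list (map (\<lambda>r. [:- r, 1:]) rs)"
      by (intro dvdI[of _ _ "prod_list (map (\<lambda>r. [:- r, 1:]) (xs @ ys @ zs))"])
        (simp only: map_append prod_list.append list.map prod_list.Cons prod_list.Nil mult_ac mult_1_right mult_1_left)
    then have "[:- r, 1:] * [:- r, 1:] dvd f" using rs(2) by (metis dvd_smult)
    then obtain h where "f = ([:- r, 1:] * [:- r, 1:]) * h" by (rule dvdE)
    then have h: "f = [:- r, 1:] * ([:- r, 1:] * h)" by (simp only: mult.assoc)
    have "poly (pderiv f) r = 0" unfolding h pderiv_mult[of "[:- r, 1:]"] by simp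
    moreover have "poly f r = 0" unfolding h by simp
    ultimately show False using assms(2) by blast
  qed
  have roots: "poly (prod_list (map (\<lambda>r. [:- r, 1:]) xs)) x = 0 \<longleftrightarrow> x \<in> set xs" for x :: 'c and xs
    by (induction xs) (auto simp: algebra_simps)
  have "lead_coeff f \<noteq> 0" using assms by simp
  then have "{x. poly f x = 0} = set rs"
    using roots[of rs] by (subst rs(2)) auto
  then show ?thesis using \<open>distinct rs\<close> rs(1) by (simp add: distinct_card)
qed

lemma q_root: "\<exists>y::'c. y ^ q = x"
proof -
  have "degree (monom 1 q - [:x:]) = q"
  proof (rule antisym)
    show "degree (monom 1 q - [:x:]) \<le> q" by (intro degree_diff_le) (simp_all add: degree_monom_eq)
    show "q \<le> degree (monom 1 q - [:x:])"
      by (rule le_degree) (use q_pos in \<open>cases q; simp\<close>)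
  qed
  then obtain y where "poly (monom 1 q - [:x:]) y = 0" using has_root q_pos by metis
  then show ?thesis by (auto simp: poly_monom)
qed

lemma q_power_char_zero: "k > 0 \<Longrightarrow> (of_nat (q ^ k) :: 'c) = 0"
  using q_char_zero by simp

text \<open>The recursion has order two, so dependent choice runs over pairs of consecutive terms,
  with 0 standing before \<open>x0\<close>. The exponent \<open>k\<close> may vary from step to
  step, which later allows the linear and the middle coefficient to take turns.\<close>

lemma lift_sequence:
  fixes f :: "'c poly" and R :: "'c \<Rightarrow> 'c \<Rightarrow> 'c" and \<zeta> :: "nat \<Rightarrow> real"
  assumes f0: "coeff f 0 = 0" and x0: "x0 \<in> val_ball (\<zeta> 0)"
    and step: "\<And>i y z. y \<in> val_ball (\<zeta> i) \<Longrightarrow> (if i = 0 then z = 0 else z \<in> val_ball (\<zeta> (i - 1))) \<Longrightarrow>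
      \<exists>k>0. coeff f k \<noteq> 0 \<and> R y z \<in> val_ball (val (coeff f k) + real k * \<zeta> (Suc i))"
  shows "\<exists>x. x 0 = x0 \<and> (\<forall>i. x i \<in> val_ball (\<zeta> i)) \<and>
     (\<forall>i. poly f (x (Suc i)) = R (x i) (if i = 0 then 0 else x (i - 1)))"
proof -
  define I where "I i s \<longleftrightarrow> fst s \<in> val_ball (\<zeta> i) \<and>
    (if i = 0 then s = (x0, 0) else snd s \<in> val_ball (\<zeta> (i - 1)))" for i and s :: "'c \<times> 'c"
  define J where "J s s' \<longleftrightarrow> snd s' = fst s \<and> poly f (fst s') = R (fst s) (snd s)"
    for s s' :: "'c \<times> 'c"
  have "\<exists>s'. I (Suc i) s' \<and> J s s'" if "I i s" for i s
  proof -
    have y: "fst s \<in> val_ball (\<zeta> i)" using that by (simp add: I_def)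
    have "if i = 0 then snd s = 0 else snd s \<in> val_ball (\<zeta> (i - 1))"
      using that by (auto simp: I_def)
    from step[OF y this] obtain k where k: "k > 0" "coeff f k \<noteq> 0"
      "R (fst s) (snd s) \<in> val_ball (val (coeff f k) + real k * \<zeta> (Suc i))" by blast
    define g where "g = f - [:R (fst s) (snd s):]"
    have "coeff g k = coeff f k" "coeff g 0 = - R (fst s) (snd s)"
      using k f0 by (auto simp: g_def coeff_pCons split: nat.split)
    then obtain x where "x \<in> val_ball (\<zeta> (Suc i))" "poly g x = 0"
      using root_in_ball[of k g] k by auto
    then show ?thesis using y by (intro exI[of _ "(x, fst s)"]) (auto simp: I_def J_def g_def)
  qed
  moreover have "\<exists>s. I 0 s" using x0 by (auto simp: I_def)
  ultimately obtain s where s: "\<And>i. I i (s i)" "\<And>i. J (s i) (s (Suc i))"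
    using dependent_nat_choice[of I "\<lambda>i. J"] by metis
  have "snd (s i) = (if i = 0 then 0 else fst (s (i - 1)))" for i
    using s(1)[of 0] s(2)[of "i - 1"] by (cases i) (auto simp: I_def J_def)
  then show ?thesis using s by (intro exI[of _ "\<lambda>i. fst (s i)"]) (auto simp: I_def J_def)
qed

section \<open>The additive system and the lifting property of its kernel\<close>

definition sys_kernel :: "'c \<Rightarrow> 'c \<Rightarrow> ('c \<times> 'c) set"
  where "sys_kernel a b =
    {(x, y). \<theta> ^ q * x ^ q\<^sup>2 + b * y ^ q + x = 0 \<and> \<theta> ^ q * y ^ q\<^sup>2 + a * x ^ q + y = 0}"

definition null_seq :: "(nat \<Rightarrow> 'c) \<Rightarrow> bool"
  where "null_seq X \<longleftrightarrow> (\<forall>r. \<exists>N. \<forall>n\<ge>N. X n \<in> val_ball r)"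

definition sys_solution :: "'c \<Rightarrow> 'c \<Rightarrow> (nat \<Rightarrow> 'c) \<Rightarrow> (nat \<Rightarrow> 'c) \<Rightarrow> bool"
  where "sys_solution a b X Y \<longleftrightarrow> null_seq X \<and> null_seq Y \<and>
    (\<forall>i. \<theta> ^ q * X i ^ q\<^sup>2 + b * Y i ^ q + X i = (if i = 0 then 0 else X (i - 1) ^ q\<^sup>2) \<and>
         \<theta> ^ q * Y i ^ q\<^sup>2 + a * X i ^ q + Y i = (if i = 0 then 0 else Y (i - 1) ^ q\<^sup>2))"

definition liftable :: "'c \<Rightarrow> 'c \<Rightarrow> bool"
  where "liftable a b \<longleftrightarrow>
    (\<forall>(x, y)\<in>sys_kernel a b. \<exists>X Y. sys_solution a b X Y \<and> X 0 = x \<and> Y 0 = y)"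

lemma sys_solution_swap: "sys_solution a b X Y \<Longrightarrow> sys_solution b a Y X"
  by (auto simp: sys_solution_def)

lemma sys_kernel_swap: "(x, y) \<in> sys_kernel a b \<longleftrightarrow> (y, x) \<in> sys_kernel b a"
  by (auto simp: sys_kernel_def)

lemma liftable_swap: "liftable a b \<Longrightarrow> liftable b a"
proof -
  assume l: "liftable a b"
  show "liftable b a" unfolding liftable_def
  proof clarify
    fix x y assume "(x, y) \<in> sys_kernel b a"
    then have "(y, x) \<in> sys_kernel a b" by (simp add: sys_kernel_swap)
    then obtain X Y where "sys_solution a b X Y" "X 0 = y" "Y 0 = x" using l by (auto simp: liftable_def)
    then show "\<exists>X Y. sys_solution b a X Y \<and> X 0 = x \<and> Y 0 = y" using sys_solution_swap by blast
  qed
qed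

lemma null_seq_linear:
  assumes "\<delta> > 0" "\<And>i. X i \<in> val_ball (c + real i * \<delta>)"
  shows "null_seq X"
  unfolding null_seq_def
proof
  fix r
  obtain N :: nat where N: "real N > (r - c) / \<delta>" using reals_Archimedean2 by blast
  have "X n \<in> val_ball r" if "n \<ge> N" for n
  proof (rule ball_mono[OF assms(2)])
    have "(r - c) / \<delta> \<le> real n" using N that by simp
    then show "r \<le> c + real n * \<delta>" using assms(1) by (simp add: field_simps)
  qed
  then show "\<exists>N. \<forall>n\<ge>N. X n \<in> val_ball r" by blast
qed

lemma q_real: "real q \<ge> 2"
  using q_ge_2 by simp

subsection \<open>Elimination of one unknown\<close>

text \<open>The second equation is raised to the power q and multiplied by
  \<open>b ^ q\<^sup>2\<close>. Then y occurs only through \<open>b * y ^ q\<close>, which the first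
  equation expresses by x. The terms in the current coefficient are collected here; those in the
  previous one and the one before it form \<open>elim_rhs\<close>.\<close>

definition elim_poly :: "'c \<Rightarrow> 'c \<Rightarrow> 'c poly"
  where "elim_poly a b = monom (\<theta> ^ q\<^sup>2 * \<theta> ^ q ^ 3) (q ^ 4) +
    monom (\<theta> ^ q\<^sup>2 - a ^ q * b ^ q\<^sup>2 + b ^ (q\<^sup>2 - 1) * \<theta> ^ q) (q\<^sup>2) + monom (b ^ (q\<^sup>2 - 1)) 1"

definition elim_rhs :: "'c \<Rightarrow> 'c \<Rightarrow> 'c \<Rightarrow> 'c"
  where "elim_rhs b y z = (\<theta> ^ q\<^sup>2 + \<theta> ^ q ^ 3) * y ^ q ^ 4 + (1 + b ^ (q\<^sup>2 - 1)) * y ^ q\<^sup>2 - z ^ q ^ 4"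

lemma frob_comp: "i + j = k \<Longrightarrow> ((x::'c) ^ q ^ i) ^ q ^ j = x ^ q ^ k"
  by (auto simp: power_mult[symmetric] power_add[symmetric])

text \<open>No information is lost, because the Frobenius map is injective and \<open>b\<close> is
  nonzero. The elements \<open>x'\<close> and \<open>x''\<close> are the coefficients one and two
  places before \<open>x\<close>.\<close>

lemma elim_identity:
  assumes b: "b \<noteq> 0"
    and y: "b * y ^ q = x' ^ q\<^sup>2 - \<theta> ^ q * x ^ q\<^sup>2 - x"
    and y': "b * y' ^ q = x'' ^ q\<^sup>2 - \<theta> ^ q * x' ^ q\<^sup>2 - x'"
  shows "\<theta> ^ q * y ^ q\<^sup>2 + a * x ^ q + y = y' ^ q\<^sup>2 \<longleftrightarrow> poly (elim_poly a b) x = elim_rhs b x' x''"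
proof -
  have eq: "b ^ q\<^sup>2 * z ^ q ^ 3 = (b * z ^ q) ^ q\<^sup>2" for z
    using frob_comp[of 1 2 3 z] by (simp add: power_mult_distrib)
  have exp: "(w ^ q\<^sup>2 - \<theta> ^ q * v ^ q\<^sup>2 - v) ^ q\<^sup>2 = w ^ q ^ 4 - \<theta> ^ q ^ 3 * v ^ q ^ 4 - v ^ q\<^sup>2" for v w
    using frob_comp[of 2 2 4 v] frob_comp[of 2 2 4 w] frob_comp[of 1 2 3 \<theta>]
    by (simp add: frob_diff power_mult_distrib)
  have bb: "b ^ q\<^sup>2 = b ^ (q\<^sup>2 - 1) * b"
    by (metis power_minus_mult q_pos zero_less_power)
  have "\<theta> ^ q * y ^ q\<^sup>2 + a * x ^ q + y = y' ^ q\<^sup>2 \<longleftrightarrow>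
     b ^ q\<^sup>2 * (\<theta> ^ q * y ^ q\<^sup>2 + a * x ^ q + y) ^ q = b ^ q\<^sup>2 * (y' ^ q\<^sup>2) ^ q"
    using b frob_q_inj by auto
  also have "b ^ q\<^sup>2 * (\<theta> ^ q * y ^ q\<^sup>2 + a * x ^ q + y) ^ q =
     \<theta> ^ q\<^sup>2 * (b ^ q\<^sup>2 * y ^ q ^ 3) + a ^ q * b ^ q\<^sup>2 * x ^ q\<^sup>2 + b ^ (q\<^sup>2 - 1) * (b * y ^ q)"
    using frob_comp[of 2 1 3 y] frob_comp[of 1 1 2 x] frob_comp[of 1 1 2 \<theta>]
      bb by (simp add: frob_q_add power_mult_distrib algebra_simps)
  also have "b ^ q\<^sup>2 * (y' ^ q\<^sup>2) ^ q = b ^ q\<^sup>2 * y' ^ q ^ 3"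
    using frob_comp[of 2 1 3 y'] by simp
  finally show ?thesis
    unfolding eq y y' exp
    by (simp add: elim_poly_def elim_rhs_def poly_monom algebra_simps) metis
qed

lemma coeff_elim_poly:
  "coeff (elim_poly a b) 0 = 0" 
  "coeff (elim_poly a b) 1 = b ^ (q\<^sup>2 - 1)"
  "coeff (elim_poly a b) (q\<^sup>2) = \<theta> ^ q\<^sup>2 - a ^ q * b ^ q\<^sup>2 + b ^ (q\<^sup>2 - 1) * \<theta> ^ q"
  "coeff (elim_poly a b) (q ^ 4) = \<theta> ^ q\<^sup>2 * \<theta> ^ q ^ 3"
  "degree (elim_poly a b) = q ^ 4"
proof -
  have q1: "1 < q\<^sup>2" "q\<^sup>2 < q ^ 4"
    using q_ge_2 one_less_power[of q 2] by (auto intro: power_strict_increasing)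
  show "coeff (elim_poly a b) 0 = 0" 
    "coeff (elim_poly a b) 1 = b ^ (q\<^sup>2 - 1)"
    "coeff (elim_poly a b) (q\<^sup>2) = \<theta> ^ q\<^sup>2 - a ^ q * b ^ q\<^sup>2 + b ^ (q\<^sup>2 - 1) * \<theta> ^ q"
    using q1 by (auto simp: elim_poly_def)
  show c: "coeff (elim_poly a b) (q ^ 4) = \<theta> ^ q\<^sup>2 * \<theta> ^ q ^ 3"
    using q1 by (auto simp: elim_poly_def)
  show "degree (elim_poly a b) = q ^ 4"
  proof (rule antisym)
    show "degree (elim_poly a b) \<le> q ^ 4" unfolding elim_poly_def
      using q1 by (intro degree_add_le order.trans[OF degree_monom_le]) auto
    show "q ^ 4 \<le> degree (elim_poly a b)" using c theta_nonzero by (intro le_degree) simp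
  qed
qed

lemma elim_kernel:
  assumes b: "b \<noteq> 0"
  shows "(x, y) \<in> sys_kernel a b \<longleftrightarrow>
    b * y ^ q = - (\<theta> ^ q * x ^ q\<^sup>2) - x \<and> poly (elim_poly a b) x = 0"
proof -
  have "\<theta> ^ q * x ^ q\<^sup>2 + b * y ^ q + x = 0 \<longleftrightarrow> b * y ^ q = - (\<theta> ^ q * x ^ q\<^sup>2) - x"
    by (simp add: eq_diff_eq eq_neg_iff_add_eq_0 add_ac)
  moreover have "\<theta> ^ q * y ^ q\<^sup>2 + a * x ^ q + y = 0 \<longleftrightarrow> poly (elim_poly a b) x = 0"
    if "b * y ^ q = - (\<theta> ^ q * x ^ q\<^sup>2) - x"
    using elim_identity[OF b, of y 0 x 0 0 a] that by (simp add: zero_power elim_rhs_def)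
  ultimately show ?thesis unfolding sys_kernel_def by auto
qed

text \<open>The derivative of an additive polynomial is its linear coefficient, here nonzero, so all
  \<open>q ^ 4\<close> roots are simple. Each root belongs to exactly one kernel element because
  q-th roots exist and are unique.\<close>

lemma finite_card_elim_kernel:
  assumes b: "b \<noteq> 0"
  shows "finite (sys_kernel a b)" "card (sys_kernel a b) = q ^ 4"
proof -
  let ?f = "elim_poly a b"
  have f0: "?f \<noteq> 0" using coeff_elim_poly(2)[of a b] b by auto
  have "pderiv ?f = [:b ^ (q\<^sup>2 - 1):]"
    unfolding elim_poly_def pderiv_add pderiv_monom
    using q_power_char_zero[of 4] q_power_char_zero[of 2] by (simp add: monom_0)
  then have "card {x. poly ?f x = 0} = q ^ 4"
    using card_roots[OF f0] b coeff_elim_poly(5)[of a b] by simp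
  moreover have "bij_betw fst (sys_kernel a b) {x. poly ?f x = 0}"
    unfolding bij_betw_def
  proof
    show "inj_on fst (sys_kernel a b)"
    proof (rule inj_onI)
      fix p p' assume "p \<in> sys_kernel a b" "p' \<in> sys_kernel a b" "fst p = fst p'"
      moreover from this have "b * snd p ^ q = b * snd p' ^ q"
        by (cases p, cases p') (simp add: elim_kernel[OF b])
      then have "snd p = snd p'" using b frob_q_inj by auto
      ultimately show "p = p'" by (simp add: prod_eq_iff)
    qed
    show "fst ` sys_kernel a b = {x. poly ?f x = 0}"
    proof
      show "fst ` sys_kernel a b \<subseteq> {x. poly ?f x = 0}" by (auto simp: elim_kernel[OF b])
      show "{x. poly ?f x = 0} \<subseteq> fst ` sys_kernel a b"
      proof clarify
        fix x assume x: "poly ?f x = 0"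
        obtain y where "y ^ q = (- (\<theta> ^ q * x ^ q\<^sup>2) - x) / b" using q_root by blast
        then have "(x, y) \<in> sys_kernel a b" using x b by (subst elim_kernel[OF b]) simp
        then show "x \<in> fst ` sys_kernel a b" by force
      qed
    qed
  qed
  moreover have "finite {x. poly ?f x = 0}" using f0 by (rule poly_roots_finite)
  ultimately show "finite (sys_kernel a b)" "card (sys_kernel a b) = q ^ 4"
    by (simp_all add: bij_betw_finite bij_betw_same_card)
qed

text \<open>The second sequence is read off the first equation by q-th roots. Their uniqueness
  forces its start to be the prescribed \<open>y0\<close>.\<close>

lemma elim_lift:
  assumes b: "b \<noteq> 0" and ker: "(x0, y0) \<in> sys_kernel a b"
    and X0: "X 0 = x0" and X: "null_seq X"
    and rec: "\<And>i. poly (elim_poly a b) (X (Suc i)) = elim_rhs b (X i) (if i = 0 then 0 else X (i - 1))"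
  shows "\<exists>Y. sys_solution a b X Y \<and> Y 0 = y0"
proof -
  define X' where "X' i = (if i = 0 then 0 else X (i - 1))" for i
  define Y where "Y i = (SOME y. y ^ q = (X' i ^ q\<^sup>2 - \<theta> ^ q * X i ^ q\<^sup>2 - X i) / b)" for i
  have "Y i ^ q = (X' i ^ q\<^sup>2 - \<theta> ^ q * X i ^ q\<^sup>2 - X i) / b" for i
    unfolding Y_def by (rule someI_ex) (rule q_root)
  then have Y: "b * Y i ^ q = X' i ^ q\<^sup>2 - \<theta> ^ q * X i ^ q\<^sup>2 - X i" for i using b by simp
  have Y0: "Y 0 = y0"
  proof -
    have "b * Y 0 ^ q = b * y0 ^ q" using Y[of 0] ker X0 by (simp add: X'_def elim_kernel[OF b] zero_power)
    then show ?thesis using b frob_q_inj by auto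
  qed
  have E1: "\<theta> ^ q * X i ^ q\<^sup>2 + b * Y i ^ q + X i = (if i = 0 then 0 else X (i - 1) ^ q\<^sup>2)" for i
    using Y[of i] by (simp add: X'_def zero_power)
  have E2: "\<theta> ^ q * Y i ^ q\<^sup>2 + a * X i ^ q + Y i = (if i = 0 then 0 else Y (i - 1) ^ q\<^sup>2)" for i
  proof (cases i)
    case 0
    then show ?thesis using ker X0 Y0 by (simp add: sys_kernel_def)
  next
    case (Suc j)
    show ?thesis using elim_identity[OF b Y[of i] , of "Y j" "X' j" a] Y[of j] rec[of j]
      by (simp add: Suc X'_def)
  qed
  have "null_seq Y" unfolding null_seq_def
  proof
    fix r
    \<comment> \<open>For \<open>s \<ge> 1\<close> one has \<open>q\<^sup>2 * s - q \<ge> s\<close>,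
      so all three terms of \<open>b * Y n ^ q\<close> inherit the bound \<open>s\<close>. The other
      entry of the maximum is what survives division by \<open>b\<close> and a q-th root. One extra
      index is spent on the previous coefficient in \<open>X'\<close>.\<close>
    define s where "s = max 1 (real q * r + val b)"
    obtain N where N: "\<And>n. n \<ge> N \<Longrightarrow> X n \<in> val_ball s" using X unfolding null_seq_def by blast
    have "Y n \<in> val_ball r" if "n \<ge> Suc N" for n
    proof -
      have s1: "s \<ge> 1" by (simp add: s_def)
      have qs: "real q * s \<le> real q * (real q * s) - real q"
      proof -
        have "real q * (1 * s + 1) \<le> real q * (real q * s)"
        proof (rule mult_left_mono)
          have "2 * s \<le> real q * s" using s1 q_real by (intro mult_right_mono) auto
          then show "1 * s + 1 \<le> real q * s" using s1 by linarith
        qed simp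
        then show ?thesis by (simp add: algebra_simps)
      qed
      have qs': "s \<le> real q * s" using mult_right_mono[of 1 "real q" s] s1 q_real by simp
      have pw: "x ^ q\<^sup>2 \<in> val_ball (real q * (real q * s))" if "x \<in> val_ball s" for x
        using ball_power[OF that, of "q\<^sup>2"] by (simp add: power2_eq_square mult_ac)
      have th: "\<theta> ^ q \<in> val_ball (- real q)" by (simp add: in_ball_iff val_power val_theta theta_nonzero)
      have "X' n ^ q\<^sup>2 \<in> val_ball s" using that N[of "n - 1"] qs qs'
        by (intro ball_mono[OF pw]) (auto simp: X'_def)
      moreover have "\<theta> ^ q * X n ^ q\<^sup>2 \<in> val_ball s" using that N[of n] qs qs'
        by (intro ball_mono[OF ball_mult[OF th pw]]) auto
      ultimately have "b * Y n ^ q \<in> val_ball s"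
        unfolding Y using that N[of n] by (intro ball_diff) auto
      then have "Y n ^ q \<in> val_ball (s - val b)" using ball_val_cancel[OF b] by blast
      then have "Y n ^ q \<in> val_ball (real q * r)" by (rule ball_mono) (simp add: s_def)
      then show ?thesis by (cases "Y n = 0") (auto simp: in_ball_iff val_power)
    qed
    then show "\<exists>N. \<forall>n\<ge>N. Y n \<in> val_ball r" by blast
  qed
  then have "sys_solution a b X Y" using X E1 E2 by (auto simp: sys_solution_def)
  then show ?thesis using Y0 by blast
qed

text \<open>
  The coefficients \<open>X i\<close> of a solution are found at the levels \<open>val (X i) \<ge> Z + i * \<delta>\<close>. The assumption
  \<open>ker\<close> puts the roots of \<open>elim_poly a b\<close> at level \<open>Z\<close>; by \<open>step\<close>, \<open>elim_rhs\<close> is small enough for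
  \<open>root_in_ball\<close>, applied with \<open>k = 1\<close> or \<open>k = q\<^sup>2\<close>, to give a root one level higher.
\<close>

lemma elim_liftable_aux:
  fixes a b :: 'c and Z \<delta> :: real
  defines "A1 \<equiv> \<theta> ^ q\<^sup>2 - a ^ q * b ^ q\<^sup>2 + b ^ (q\<^sup>2 - 1) * \<theta> ^ q"
  defines "u \<equiv> real q" and "Q \<equiv> (real q)\<^sup>2"
  defines "L0 \<equiv> (Q - 1) * val b" and "L2 \<equiv> - (Q + u * Q)"
  defines "\<mu> \<equiv> min 0 L0"
  assumes b: "b \<noteq> 0" and \<delta>: "\<delta> > 0" "Q * Q * \<delta> \<le> 1"
    and ker: "\<And>z. z < Z \<Longrightarrow> L2 + Q * Q * z < L0 + z \<and> (A1 \<noteq> 0 \<longrightarrow> L2 + Q * Q * z < val A1 + Q * z)"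
    and step: "\<And>t. t \<ge> Z \<Longrightarrow> L0 + t + \<delta> \<le> L2 + Q * Q * t + 2 \<and> L0 + t + \<delta> \<le> \<mu> + Q * t \<and> 
        (t - \<delta> \<ge> Z \<longrightarrow> L0 + t + \<delta> \<le> L2 + Q * Q * (t - \<delta>) + 2) \<or>
      A1 \<noteq> 0 \<and> val A1 + Q * (t + \<delta>) \<le> L2 + Q * Q * t + 2 \<and> val A1 + Q * (t + \<delta>) \<le> \<mu> + Q * t \<and>
        (t - \<delta> \<ge> Z \<longrightarrow> val A1 + Q * (t + \<delta>) \<le> L2 + Q * Q * (t - \<delta>) + 2)"
  shows "liftable a b"
  unfolding liftable_def
proof clarify
  fix x0 y0 assume xy: "(x0, y0) \<in> sys_kernel a b"
  let ?f = "elim_poly a b"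
  have u2: "u \<ge> 2" using q_real by (simp add: u_def)
  have Qu: "Q = u * u" by (simp add: Q_def u_def power2_eq_square)
  have Q4: "Q \<ge> 4" using mult_mono[of 2 u 2 u] u2 by (simp add: Qu)
  have vb: "val (b ^ (q\<^sup>2 - 1)) = L0"
  proof -
    have "real (q\<^sup>2 - 1) = Q - 1" by (subst of_nat_diff) (auto simp: Q_def Suc_le_eq)
    then show ?thesis using b by (simp add: val_power L0_def)
  qed
  have rq: "real (q\<^sup>2) = Q" "real (q ^ 3) = u * Q" "real (q ^ 4) = Q * Q"
    by (simp_all add: Q_def u_def power3_eq_cube power4_eq_xxxx power2_eq_square)
  have vt: "val (\<theta> ^ n) = - real n" for n by (simp add: val_power theta_nonzero val_theta)
  have f0: "coeff ?f 0 = 0" and f1: "coeff ?f 1 = b ^ (q\<^sup>2 - 1)" and fQ: "coeff ?f (q\<^sup>2) = A1"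
    by (simp_all only: coeff_elim_poly A1_def)
  have vL2: "val (\<theta> ^ q\<^sup>2 * \<theta> ^ q ^ 3) = L2"
  proof -
    have "val (\<theta> ^ q\<^sup>2 * \<theta> ^ q ^ 3) = val (\<theta> ^ q\<^sup>2) + val (\<theta> ^ q ^ 3)"
      using theta_nonzero by (intro val_mult) auto
    then show ?thesis by (simp only: vt rq L2_def)
  qed
  \<comment> \<open>Below the level \<open>Z\<close> the leading term has strictly the smallest
    valuation, so no root can lie there.\<close>
  have x0Z: "x0 \<in> val_ball Z"
  proof (rule ccontr)
    assume "x0 \<notin> val_ball Z"
    then have x: "x0 \<noteq> 0" "val x0 < Z" by (auto simp: in_ball_iff)
    define t where "t = L2 + Q * Q * val x0"
    have "poly ?f x0 = 0" using xy elim_kernel[OF b] by blast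
    then have eq: "\<theta> ^ q\<^sup>2 * \<theta> ^ q ^ 3 * x0 ^ q ^ 4 =
        - (A1 * x0 ^ q\<^sup>2) - b ^ (q\<^sup>2 - 1) * x0"
      by (simp add: elim_poly_def poly_monom A1_def eq_diff_eq eq_neg_iff_add_eq_0 add_ac)
    have vl: "val (\<theta> ^ q\<^sup>2 * \<theta> ^ q ^ 3 * x0 ^ q ^ 4) = t"
    proof -
      have "val (x0 ^ q ^ 4) = Q * Q * val x0" using val_power[OF x(1), of "q ^ 4"] by (simp only: rq)
      then show ?thesis
        using x theta_nonzero val_mult[of "\<theta> ^ q\<^sup>2 * \<theta> ^ q ^ 3" "x0 ^ q ^ 4"] vL2 by (simp add: t_def)
    qed
    have "- (A1 * x0 ^ q\<^sup>2) - b ^ (q\<^sup>2 - 1) * x0 = 0 \<or> t < val (- (A1 * x0 ^ q\<^sup>2) - b ^ (q\<^sup>2 - 1) * x0)"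
    proof (rule val_diff_less)
      show "- (A1 * x0 ^ q\<^sup>2) = 0 \<or> t < val (- (A1 * x0 ^ q\<^sup>2))"
        using ker[OF x(2)] x by (cases "A1 = 0") (simp_all add: val_minus val_mult val_power Q_def t_def)
      show "b ^ (q\<^sup>2 - 1) * x0 = 0 \<or> t < val (b ^ (q\<^sup>2 - 1) * x0)"
        using ker[OF x(2)] x b by (simp add: val_mult vb[unfolded One_nat_def] t_def)
    qed
    then show False using vl x theta_nonzero unfolding eq[symmetric] by auto
  qed
  define \<zeta> where "\<zeta> i = Z + real i * \<delta>" for i
  have "\<exists>X. X 0 = x0 \<and> (\<forall>i. X i \<in> val_ball (\<zeta> i)) \<and>
     (\<forall>i. poly ?f (X (Suc i)) = elim_rhs b (X i) (if i = 0 then 0 else X (i - 1)))"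
  proof (rule lift_sequence[OF f0])
    show "x0 \<in> val_ball (\<zeta> 0)" using x0Z by (simp add: \<zeta>_def)
    fix i y z
    assume y: "y \<in> val_ball (\<zeta> i)" and z: "if i = 0 then z = 0 else z \<in> val_ball (\<zeta> (i - 1))"
    define t where "t = \<zeta> i"
    have t: "t \<ge> Z" "\<zeta> (Suc i) = t + \<delta>" using \<delta> by (simp_all add: t_def \<zeta>_def algebra_simps)
    \<comment> \<open>At the first step there is no coefficient before the previous one and
      \<open>z = 0\<close>; hence \<open>step\<close> asks for the bound at
      \<open>t - \<delta>\<close> only when that level is at least \<open>Z\<close>.\<close>
    have z': "z = 0 \<or> t - \<delta> \<ge> Z \<and> z \<in> val_ball (t - \<delta>)"
    proof (cases i)
      case (Suc j)
      then have "t - \<delta> = \<zeta> j" by (simp add: t_def \<zeta>_def algebra_simps)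
      then show ?thesis using z Suc \<delta> by (simp add: \<zeta>_def)
    qed (use z in simp)
    have uQ: "2 \<le> Q" "2 \<le> u * Q" using Q4 u2 mult_mono[of 1 u 4 Q] by auto
    \<comment> \<open>The leading coefficient is the product of these two powers of \<theta>, while
      the right-hand side contains their sum. The valuation of the sum exceeds \<open>L2\<close> by
      at least 2, which is the origin of the 2 in \<open>step\<close>.\<close>
    have c1: "\<theta> ^ q\<^sup>2 + \<theta> ^ q ^ 3 \<in> val_ball (L2 + 2)"
      using uQ theta_nonzero by (intro ball_add) (simp_all add: in_ball_iff vt L2_def rq flip: of_nat_power)
    have c2: "1 + b ^ (q\<^sup>2 - 1) \<in> val_ball \<mu>"
      using b by (intro ball_add) (simp_all add: in_ball_iff vb[unfolded One_nat_def] val_one \<mu>_def)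
    have in_rhs: "elim_rhs b y z \<in> val_ball s"
      if "s \<le> L2 + Q * Q * t + 2" "s \<le> \<mu> + Q * t" "t - \<delta> \<ge> Z \<longrightarrow> s \<le> L2 + Q * Q * (t - \<delta>) + 2" for s
    proof -
      have y4: "y ^ q ^ 4 \<in> val_ball (Q * Q * t)" and y2: "y ^ q\<^sup>2 \<in> val_ball (Q * t)"
        using ball_power[OF y, of "q ^ 4"] ball_power[OF y, of "q\<^sup>2"] by (simp_all only: rq t_def) simp_all
      have z4: "z ^ q ^ 4 \<in> val_ball s"
      proof (cases "z = 0")
        case False
        then have "z \<in> val_ball (t - \<delta>)" "t - \<delta> \<ge> Z" using z' by auto
        then have "z ^ q ^ 4 \<in> val_ball (Q * Q * (t - \<delta>))"
          using ball_power[of z "t - \<delta>" "q ^ 4"] by (simp only: rq) simp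
        then show ?thesis using that \<open>t - \<delta> \<ge> Z\<close> uQ by (elim ball_mono) (simp add: L2_def)
      qed (simp add: zero_power)
      show ?thesis unfolding elim_rhs_def
        using ball_mono[OF ball_mult[OF c1 y4], of s] ball_mono[OF ball_mult[OF c2 y2], of s] z4 that
        by (intro ball_diff ball_add) auto
    qed
    from step[OF t(1)] show "\<exists>k>0. coeff ?f k \<noteq> 0 \<and>
        elim_rhs b y z \<in> val_ball (val (coeff ?f k) + real k * \<zeta> (Suc i))"
    proof (elim disjE)
      assume *: "L0 + t + \<delta> \<le> L2 + Q * Q * t + 2 \<and> L0 + t + \<delta> \<le> \<mu> + Q * t \<and> 
        (t - \<delta> \<ge> Z \<longrightarrow> L0 + t + \<delta> \<le> L2 + Q * Q * (t - \<delta>) + 2)"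
      then have "elim_rhs b y z \<in> val_ball (L0 + t + \<delta>)" by (intro in_rhs) auto
      then show ?thesis
        using b by (intro exI[of _ 1]) (simp add: f1[unfolded One_nat_def] vb[unfolded One_nat_def] t(2) add.assoc)
    next
      assume *: "A1 \<noteq> 0 \<and> val A1 + Q * (t + \<delta>) \<le> L2 + Q * Q * t + 2 \<and>
         val A1 + Q * (t + \<delta>) \<le> \<mu> + Q * t \<and>
         (t - \<delta> \<ge> Z \<longrightarrow> val A1 + Q * (t + \<delta>) \<le> L2 + Q * Q * (t - \<delta>) + 2)"
      then have "elim_rhs b y z \<in> val_ball (val A1 + Q * (t + \<delta>))" by (intro in_rhs) auto
      then show ?thesis using * by (intro exI[of _ "q\<^sup>2"]) (simp only: fQ t(2) rq, simp)
    qed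
  qed
  then obtain X where X: "X 0 = x0" "\<And>i. X i \<in> val_ball (\<zeta> i)"
    "\<And>i. poly ?f (X (Suc i)) = elim_rhs b (X i) (if i = 0 then 0 else X (i - 1))" by blast
  have "null_seq X" using X(2) \<delta> unfolding \<zeta>_def by (intro null_seq_linear)
  then obtain Y where "sys_solution a b X Y" "Y 0 = y0" using elim_lift[OF b xy X(1) _ X(3)] by blast
  then show "\<exists>X Y. sys_solution a b X Y \<and> X 0 = x0 \<and> Y 0 = y0" using X(1) by blast
qed

text \<open>
  \<open>- Z0\<close> is the slope of the segment joining the end points of the Newton polygon of \<open>elim_poly a b\<close>,
  and \<open>(Q - 1) * (val b - Z0)\<close> is the ordinate of this segment at the exponent \<open>q\<^sup>2\<close> of the middle term.
\<close>

lemma elim_liftable: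
  fixes a b :: 'c
  defines "A1 \<equiv> \<theta> ^ q\<^sup>2 - a ^ q * b ^ q\<^sup>2 + b ^ (q\<^sup>2 - 1) * \<theta> ^ q"
  defines "u \<equiv> real q" and "Q \<equiv> (real q)\<^sup>2"
  defines "L0 \<equiv> (Q - 1) * val b"
  defines "\<mu> \<equiv> min 0 L0"
  defines "Z0 \<equiv> (Q / (u - 1) + val b) / (Q + 1)"
  assumes b: "b \<noteq> 0" and low: "A1 \<noteq> 0 \<and> val A1 < \<mu> \<or> (Q - 1) * (val b - Z0) < \<mu>"
  shows "liftable a b"
proof -
  define L2 where "L2 = - (Q + u * Q)"
  have u2: "u \<ge> 2" using q_real by (simp add: u_def)
  have Qu: "Q = u * u" by (simp add: Q_def u_def power2_eq_square)
  have Q4: "Q \<ge> 4" using mult_mono[of 2 u 2 u] u2 by (simp add: Qu)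
  have L2: "L2 \<le> - 8 - Q" using Q4 u2 mult_mono[of 2 u 4 Q] by (simp add: L2_def)
  have QQ: "Q * Q \<ge> 4 * Q" using Q4 by simp
  then have QQ1: "Q * Q \<ge> 1" "Q * Q - 1 > 0" "Q * Q - Q > 0" using Q4 by linarith+
  have Z0: "L2 + Q * Q * Z0 = L0 + Z0"
  proof -
    have "(Q + 1) * Z0 = Q / (u - 1) + val b" using Q4 by (simp add: Z0_def)
    then have "(u - 1) * ((Q + 1) * Z0) = Q + (u - 1) * val b" using u2 by (simp add: field_simps)
    then have "(u + 1) * ((u - 1) * ((Q + 1) * Z0)) = (u + 1) * (Q + (u - 1) * val b)" by simp
    then show ?thesis by (simp add: L2_def L0_def Qu algebra_simps)
  qed
  have Z0': "(Q - 1) * (val b - Z0) = L0 + Z0 - Q * Z0" by (simp add: L0_def algebra_simps)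
  \<comment> \<open>The number \<open>\<mu>\<close> bounds the valuation of the coefficient
    \<open>1 + b ^ (q\<^sup>2 - 1)\<close> on the right. A middle coefficient below
    \<open>\<mu>\<close> can absorb that term. Otherwise the second alternative of
    \<open>low\<close> puts the middle point above the segment, and the linear term alone
    suffices.\<close>
  show ?thesis
  proof (cases "A1 \<noteq> 0 \<and> val A1 < \<mu>")
    case True
    \<comment> \<open>The root valuation belonging to the edge from the middle point to the last
      one. The smaller of \<open>Z0\<close> and \<open>Z1\<close> belongs to the last edge of the
      polygon, whether or not the middle point is a vertex.\<close>
    define Z1 where "Z1 = (val A1 - L2) / (Q * Q - Q)"
    have Z1: "L2 + Q * Q * Z1 = val A1 + Q * Z1"
    proof -
      have "(Q * Q - Q) * Z1 = val A1 - L2" using Q4 by (simp add: Z1_def)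
      then show ?thesis by (simp add: algebra_simps)
    qed
    define Z where "Z = min Z0 Z1"
    \<comment> \<open>The first bound keeps the losses caused by moving one level within the slack
      2; the second takes the room for the move from the strict inequality
      \<open>val A1 < \<mu>\<close>.\<close>
    define \<delta> where "\<delta> = min (1 / (Q * Q)) ((\<mu> - val A1) / Q)"
    have \<delta>: "\<delta> > 0" "Q * Q * \<delta> \<le> 1" "Q * \<delta> \<le> \<mu> - val A1"
    proof -
      show "\<delta> > 0" using True Q4 by (simp add: \<delta>_def)
      have "\<delta> \<le> 1 / (Q * Q)" "\<delta> \<le> (\<mu> - val A1) / Q" by (simp_all add: \<delta>_def)
      then show "Q * Q * \<delta> \<le> 1" "Q * \<delta> \<le> \<mu> - val A1" using Q4 by (simp_all add: field_simps)
    qed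
    have d4: "4 * \<delta> \<le> Q * \<delta>" "4 * (Q * \<delta>) \<le> Q * (Q * \<delta>)"
      using \<delta>(1) Q4 by (auto simp: mult_right_mono)
    then have \<delta>': "\<delta> \<le> 1 / 4" "Q * \<delta> \<le> 1 / 4" using \<delta>(2) unfolding mult.assoc by linarith+
    have slope: "min (val A1 + Q * t) (L0 + t) \<le> L2 + Q * Q * t" if "t \<ge> Z" for t
    proof (cases "t \<ge> Z0")
      case True
      then have "(Q * Q - 1) * Z0 \<le> (Q * Q - 1) * t" using QQ1 by (intro mult_left_mono) auto
      then show ?thesis using Z0 by (simp add: algebra_simps)
    next
      case False
      then have "t \<ge> Z1" using that by (auto simp: Z_def)
      then have "(Q * Q - Q) * Z1 \<le> (Q * Q - Q) * t" using QQ1 by (intro mult_left_mono) auto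
      then show ?thesis using Z1 by (simp add: algebra_simps)
    qed
    show ?thesis
    proof (rule elim_liftable_aux[of b \<delta> Z a, folded u_def Q_def A1_def, folded L0_def L2_def, folded \<mu>_def])
      show "b \<noteq> 0" "\<delta> > 0" "Q * Q * \<delta> \<le> 1" using b \<delta> by auto
      fix z assume "z < Z"
      then have z: "(Q * Q - 1) * z < (Q * Q - 1) * Z0" "(Q * Q - Q) * z < (Q * Q - Q) * Z1"
        using QQ1 by (auto intro!: mult_strict_left_mono simp: Z_def)
      then show "L2 + Q * Q * z < L0 + z \<and> (A1 \<noteq> 0 \<longrightarrow> L2 + Q * Q * z < val A1 + Q * z)"
        using Z0 Z1 by (simp add: algebra_simps)
    next
      fix t assume t: "t \<ge> Z"
      have Qd: "Q * Q * (t - \<delta>) = Q * Q * t - Q * Q * \<delta>" "Q * (t - \<delta>) = Q * t - Q * \<delta>" "Q * (t + \<delta>) = Q * t + Q * \<delta>"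
        by (simp_all add: algebra_simps)
      note s = slope[OF t] slope[of "t - \<delta>"]
      show "L0 + t + \<delta> \<le> L2 + Q * Q * t + 2 \<and> L0 + t + \<delta> \<le> \<mu> + Q * t \<and> 
          (t - \<delta> \<ge> Z \<longrightarrow> L0 + t + \<delta> \<le> L2 + Q * Q * (t - \<delta>) + 2) \<or>
        A1 \<noteq> 0 \<and> val A1 + Q * (t + \<delta>) \<le> L2 + Q * Q * t + 2 \<and> val A1 + Q * (t + \<delta>) \<le> \<mu> + Q * t \<and>
          (t - \<delta> \<ge> Z \<longrightarrow> val A1 + Q * (t + \<delta>) \<le> L2 + Q * Q * (t - \<delta>) + 2)"
      \<comment> \<open>Whichever of the middle and the linear term is smaller at level
        \<open>t\<close> produces the next coefficient.\<close>
      proof (cases "val A1 + Q * t \<le> L0 + t")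
        case T: True
        have "(Q - 1) * \<delta> \<ge> 0" using Q4 \<delta>(1) by simp
        then have "Q * \<delta> - \<delta> \<ge> 0" by (simp add: algebra_simps)
        then show ?thesis using True T s \<delta> \<delta>' unfolding Qd by (intro disjI2) auto
      next
        case F: False
        have "\<delta> \<le> \<mu> - val A1" using \<delta>(3) d4 \<delta>(1) by linarith
        with F show ?thesis using True s \<delta> \<delta>' unfolding Qd by (intro disjI1) auto
      qed
    qed
  next
    case False
    then have l: "(Q - 1) * (val b - Z0) < \<mu>" and A1: "A1 = 0 \<or> val A1 \<ge> \<mu>" using low by auto
    \<comment> \<open>Here the room for one level is the gap between \<open>\<mu>\<close> and the
      ordinate of the segment at the middle exponent.\<close>
    define \<delta> where "\<delta> = min (1 / (Q * Q)) (\<mu> - (Q - 1) * (val b - Z0))"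
    have \<delta>: "\<delta> > 0" "Q * Q * \<delta> \<le> 1" "\<delta> \<le> \<mu> - (Q - 1) * (val b - Z0)"
    proof -
      show "\<delta> > 0" using l Q4 by (simp add: \<delta>_def)
      have "\<delta> \<le> 1 / (Q * Q)" by (simp add: \<delta>_def)
      then show "Q * Q * \<delta> \<le> 1" using Q4 by (simp add: field_simps)
      show "\<delta> \<le> \<mu> - (Q - 1) * (val b - Z0)" by (simp add: \<delta>_def)
    qed
    have "4 * \<delta> \<le> Q * \<delta>" "4 * (Q * \<delta>) \<le> Q * (Q * \<delta>)"
      using \<delta>(1) Q4 by (auto simp: mult_right_mono)
    then have \<delta>': "\<delta> \<le> 1 / 4" "Q * \<delta> \<le> 1 / 4" using \<delta>(2) unfolding mult.assoc by linarith+
    have slope: "L0 + t \<le> L2 + Q * Q * t" if "t \<ge> Z0" for t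
    proof -
      have "(Q * Q - 1) * Z0 \<le> (Q * Q - 1) * t" using that QQ1 by (intro mult_left_mono) auto
      then show ?thesis using Z0 by (simp add: algebra_simps)
    qed
    show ?thesis
    proof (rule elim_liftable_aux[of b \<delta> Z0 a, folded u_def Q_def A1_def, folded L0_def L2_def, folded \<mu>_def])
      show "b \<noteq> 0" "\<delta> > 0" "Q * Q * \<delta> \<le> 1" using b \<delta> by auto
      fix z assume "z < Z0"
      then have z: "(Q * Q - 1) * z < (Q * Q - 1) * Z0" "(Q * Q - Q) * z < (Q * Q - Q) * Z0"
        using QQ1 by (auto intro!: mult_strict_left_mono)
      show "L2 + Q * Q * z < L0 + z \<and> (A1 \<noteq> 0 \<longrightarrow> L2 + Q * Q * z < val A1 + Q * z)"
      proof (intro conjI impI)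
        show "L2 + Q * Q * z < L0 + z" using z(1) Z0 by (simp add: algebra_simps)
        assume "A1 \<noteq> 0"
        then have "val A1 \<ge> \<mu>" using A1 by simp
        then show "L2 + Q * Q * z < val A1 + Q * z"
          using z(2) l Z0 unfolding Z0' by (simp add: algebra_simps)
      qed
    next
      fix t assume t: "t \<ge> Z0"
      have Qd: "Q * Q * (t - \<delta>) = Q * Q * t - Q * Q * \<delta>" by (simp add: algebra_simps)
      have "(Q - 1) * Z0 \<le> (Q - 1) * t" using t Q4 by (intro mult_left_mono) auto
      then have "Q * Z0 - Z0 \<le> Q * t - t" by (simp add: algebra_simps)
      then show "L0 + t + \<delta> \<le> L2 + Q * Q * t + 2 \<and> L0 + t + \<delta> \<le> \<mu> + Q * t \<and> 
          (t - \<delta> \<ge> Z0 \<longrightarrow> L0 + t + \<delta> \<le> L2 + Q * Q * (t - \<delta>) + 2) \<or>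
        A1 \<noteq> 0 \<and> val A1 + Q * (t + \<delta>) \<le> L2 + Q * Q * t + 2 \<and> val A1 + Q * (t + \<delta>) \<le> \<mu> + Q * t \<and>
          (t - \<delta> \<ge> Z0 \<longrightarrow> val A1 + Q * (t + \<delta>) \<le> L2 + Q * Q * (t - \<delta>) + 2)"
        using slope[OF t] slope[of "t - \<delta>"] \<delta> \<delta>' unfolding Z0' Qd by (intro disjI1) auto
    qed
  qed
qed

section \<open>Lifting by the size of the entries, including the zero matrix\<close>

lemma liftable_of_val_less:
  assumes b: "b \<noteq> 0" and v: "- (real q ^ 2 / (real q - 1)) < val b" "val b < 1 / (real q - 1)"
  shows "liftable a b"
proof (rule elim_liftable[OF b], rule disjI2)
  define u where "u = real q"
  define Z0 where "Z0 = (u\<^sup>2 / (u - 1) + val b) / (u\<^sup>2 + 1)"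
  have u: "u \<ge> 2" using q_real by (simp add: u_def)
  have "u\<^sup>2 > 1" using u by (intro one_less_power) auto
  have p: "u\<^sup>2 / (u - 1) + val b > 0" using v by (simp add: u_def)
  then have Z0: "Z0 > 0" unfolding Z0_def using \<open>u\<^sup>2 > 1\<close> by (intro divide_pos_pos) auto
  have "u\<^sup>2 * val b < u\<^sup>2 * (1 / (u - 1))"
    using v \<open>u\<^sup>2 > 1\<close> by (intro mult_strict_left_mono) (auto simp: u_def)
  then have "val b * (u\<^sup>2 + 1) < u\<^sup>2 / (u - 1) + val b" by (simp add: algebra_simps)
  then have "val b < Z0" unfolding Z0_def using \<open>u\<^sup>2 > 1\<close> by (simp add: pos_less_divide_eq)
  then have "(u\<^sup>2 - 1) * (val b - Z0) < 0" "(u\<^sup>2 - 1) * (val b - Z0) < (u\<^sup>2 - 1) * val b"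
    using Z0 \<open>u\<^sup>2 > 1\<close> by (auto intro: mult_pos_neg mult_strict_left_mono)
  then show "((real q)\<^sup>2 - 1) * (val b - ((real q)\<^sup>2 / (real q - 1) + val b) / ((real q)\<^sup>2 + 1))
    < min 0 (((real q)\<^sup>2 - 1) * val b)" by (simp add: u_def Z0_def)
qed

text \<open>The threshold makes \<open>b ^ (q\<^sup>2 - 1) * \<theta> ^ q\<close> of valuation at
  least (q + 1) - q, and \<open>a ^ q * b ^ q\<^sup>2\<close> has nonnegative valuation too. Hence
  \<open>\<theta> ^ q\<^sup>2\<close> keeps the middle coefficient out of \<open>val_ball 0\<close>,
  while val b > 0 makes the bound \<open>\<mu>\<close> of \<open>elim_liftable\<close> equal to
  0.\<close>

lemma liftable_of_val_ge:
  assumes b: "b \<noteq> 0" and v: "a \<in> val_ball (1 / (real q - 1))" "b \<in> val_ball (1 / (real q - 1))"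
  shows "liftable a b"
proof (rule elim_liftable[OF b], rule disjI1)
  define u where "u = real q"
  have u: "u \<ge> 2" using q_real by (simp add: u_def)
  have u2: "u\<^sup>2 > 1" using u by (intro one_less_power) auto
  let ?A = "\<theta> ^ q\<^sup>2 - a ^ q * b ^ q\<^sup>2 + b ^ (q\<^sup>2 - 1) * \<theta> ^ q"
  have val_b: "val b > 0"
  proof -
    have "1 / (u - 1) > 0" using u by simp
    moreover have "1 / (u - 1) \<le> val b" using b v by (simp add: in_ball_iff u_def)
    ultimately show ?thesis by linarith
  qed
  have mu: "min 0 (((real q)\<^sup>2 - 1) * val b) = 0"
    using val_b u2 by (simp add: u_def min_def)
  have "?A \<notin> val_ball 0"
  proof
    assume A: "?A \<in> val_ball 0"
    have 1: "a ^ q * b ^ q\<^sup>2 \<in> val_ball 0"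
    proof -
      have "a ^ q \<in> val_ball (real q * (1 / (real q - 1)))" using v by (intro ball_power) auto
      moreover have "b ^ q\<^sup>2 \<in> val_ball (real (q\<^sup>2) * (1 / (real q - 1)))" using v by (intro ball_power) auto
      ultimately show ?thesis
        using u by (intro ball_mono[OF ball_mult]) (auto simp: u_def)
    qed
    have 2: "b ^ (q\<^sup>2 - 1) * \<theta> ^ q \<in> val_ball 0"
    proof -
      have n: "real (q\<^sup>2 - 1) = u\<^sup>2 - 1"
        by (subst of_nat_diff) (auto simp: u_def Suc_le_eq)
      have "q\<^sup>2 - 1 > 0" using u2 unfolding u_def by (metis n of_nat_0_less_iff u2 u_def diff_gt_0_iff_gt)
      then have "b ^ (q\<^sup>2 - 1) \<in> val_ball (real (q\<^sup>2 - 1) * (1 / (real q - 1)))"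
        using v by (intro ball_power)
      moreover have "real (q\<^sup>2 - 1) * (1 / (real q - 1)) = u + 1"
        using u unfolding n by (simp add: u_def field_simps power2_eq_square)
      moreover have "\<theta> ^ q \<in> val_ball (- u)"
        by (simp add: in_ball_iff val_power theta_nonzero val_theta u_def)
      ultimately show ?thesis using ball_mono[OF ball_mult[of "b ^ (q\<^sup>2 - 1)" "u + 1" "\<theta> ^ q" "- u"]] by simp
    qed
    have "?A + a ^ q * b ^ q\<^sup>2 - b ^ (q\<^sup>2 - 1) * \<theta> ^ q \<in> val_ball 0"
      by (intro ball_diff ball_add A 1 2)
    then have "\<theta> ^ q\<^sup>2 \<in> val_ball 0" by simp
    then show False using u2 by (simp add: in_ball_iff val_power theta_nonzero val_theta u_def)
  qed
  then show "?A \<noteq> 0 \<and> val ?A < min 0 (((real q)\<^sup>2 - 1) * val b)"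
    unfolding mu by (auto simp: in_ball_iff)
qed

text \<open>With both entries zero nothing can be eliminated, but the system splits into two copies
  of one scalar equation. Its polynomial is separable of degree \<open>q\<^sup>2\<close>, which
  gives \<open>q\<^sup>2 * q\<^sup>2\<close> kernel elements.\<close>

lemma kernel_and_lift_zero: "liftable 0 0" "finite (sys_kernel 0 0)" "card (sys_kernel 0 0) = q ^ 4"
proof -
  define f where "f = monom (\<theta> ^ q) (q\<^sup>2) + monom 1 1"
  have q1: "1 < q\<^sup>2" using q_ge_2 one_less_power[of q 2] by simp
  have f: "coeff f 0 = 0" "coeff f 1 = 1" "degree f = q\<^sup>2"
  proof -
    show "coeff f 0 = 0" "coeff f 1 = 1" using q1 by (auto simp: f_def)
    have "degree (monom 1 1 :: 'c poly) < degree (monom (\<theta> ^ q) (q\<^sup>2))"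
      using q1 theta_nonzero by (simp add: degree_monom_eq)
    then show "degree f = q\<^sup>2" unfolding f_def using theta_nonzero
      by (subst degree_add_eq_left) (simp_all add: degree_monom_eq)
  qed
  have poly_f: "poly f x = \<theta> ^ q * x ^ q\<^sup>2 + x" for x by (simp add: f_def poly_monom)
  have f0: "f \<noteq> 0" using f(2) by auto
  have ker: "sys_kernel 0 0 = {x. poly f x = 0} \<times> {x. poly f x = 0}"
    by (auto simp: sys_kernel_def poly_f)
  show "finite (sys_kernel 0 0)" unfolding ker using poly_roots_finite[OF f0] by simp
  have "pderiv f = 1"
    unfolding f_def pderiv_add pderiv_monom using q_power_char_zero[of 2] by (simp add: monom_0 one_pCons)
  then have "card {x. poly f x = 0} = q\<^sup>2" using card_roots[OF f0] f by simp
  then show "card (sys_kernel 0 0) = q ^ 4" 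
    unfolding ker card_cartesian_product by (simp add: power_add[symmetric])
  define u where "u = real q"
  have u: "u \<ge> 2" using q_real by (simp add: u_def)
  have u2: "u\<^sup>2 > 1" using u by (intro one_less_power) auto
  \<comment> \<open>The common valuation of the nonzero roots, from - x =
    \<open>\<theta> ^ q * x ^ q\<^sup>2\<close>. Raising to the power \<open>q\<^sup>2\<close> takes
    the level Z + i to at least Z + i + u, so the levels can grow by 1 and the linear coefficient 1
    always serves.\<close>
  define Z where "Z = u / (u\<^sup>2 - 1)"
  have Z: "u\<^sup>2 * Z = Z + u" using u2 by (simp add: Z_def field_simps)
  have "\<exists>X. X 0 = x \<and> null_seq X \<and> (\<forall>i. \<theta> ^ q * X i ^ q\<^sup>2 + X i = (if i = 0 then 0 else X (i - 1) ^ q\<^sup>2))"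
    if x: "poly f x = 0" for x
  proof -
    define \<zeta> where "\<zeta> i = Z + real i * 1" for i
    have "\<exists>X. X 0 = x \<and> (\<forall>i. X i \<in> val_ball (\<zeta> i)) \<and>
      (\<forall>i. poly f (X (Suc i)) = (\<lambda>y z. y ^ q\<^sup>2) (X i) (if i = 0 then 0 else X (i - 1)))"
    proof (rule lift_sequence[OF f(1)])
      show "x \<in> val_ball (\<zeta> 0)"
      proof (cases "x = 0")
        case False
        have "- x = \<theta> ^ q * x ^ q\<^sup>2" using x by (simp add: poly_f add_eq_0_iff2)
        then have "val x = val (\<theta> ^ q * x ^ q\<^sup>2)" by (metis val_minus)
        then have "val x = u\<^sup>2 * val x - u" 
          using False theta_nonzero by (simp add: val_mult val_power val_theta u_def)
        then have "(u\<^sup>2 - 1) * val x = u" by (simp add: algebra_simps)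
        then show ?thesis using u2 by (simp add: in_ball_iff \<zeta>_def Z_def field_simps)
      qed simp
      fix i y and z :: 'c assume y: "y \<in> val_ball (\<zeta> i)"
      have "y ^ q\<^sup>2 \<in> val_ball (u\<^sup>2 * \<zeta> i)" using ball_power[OF y, of "q\<^sup>2"] by (simp add: u_def)
      moreover have "1 * real i \<le> u\<^sup>2 * real i" using u2 by (intro mult_right_mono) auto
      then have "\<zeta> (Suc i) \<le> u\<^sup>2 * \<zeta> i" using Z u by (simp add: \<zeta>_def distrib_left)
      ultimately have "y ^ q\<^sup>2 \<in> val_ball (\<zeta> (Suc i))" by (rule ball_mono)
      then show "\<exists>k>0. coeff f k \<noteq> 0 \<and> y ^ q\<^sup>2 \<in> val_ball (val (coeff f k) + real k * \<zeta> (Suc i))"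
        using f(2) by (intro exI[of _ 1]) (simp add: val_one)
    qed
    then obtain X where X: "X 0 = x" "\<And>i. X i \<in> val_ball (\<zeta> i)" "\<And>i. poly f (X (Suc i)) = X i ^ q\<^sup>2" by blast
    have "null_seq X" by (rule null_seq_linear[of 1 X Z]) (use X(2) in \<open>auto simp: \<zeta>_def\<close>)
    moreover have "\<theta> ^ q * X i ^ q\<^sup>2 + X i = (if i = 0 then 0 else X (i - 1) ^ q\<^sup>2)" for i
      using x X(1) X(3)[of "i - 1"] by (cases i) (auto simp: poly_f)
    ultimately show ?thesis using X(1) by blast
  qed note lift = this
  show "liftable 0 0" unfolding liftable_def
  proof clarify
    fix x y assume "(x, y) \<in> sys_kernel 0 0"
    then have "poly f x = 0" "poly f y = 0" by (auto simp: ker)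
    then obtain X Y where
      "X 0 = x" "null_seq X" "\<And>i. \<theta> ^ q * X i ^ q\<^sup>2 + X i = (if i = 0 then 0 else X (i - 1) ^ q\<^sup>2)"
      "Y 0 = y" "null_seq Y" "\<And>i. \<theta> ^ q * Y i ^ q\<^sup>2 + Y i = (if i = 0 then 0 else Y (i - 1) ^ q\<^sup>2)"
      using lift[of x] lift[of y] by metis
    then show "\<exists>X Y. sys_solution 0 0 X Y \<and> X 0 = x \<and> Y 0 = y"
      by (intro exI[of _ X] exI[of _ Y]) (simp add: sys_solution_def)
  qed
qed

lemma sys_kernel_swap_image: "sys_kernel a b = prod.swap ` sys_kernel b a"
  using sys_kernel_swap by (force simp: image_iff)

lemma finite_card_sys_kernel: "finite (sys_kernel a b)" "card (sys_kernel a b) = q ^ 4"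
proof -
  have "finite (sys_kernel a b) \<and> card (sys_kernel a b) = q ^ 4"
  proof (cases "b = 0")
    case b: True
    show ?thesis
    proof (cases "a = 0")
      case True
      then show ?thesis using b kernel_and_lift_zero by simp
    next
      case False
      have "inj_on prod.swap (sys_kernel b a)" by simp
      then show ?thesis unfolding sys_kernel_swap_image[of a b]
        using finite_card_elim_kernel[OF False, of b] by (simp add: card_image)
    qed
  qed (use finite_card_elim_kernel in auto)
  then show "finite (sys_kernel a b)" "card (sys_kernel a b) = q ^ 4" by auto
qed

lemma liftable_of_ord:
  assumes "ord a > ereal (- (real q ^ 2 / (real q - 1)))" "ord b > ereal (- (real q ^ 2 / (real q - 1)))"
  shows "liftable a b"
proof -
  have *: "c \<noteq> 0 \<Longrightarrow> - (real q ^ 2 / (real q - 1)) < val c"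
    if "ord c > ereal (- (real q ^ 2 / (real q - 1)))" for c
    using that ord_eq_val[of c] by simp
  define r where "r = 1 / (real q - 1)"
  consider "b \<noteq> 0 \<and> val b < r" | "a \<noteq> 0 \<and> val a < r" | "a \<in> val_ball r" "b \<in> val_ball r"
    by (force simp: in_ball_iff)
  then show ?thesis
  proof cases
    case 1
    then show ?thesis using *[OF assms(2)] liftable_of_val_less[of b a] by (simp add: r_def)
  next
    case 2
    then show ?thesis using *[OF assms(1)] liftable_of_val_less[of a b] liftable_swap by (simp add: r_def)
  next
    case 3
    then show ?thesis
      using liftable_of_val_ge[of b a] liftable_of_val_ge[of a b] liftable_swap[of b a] kernel_and_lift_zero(1)
      unfolding r_def by metis
  qed
qed

subsection \<open>Solutions as a module over \<open>F\<^sub>q[T]\<close>\<close>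

definition sol :: "'c \<Rightarrow> 'c \<Rightarrow> ('c fps \<times> 'c fps) set"
  where "sol a b = {v. sys_solution a b (fps_nth (fst v)) (fps_nth (snd v))}"

lemma null_seq_add: "null_seq X \<Longrightarrow> null_seq Y \<Longrightarrow> null_seq (\<lambda>i. X i + Y i)"
proof -
  assume X: "null_seq X" and Y: "null_seq Y"
  show "null_seq (\<lambda>i. X i + Y i)" unfolding null_seq_def
  proof
    fix r
    obtain M N where "\<And>n. n \<ge> M \<Longrightarrow> X n \<in> val_ball r" "\<And>n. n \<ge> N \<Longrightarrow> Y n \<in> val_ball r"
      using X Y unfolding null_seq_def by meson
    then show "\<exists>N. \<forall>n\<ge>N. X n + Y n \<in> val_ball r"
      by (intro exI[of _ "max M N"]) (auto intro: ball_add)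
  qed
qed

lemma null_seq_const_mult: "null_seq X \<Longrightarrow> null_seq (\<lambda>i. c * X i)"
proof (cases "c = 0")
  case False
  assume X: "null_seq X"
  show ?thesis unfolding null_seq_def
  proof
    fix r
    obtain M where "\<And>n. n \<ge> M \<Longrightarrow> X n \<in> val_ball (r - val c)"
      using X unfolding null_seq_def by meson
    then show "\<exists>N. \<forall>n\<ge>N. c * X n \<in> val_ball r"
      using False by (auto simp: ball_val_cancel)
  qed
qed (simp add: null_seq_def)

lemma null_seq_shift: "null_seq X \<Longrightarrow> null_seq (\<lambda>i. if i = 0 then 0 else X (i - 1))"
proof -
  assume X: "null_seq X"
  show ?thesis unfolding null_seq_def
  proof
    fix r
    obtain M where M: "\<And>n. n \<ge> M \<Longrightarrow> X n \<in> val_ball r" using X unfolding null_seq_def by meson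
    then show "\<exists>N. \<forall>n\<ge>N. (if n = 0 then 0 else X (n - 1)) \<in> val_ball r"
      by (intro exI[of _ "Suc M"]) auto
  qed
qed

lemma null_seq_unshift: "null_seq X \<Longrightarrow> null_seq (\<lambda>i. X (Suc i))"
  unfolding null_seq_def by (meson le_SucI)

lemma fps_nth_add_fun: "fps_nth (f + g) = (\<lambda>i. fps_nth f i + fps_nth (g :: 'c fps) i)"
  and fps_nth_const_mult_fun: "fps_nth (fps_const c * f) = (\<lambda>i. c * fps_nth f i)"
  by (simp_all add: fun_eq_iff)

lemma sol_add: "v \<in> sol a b \<Longrightarrow> w \<in> sol a b \<Longrightarrow> v + w \<in> sol a b"
  unfolding sol_def sys_solution_def mem_Collect_eq
proof (elim conjE, intro conjI allI)
  fix i
  assume v: "\<forall>i. \<theta> ^ q * (fst v $ i) ^ q\<^sup>2 + b * (snd v $ i) ^ q + fst v $ i = (if i = 0 then 0 else (fst v $ (i - 1)) ^ q\<^sup>2) \<and>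
      \<theta> ^ q * (snd v $ i) ^ q\<^sup>2 + a * (fst v $ i) ^ q + snd v $ i = (if i = 0 then 0 else (snd v $ (i - 1)) ^ q\<^sup>2)"
    and w: "\<forall>i. \<theta> ^ q * (fst w $ i) ^ q\<^sup>2 + b * (snd w $ i) ^ q + fst w $ i = (if i = 0 then 0 else (fst w $ (i - 1)) ^ q\<^sup>2) \<and>
      \<theta> ^ q * (snd w $ i) ^ q\<^sup>2 + a * (fst w $ i) ^ q + snd w $ i = (if i = 0 then 0 else (snd w $ (i - 1)) ^ q\<^sup>2)"
  have alg: "t * (x + x') + c * (y + y') + (z + z') = (t * x + c * y + z) + (t * x' + c * y' + z')"
    for t x x' c y y' z z' :: 'c by (simp add: algebra_simps)
  show "\<theta> ^ q * (fst (v + w) $ i) ^ q\<^sup>2 + b * (snd (v + w) $ i) ^ q + fst (v + w) $ i =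
      (if i = 0 then 0 else (fst (v + w) $ (i - 1)) ^ q\<^sup>2)"
    using spec[OF v, of i] spec[OF w, of i]
    by (simp only: fst_add snd_add fps_add_nth frob_add frob_q_add alg) simp
  show "\<theta> ^ q * (snd (v + w) $ i) ^ q\<^sup>2 + a * (fst (v + w) $ i) ^ q + snd (v + w) $ i =
      (if i = 0 then 0 else (snd (v + w) $ (i - 1)) ^ q\<^sup>2)"
    using spec[OF v, of i] spec[OF w, of i]
    by (simp only: fst_add snd_add fps_add_nth frob_add frob_q_add alg) simp
qed (simp_all add: fps_nth_add_fun null_seq_add)

lemma sol_const: "c \<in> Fq q \<Longrightarrow> v \<in> sol a b \<Longrightarrow> pair_scale (fps_const c) v \<in> sol a b"
  unfolding sol_def sys_solution_def mem_Collect_eq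
proof (elim conjE, intro conjI allI)
  fix i
  assume c: "c \<in> Fq q" and
    v: "\<forall>i. \<theta> ^ q * (fst v $ i) ^ q\<^sup>2 + b * (snd v $ i) ^ q + fst v $ i = (if i = 0 then 0 else (fst v $ (i - 1)) ^ q\<^sup>2) \<and>
      \<theta> ^ q * (snd v $ i) ^ q\<^sup>2 + a * (fst v $ i) ^ q + snd v $ i = (if i = 0 then 0 else (snd v $ (i - 1)) ^ q\<^sup>2)"
  have cq: "c ^ q = c" using c by (rule Fq_frob)
  have cQ: "c ^ q\<^sup>2 = c" using cq by (simp add: power2_eq_square power_mult)
  have alg: "t * (c * x) + d * (c * y) + c * z = c * (t * x + d * y + z)"
    for t x d y z :: 'c by (simp add: algebra_simps)
  show "\<theta> ^ q * (fst (pair_scale (fps_const c) v) $ i) ^ q\<^sup>2 + b * (snd (pair_scale (fps_const c) v) $ i) ^ q + fst (pair_scale (fps_const c) v) $ i =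
      (if i = 0 then 0 else (fst (pair_scale (fps_const c) v) $ (i - 1)) ^ q\<^sup>2)"
    using spec[OF v, of i]
    by (simp only: fst_pair_scale snd_pair_scale fps_mult_left_const_nth power_mult_distrib cq cQ alg) simp
  show "\<theta> ^ q * (snd (pair_scale (fps_const c) v) $ i) ^ q\<^sup>2 + a * (fst (pair_scale (fps_const c) v) $ i) ^ q + snd (pair_scale (fps_const c) v) $ i =
      (if i = 0 then 0 else (snd (pair_scale (fps_const c) v) $ (i - 1)) ^ q\<^sup>2)"
    using spec[OF v, of i]
    by (simp only: fst_pair_scale snd_pair_scale fps_mult_left_const_nth power_mult_distrib cq cQ alg) simp
qed (simp_all add: fps_nth_const_mult_fun null_seq_const_mult)

lemma fps_nth_X_mult: "fps_nth (fps_X * f) = (\<lambda>i. if i = 0 then 0 else fps_nth (f :: 'c fps) (i - 1))"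
  by (simp add: fun_eq_iff fps_X_mult_nth)

text \<open>The equations of the shifted pair at index i + 1 are those of the original pair at i,
  and at index 0 they are trivial. Hence a solution without constant term can be divided by T within
  the solutions.\<close>

lemma sol_X_iff: "pair_scale fps_X v \<in> sol a b \<longleftrightarrow> v \<in> sol a b"
proof
  assume "v \<in> sol a b"
  then show "pair_scale fps_X v \<in> sol a b"
    unfolding sol_def sys_solution_def using null_seq_shift[of "fps_nth (fst v)"] null_seq_shift[of "fps_nth (snd v)"]
    by (auto simp: fps_nth_X_mult zero_power)
next
  assume s: "pair_scale fps_X v \<in> sol a b"
  have n: "null_seq (fps_nth (fst v))" "null_seq (fps_nth (snd v))"
    using s null_seq_unshift[of "fps_nth (fps_X * fst v)"] null_seq_unshift[of "fps_nth (fps_X * snd v)"]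
    by (simp_all add: sol_def sys_solution_def)
  have "\<theta> ^ q * (fst v $ i) ^ q\<^sup>2 + b * (snd v $ i) ^ q + fst v $ i = (if i = 0 then 0 else (fst v $ (i - 1)) ^ q\<^sup>2) \<and>
      \<theta> ^ q * (snd v $ i) ^ q\<^sup>2 + a * (fst v $ i) ^ q + snd v $ i = (if i = 0 then 0 else (snd v $ (i - 1)) ^ q\<^sup>2)" for i
  proof -
    from s have "\<theta> ^ q * ((fps_X * fst v) $ (Suc i)) ^ q\<^sup>2 + b * ((fps_X * snd v) $ (Suc i)) ^ q + (fps_X * fst v) $ (Suc i) = ((fps_X * fst v) $ i) ^ q\<^sup>2 \<and>
      \<theta> ^ q * ((fps_X * snd v) $ (Suc i)) ^ q\<^sup>2 + a * ((fps_X * fst v) $ (Suc i)) ^ q + (fps_X * snd v) $ (Suc i) = ((fps_X * snd v) $ i) ^ q\<^sup>2"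
      unfolding sol_def sys_solution_def mem_Collect_eq fst_pair_scale snd_pair_scale
      by (metis diff_Suc_1 nat.distinct(1))
    then show ?thesis by (cases i) (auto simp: zero_power)
  qed
  then show "v \<in> sol a b" using n by (auto simp: sol_def sys_solution_def)
qed

lemma sol_zero: "0 \<in> sol a b"
  by (simp add: sol_def sys_solution_def null_seq_def zero_power)

lemma sol_poly: "c \<in> Fq_poly q \<Longrightarrow> v \<in> sol a b \<Longrightarrow> pair_scale (fps_of_poly c) v \<in> sol a b"
proof (induction c)
  case (pCons d c)
  have d: "d \<in> Fq q" "c \<in> Fq_poly q"
    using pCons.prems(1) unfolding Fq_poly_def mem_Collect_eq
    by (metis coeff_pCons_0) (metis (mono_tags) coeff_pCons_Suc pCons.prems(1) Fq_poly_def mem_Collect_eq)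
  have "pair_scale (fps_of_poly (pCons d c)) v =
    pair_scale (fps_const d) v + pair_scale fps_X (pair_scale (fps_of_poly c) v)"
    by (simp add: prod_eq_iff fps_of_poly_pCons algebra_simps)
  then show ?case using pCons d by (simp add: sol_add sol_const sol_X_iff)
qed (simp add: sol_zero)

lemma sol_sum: "(\<And>i. i \<in> I \<Longrightarrow> f i \<in> sol a b) \<Longrightarrow> sum f I \<in> sol a b"
  by (induction I rule: infinite_finite_induct) (auto simp: sol_zero intro: sol_add)

lemma sol_div_X:
  assumes "v \<in> sol a b" "pair_nth v 0 = 0"
  obtains w where "w \<in> sol a b" "v = pair_scale fps_X w"
proof -
  define w where "w = (fps_shift 1 (fst v), fps_shift 1 (snd v))"
  have "v = pair_scale fps_X w"
    using assms(2) by (auto simp: prod_eq_iff w_def pair_nth_def fps_eq_iff fps_X_mult_nth)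
  then show thesis using that assms(1) sol_X_iff by metis
qed

lemma sol_nth_0: "v \<in> sol a b \<Longrightarrow> pair_nth v 0 \<in> sys_kernel a b"
  unfolding sol_def sys_solution_def sys_kernel_def pair_nth_def by auto

lemma sol_lift: "liftable a b \<Longrightarrow> p \<in> sys_kernel a b \<Longrightarrow> \<exists>v\<in>sol a b. pair_nth v 0 = p"
proof -
  assume "liftable a b" "p \<in> sys_kernel a b"
  then obtain X Y where "sys_solution a b X Y" "X 0 = fst p" "Y 0 = snd p"
    unfolding liftable_def by (cases p) fastforce
  then show ?thesis
    by (intro bexI[of _ "(Abs_fps X, Abs_fps Y)"]) (simp_all add: sol_def pair_nth_def Abs_fps_inverse)
qed

section \<open>Degrees of solutions\<close>

definition inj_radius :: "'c \<Rightarrow> 'c \<Rightarrow> real"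
  where "inj_radius a b = Max {2, 1 - val a, 1 - val b}"

text \<open>The radius is chosen so that for every m at or above it both
  \<open>q\<^sup>2 * m - q\<close> and \<open>val c + q * m\<close>, with c either entry, are at
  least m + 1. A kernel pair in the ball of radius m therefore lies in the ball of radius m + 1, and
  by iteration it is 0.\<close>

lemma inj_radius:
  assumes "x \<in> val_ball (inj_radius a b)" "y \<in> val_ball (inj_radius a b)"
    and E: "\<theta> ^ q * x ^ q\<^sup>2 + b * y ^ q + x = 0" "\<theta> ^ q * y ^ q\<^sup>2 + a * x ^ q + y = 0"
  shows "x = 0 \<and> y = 0"
proof -
  define \<rho> where "\<rho> = inj_radius a b"
  have \<rho>: "\<rho> \<ge> 2" "\<rho> \<ge> 1 - val a" "\<rho> \<ge> 1 - val b" by (auto simp: \<rho>_def inj_radius_def)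
  have big: "\<theta> ^ q * x ^ q\<^sup>2 \<in> val_ball (m + 1)" if "x \<in> val_ball m" "m \<ge> \<rho>" for x m
  proof -
    have "\<theta> ^ q \<in> val_ball (- real q)" by (simp add: in_ball_iff val_power val_theta theta_nonzero)
    from ball_mult[OF this ball_power[OF that(1), of "q\<^sup>2"]]
    have "\<theta> ^ q * x ^ q\<^sup>2 \<in> val_ball (- real q + real (q\<^sup>2) * m)" by simp
    moreover have "m + 1 \<le> - real q + real (q\<^sup>2) * m"
    proof -
      have "2 \<le> m" using that(2) \<rho>(1) by simp
      then have "m + 1 \<le> 2 * (m + m - 1)" by simp
      also have "\<dots> \<le> real q * (m + m - 1)"
        using that \<rho> q_real by (intro mult_right_mono) auto
      also have "\<dots> \<le> real q * (real q * m - 1)"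
      proof (rule mult_left_mono)
        have "2 * m \<le> real q * m" using that \<rho> q_real by (intro mult_right_mono) auto
        then show "m + m - 1 \<le> real q * m - 1" by linarith
      qed simp
      also have "\<dots> = - real q + real (q\<^sup>2) * m" by (simp add: power2_eq_square algebra_simps)
      finally show ?thesis .
    qed
    ultimately show ?thesis by (rule ball_mono)
  qed
  have small: "c * x ^ q \<in> val_ball (m + 1)" if "x \<in> val_ball m" "m \<ge> \<rho>" "\<rho> \<ge> 1 - val c" for x c m
  proof -
    have "c \<in> val_ball (val c)" by (simp add: in_ball_iff)
    from ball_mult[OF this ball_power[OF that(1), of q]]
    have "c * x ^ q \<in> val_ball (val c + real q * m)" by simp
    moreover have "2 * m \<le> real q * m" using that \<rho> q_real by (intro mult_right_mono) auto
    then have "m + 1 \<le> val c + real q * m" using that by linarith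
    ultimately show ?thesis by (rule ball_mono)
  qed
  have "x \<in> val_ball (\<rho> + real n) \<and> y \<in> val_ball (\<rho> + real n)" for n
  proof (induction n)
    case 0
    then show ?case using assms by (simp add: \<rho>_def)
  next
    case (Suc n)
    have "\<theta> ^ q * x ^ q\<^sup>2 + b * y ^ q \<in> val_ball (\<rho> + real n + 1)"
      using Suc \<rho> by (intro ball_add big small) auto
    moreover have "x = - (\<theta> ^ q * x ^ q\<^sup>2 + b * y ^ q)" using E(1) by (metis eq_neg_iff_add_eq_0 add.commute)
    ultimately have x: "x \<in> val_ball (\<rho> + real n + 1)" by (metis ball_minus_iff)
    have "\<theta> ^ q * y ^ q\<^sup>2 + a * x ^ q \<in> val_ball (\<rho> + real n + 1)"
      using Suc \<rho> by (intro ball_add big small) auto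
    moreover have "y = - (\<theta> ^ q * y ^ q\<^sup>2 + a * x ^ q)" using E(2) by (metis eq_neg_iff_add_eq_0 add.commute)
    ultimately have "y \<in> val_ball (\<rho> + real n + 1)" by (metis ball_minus_iff)
    with x show ?case by (simp add: algebra_simps)
  qed
  then have "x \<in> val_ball r \<and> y \<in> val_ball r" for r
  proof -
    obtain n :: nat where "real n > r - \<rho>" using reals_Archimedean2 by blast
    then show ?thesis using \<open>\<And>n. x \<in> val_ball (\<rho> + real n) \<and> y \<in> val_ball (\<rho> + real n)\<close>[of n]
      by (auto elim: ball_mono)
  qed
  then show ?thesis using zero_if_in_all_balls by blast
qed

definition sol_level :: "'c \<Rightarrow> 'c \<Rightarrow> nat \<Rightarrow> ('c fps \<times> 'c fps) set"
  where "sol_level a b J = {v \<in> sol a b. \<forall>i\<ge>J. fst v $ i \<in> val_ball (inj_radius a b) \<and>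
     snd v $ i \<in> val_ball (inj_radius a b)}"

text \<open>Once the previous coefficients vanish, the next one is a kernel pair inside the
  injectivity ball.\<close>

lemma sol_level_0: "v \<in> sol_level a b 0 \<Longrightarrow> v = 0"
proof -
  assume v: "v \<in> sol_level a b 0"
  have "fst v $ i = 0 \<and> snd v $ i = 0" for i
  proof (induction i rule: less_induct)
    case (less i)
    have "\<theta> ^ q * (fst v $ i) ^ q\<^sup>2 + b * (snd v $ i) ^ q + fst v $ i = 0" "\<theta> ^ q * (snd v $ i) ^ q\<^sup>2 + a * (fst v $ i) ^ q + snd v $ i = 0"
      using v less[of "i - 1"] by (auto simp: sol_level_def sol_def sys_solution_def zero_power)
    then show ?case using v by (intro inj_radius) (auto simp: sol_level_def)
  qed
  then show ?thesis by (simp add: prod_eq_iff fps_eq_iff)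
qed

lemma sol_level_exists: "v \<in> sol a b \<Longrightarrow> \<exists>J. v \<in> sol_level a b J"
proof -
  assume v: "v \<in> sol a b"
  then have "null_seq (fps_nth (fst v))" "null_seq (fps_nth (snd v))"
    by (auto simp: sol_def sys_solution_def)
  then obtain M N where "\<And>i. i \<ge> M \<Longrightarrow> fst v $ i \<in> val_ball (inj_radius a b)"
    "\<And>i. i \<ge> N \<Longrightarrow> snd v $ i \<in> val_ball (inj_radius a b)" unfolding null_seq_def by meson
  then show ?thesis using v by (intro exI[of _ "max M N"]) (auto simp: sol_level_def)
qed

lemma sol_level_sol: "v \<in> sol_level a b J \<Longrightarrow> v \<in> sol a b"
  by (simp add: sol_level_def)

lemma sol_level_mono: "v \<in> sol_level a b J \<Longrightarrow> J \<le> K \<Longrightarrow> v \<in> sol_level a b K"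
  by (auto simp: sol_level_def)

lemma sol_level_add: "v \<in> sol_level a b J \<Longrightarrow> w \<in> sol_level a b J \<Longrightarrow> v + w \<in> sol_level a b J"
  by (auto simp: sol_level_def sol_add ball_add)

lemma sol_level_const: "c \<in> Fq q \<Longrightarrow> v \<in> sol_level a b J \<Longrightarrow> pair_scale (fps_const c) v \<in> sol_level a b J"
  by (auto simp: sol_level_def sol_const Fq_mult_ball)

lemma sol_level_sum: "(\<And>i. i \<in> I \<Longrightarrow> f i \<in> sol_level a b J) \<Longrightarrow> sum f I \<in> sol_level a b J"
proof (induction I rule: infinite_finite_induct)
  case (insert i I)
  then show ?case using sol_level_add[of "f i" a b J "sum f I"] by simp
qed (simp_all add: sol_level_def sol_zero)

lemma sol_level_X: "pair_scale fps_X w \<in> sol_level a b (Suc J) \<Longrightarrow> w \<in> sol_level a b J"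
  unfolding sol_level_def mem_Collect_eq sol_X_iff
  by (auto simp: fps_X_mult_nth dest: spec[of _ "Suc _"])

section \<open>Linear algebra over the constants in the kernel\<close>

definition Fq_span :: "(nat \<Rightarrow> 'c \<times> 'c) \<Rightarrow> nat \<Rightarrow> ('c \<times> 'c) set"
  where "Fq_span l n = {\<Sum>i<n. pair_scale (c i) (l i) | c. \<forall>i. c i \<in> Fq q}"

lemma Fq_spanI: "(\<And>i. i < n \<Longrightarrow> c i \<in> Fq q) \<Longrightarrow> (\<Sum>i<n. pair_scale (c i) (l i)) \<in> Fq_span l n"
proof -
  assume c: "\<And>i. i < n \<Longrightarrow> c i \<in> Fq q"
  have "(\<Sum>i<n. pair_scale (c i) (l i)) = (\<Sum>i<n. pair_scale (if i < n then c i else 0) (l i))"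
    by (intro sum.cong) auto
  then show ?thesis unfolding Fq_span_def using c
    by (intro CollectI exI[of _ "\<lambda>i. if i < n then c i else 0"]) auto
qed

lemma Fq_spanD: "x \<in> Fq_span l n \<Longrightarrow> \<exists>c. (\<forall>i. c i \<in> Fq q) \<and> x = (\<Sum>i<n. pair_scale (c i) (l i))"
  unfolding Fq_span_def by blast

lemma Fq_span_mono: "m \<le> n \<Longrightarrow> Fq_span l m \<subseteq> Fq_span l n"
proof
  fix x assume "m \<le> n" and x: "x \<in> Fq_span l m"
  obtain c where c: "\<And>i. c i \<in> Fq q" "x = (\<Sum>i<m. pair_scale (c i) (l i))"
    using Fq_spanD[OF x] by metis
  have x': "x = (\<Sum>i<n. pair_scale (if i < m then c i else 0) (l i))"
    unfolding c(2) using \<open>m \<le> n\<close> by (intro sum.mono_neutral_cong_left) auto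
  show "x \<in> Fq_span l n" unfolding x' by (rule Fq_spanI) (simp add: c(1))
qed

lemma Fq_span_cong: "(\<And>i. i < n \<Longrightarrow> l i = l' i) \<Longrightarrow> Fq_span l n = Fq_span l' n"
  unfolding Fq_span_def by (intro Collect_cong ex_cong conj_cong refl) (auto intro!: sum.cong)

text \<open>Independence is taken in triangular form, each vector outside the span of the earlier
  ones, because lifts of minimal degree are chosen one at a time under exactly this
  condition.\<close>

lemma Fq_span_independent:
  assumes "\<And>i. i < n \<Longrightarrow> l i \<notin> Fq_span l i" "\<And>i. i < n \<Longrightarrow> c i \<in> Fq q"
    "(\<Sum>i<n. pair_scale (c i) (l i)) = 0"
  shows "\<forall>i<n. c i = 0"
  using assms
proof (induction n)
  case (Suc n)
  have "c n = 0"
  proof (rule ccontr)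
    assume cn: "c n \<noteq> 0"
    have "pair_scale (c n) (l n) = - (\<Sum>i<n. pair_scale (c i) (l i))"
      using Suc.prems(3) by (simp add: eq_neg_iff_add_eq_0 add.commute)
    then have "pair_scale (inverse (c n)) (pair_scale (c n) (l n)) =
       pair_scale (- inverse (c n)) (\<Sum>i<n. pair_scale (c i) (l i))"
      by (simp add: prod_eq_iff)
    then have "l n = (\<Sum>i<n. pair_scale (- inverse (c n) * c i) (l i))"
      using cn unfolding pair_scale_sum by (simp add: pair_scale_mult[symmetric])
    moreover have "(\<Sum>i<n. pair_scale (- inverse (c n) * c i) (l i)) \<in> Fq_span l n"
      using Suc.prems(2) by (intro Fq_spanI Fq_mult Fq_minus Fq_inverse) auto
    ultimately show False using Suc.prems(1)[of n] by simp
  qed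
  moreover have "\<forall>i<n. c i = 0" using Suc \<open>c n = 0\<close> by (intro Suc.IH) auto
  ultimately show ?case by (auto simp: less_Suc_eq)
qed simp

lemma card_Fq_span:
  assumes "\<And>i. i < n \<Longrightarrow> l i \<notin> Fq_span l i"
  shows "card (Fq_span l n) = q ^ n"
proof -
  have "bij_betw (\<lambda>c. \<Sum>i<n. pair_scale (c i) (l i)) ({..<n} \<rightarrow>\<^sub>E (Fq q :: 'c set)) (Fq_span l n)"
    unfolding bij_betw_def
  proof
    show "inj_on (\<lambda>c. \<Sum>i<n. pair_scale (c i) (l i)) ({..<n} \<rightarrow>\<^sub>E (Fq q :: 'c set))"
    proof (rule inj_onI)
      fix c d assume c: "c \<in> {..<n} \<rightarrow>\<^sub>E (Fq q :: 'c set)" and d: "d \<in> {..<n} \<rightarrow>\<^sub>E (Fq q :: 'c set)"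
        and eq: "(\<Sum>i<n. pair_scale (c i) (l i)) = (\<Sum>i<n. pair_scale (d i) (l i))"
      have "(\<Sum>i<n. pair_scale (c i - d i) (l i)) =
          (\<Sum>i<n. pair_scale (c i) (l i)) - (\<Sum>i<n. pair_scale (d i) (l i))"
        by (simp add: sum_subtractf pair_scale_diff_left)
      then have z: "(\<Sum>i<n. pair_scale (c i - d i) (l i)) = 0" unfolding eq by simp
      have "\<forall>i<n. c i - d i = 0"
      proof (rule Fq_span_independent[OF _ _ z])
        show "l i \<notin> Fq_span l i" if "i < n" for i by (rule assms[OF that])
        show "c i - d i \<in> Fq q" if "i < n" for i
          using PiE_mem[OF c, of i] PiE_mem[OF d, of i] that by (simp add: Fq_diff)
      qed
      then have cd: "c i = d i" if "i < n" for i using that by simp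
      show "c = d" by (rule PiE_ext[OF c d]) (simp add: cd)
    qed
    show "(\<lambda>c. \<Sum>i<n. pair_scale (c i) (l i)) ` ({..<n} \<rightarrow>\<^sub>E (Fq q :: 'c set)) = Fq_span l n"
    proof
      show "(\<lambda>c. \<Sum>i<n. pair_scale (c i) (l i)) ` ({..<n} \<rightarrow>\<^sub>E (Fq q :: 'c set)) \<subseteq> Fq_span l n"
      proof (rule image_subsetI)
        fix c assume c: "c \<in> {..<n} \<rightarrow>\<^sub>E (Fq q :: 'c set)"
        show "(\<Sum>i<n. pair_scale (c i) (l i)) \<in> Fq_span l n"
          by (rule Fq_spanI) (use PiE_mem[OF c] in simp)
      qed
      show "Fq_span l n \<subseteq> (\<lambda>c. \<Sum>i<n. pair_scale (c i) (l i)) ` ({..<n} \<rightarrow>\<^sub>E (Fq q :: 'c set))"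
      proof
        fix x assume x: "x \<in> Fq_span l n"
        obtain c where c: "\<And>i. c i \<in> Fq q" "x = (\<Sum>i<n. pair_scale (c i) (l i))" using Fq_spanD[OF x] by metis
        show "x \<in> (\<lambda>c. \<Sum>i<n. pair_scale (c i) (l i)) ` ({..<n} \<rightarrow>\<^sub>E (Fq q :: 'c set))"
        proof (rule image_eqI)
          show "x = (\<Sum>i<n. pair_scale (restrict c {..<n} i) (l i))"
            unfolding c(2) by (intro sum.cong) auto
          show "restrict c {..<n} \<in> {..<n} \<rightarrow>\<^sub>E Fq q" using c(1) by auto
        qed
      qed
    qed
  qed
  then have "card (Fq_span l n) = card ({..<n} \<rightarrow>\<^sub>E (Fq q :: 'c set))" by (rule bij_betw_same_card[symmetric])
  then show ?thesis by (simp add: card_PiE card_Fq)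
qed

definition sol_deg :: "'c \<Rightarrow> 'c \<Rightarrow> 'c fps \<times> 'c fps \<Rightarrow> nat"
  where "sol_deg a b v = (LEAST J. v \<in> sol_level a b J)"

lemma sol_deg_level: "v \<in> sol a b \<Longrightarrow> v \<in> sol_level a b (sol_deg a b v)"
  unfolding sol_deg_def using sol_level_exists by (metis LeastI_ex)

lemma sol_deg_le: "v \<in> sol_level a b J \<Longrightarrow> sol_deg a b v \<le> J"
  unfolding sol_deg_def by (rule Least_le)

text \<open>Closure is inherited from the solutions: lift the vectors, combine the lifts, and return
  to constant terms.\<close>

lemma sys_kernel_Fq_combination:
  assumes "liftable a b" "\<And>i. i < n \<Longrightarrow> l i \<in> sys_kernel a b"
  shows "Fq_span l n \<subseteq> sys_kernel a b"
proof
  fix x assume x: "x \<in> Fq_span l n"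
  obtain c where c: "\<And>i. c i \<in> Fq q" "x = (\<Sum>i<n. pair_scale (c i) (l i))" using Fq_spanD[OF x] by metis
  have "\<exists>v. i < n \<longrightarrow> v \<in> sol a b \<and> pair_nth v 0 = l i" for i
    using sol_lift[OF assms(1) assms(2)] by blast
  then obtain v where v: "\<And>i. i < n \<Longrightarrow> v i \<in> sol a b \<and> pair_nth (v i) 0 = l i" by metis
  have "pair_nth (\<Sum>i<n. pair_scale (fps_const (c i)) (v i)) 0 = x"
    using v by (simp add: pair_nth_sum pair_nth_const c(2))
  moreover have "(\<Sum>i<n. pair_scale (fps_const (c i)) (v i)) \<in> sol a b"
    using v c by (intro sol_sum sol_const) auto
  ultimately show "x \<in> sys_kernel a b" using sol_nth_0 by metis
qed

text \<open>
  Successive minima with respect to \<open>sol_deg\<close>, a norm in which multiplication by \<open>T\<close> shifts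
  degrees by one.
\<close>

lemma reduced_basis_exists:
  assumes lift: "liftable a b" and "n \<le> 4"
  shows "\<exists>B. \<forall>i<n. B i \<in> sol a b \<and> pair_nth (B i) 0 \<notin> Fq_span (\<lambda>j. pair_nth (B j) 0) i \<and>
    (\<forall>w\<in>sol a b. pair_nth w 0 \<notin> Fq_span (\<lambda>j. pair_nth (B j) 0) i \<longrightarrow> sol_deg a b (B i) \<le> sol_deg a b w)"
  using assms(2)
proof (induction n)
  case (Suc n)
  then obtain B where B: "\<And>i. i < n \<Longrightarrow> B i \<in> sol a b \<and> pair_nth (B i) 0 \<notin> Fq_span (\<lambda>j. pair_nth (B j) 0) i \<and>
    (\<forall>w\<in>sol a b. pair_nth w 0 \<notin> Fq_span (\<lambda>j. pair_nth (B j) 0) i \<longrightarrow> sol_deg a b (B i) \<le> sol_deg a b w)"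
    by auto
  let ?P = "\<lambda>w. w \<in> sol a b \<and> pair_nth w 0 \<notin> Fq_span (\<lambda>j. pair_nth (B j) 0) n"
  \<comment> \<open>Counting: fewer than four independent vectors span fewer than
    \<open>q ^ 4\<close> elements, so some kernel element remains outside, and it lifts.\<close>
  have "\<exists>w. ?P w"
  proof -
    have "card (Fq_span (\<lambda>j. pair_nth (B j) 0) n) = q ^ n" using B by (intro card_Fq_span) auto
    moreover have "q ^ n < q ^ 4" using Suc.prems q_ge_2 by (intro power_strict_increasing) auto
    ultimately have "Fq_span (\<lambda>j. pair_nth (B j) 0) n \<noteq> sys_kernel a b"
      using finite_card_sys_kernel[of a b] by auto
    moreover have "Fq_span (\<lambda>j. pair_nth (B j) 0) n \<subseteq> sys_kernel a b"
      using B sol_nth_0 by (intro sys_kernel_Fq_combination[OF lift]) blast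
    ultimately obtain p where "p \<in> sys_kernel a b" "p \<notin> Fq_span (\<lambda>j. pair_nth (B j) 0) n" by blast
    then show ?thesis using sol_lift[OF lift] by blast
  qed
  then obtain w0 where w0: "?P w0" "\<And>w. ?P w \<Longrightarrow> sol_deg a b w0 \<le> sol_deg a b w"
    using ex_has_least_nat[of ?P _ "sol_deg a b"] by metis
  define B' where "B' = B(n := w0)"
  have span: "Fq_span (\<lambda>j. pair_nth (B' j) 0) i = Fq_span (\<lambda>j. pair_nth (B j) 0) i" if "i \<le> n" for i
    using that by (intro Fq_span_cong) (auto simp: B'_def)
  show ?case
  proof (intro exI[of _ B'] allI impI)
    fix i assume "i < Suc n"
    then consider "i < n" | "i = n" by linarith
    then show "B' i \<in> sol a b \<and> pair_nth (B' i) 0 \<notin> Fq_span (\<lambda>j. pair_nth (B' j) 0) i \<and>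
      (\<forall>w\<in>sol a b. pair_nth w 0 \<notin> Fq_span (\<lambda>j. pair_nth (B' j) 0) i \<longrightarrow> sol_deg a b (B' i) \<le> sol_deg a b w)"
    proof cases
      case 1
      then show ?thesis using B[of i] span[of i] by (simp add: B'_def)
    next
      case 2
      then show ?thesis using w0 span[of i] by (simp add: B'_def)
    qed
  qed
qed simp

lemma Fq_poly_pCons: "pCons d c \<in> Fq_poly q \<longleftrightarrow> d \<in> (Fq q :: 'c set) \<and> c \<in> Fq_poly q"
  by (auto simp: Fq_poly_def coeff_pCons split: nat.splits)

text \<open>For existence, subtract the constant combination of basis elements with the same
  constant term, divide by T, and induct on the level. For uniqueness, the constant terms of a
  relation vanish by independence, and the relation can again be divided by T.\<close>

lemma sol_basis:
  assumes lift: "liftable a b"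
  shows "\<exists>B. (\<forall>j<4. B j \<in> sol a b) \<and> (\<forall>v\<in>sol a b. \<exists>!c. c \<in> {..<4::nat} \<rightarrow>\<^sub>E Fq_poly q \<and>
     v = (\<Sum>j<4. pair_scale (fps_of_poly (c j)) (B j)))"
proof -
  obtain B where B: "\<And>i. i < 4 \<Longrightarrow> B i \<in> sol a b"
    "\<And>i. i < 4 \<Longrightarrow> pair_nth (B i) 0 \<notin> Fq_span (\<lambda>j. pair_nth (B j) 0) i"
    "\<And>i w. i < 4 \<Longrightarrow> w \<in> sol a b \<Longrightarrow> pair_nth w 0 \<notin> Fq_span (\<lambda>j. pair_nth (B j) 0) i \<Longrightarrow>
      sol_deg a b (B i) \<le> sol_deg a b w"
    using reduced_basis_exists[OF lift, of 4] by auto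
  define l where "l j = pair_nth (B j) 0" for j
  have l: "l = (\<lambda>j. pair_nth (B j) 0)" by (simp add: l_def fun_eq_iff)
  have span4: "Fq_span l 4 = sys_kernel a b"
  proof (rule card_subset_eq)
    show "Fq_span l 4 \<subseteq> sys_kernel a b"
      using B(1) sol_nth_0 unfolding l_def by (intro sys_kernel_Fq_combination[OF lift]) blast
    show "card (Fq_span l 4) = card (sys_kernel a b)"
      using B(2) card_Fq_span[of 4 l] finite_card_sys_kernel by (simp add: l)
  qed (rule finite_card_sys_kernel)
  have deg_mono: "sol_deg a b (B i) \<le> sol_deg a b (B j)" if "i \<le> j" "j < 4" for i j
  proof -
    have "pair_nth (B j) 0 \<notin> Fq_span l i"
      using B(2)[OF that(2)] Fq_span_mono[OF that(1), of l] by (auto simp: l)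
    then show ?thesis using that B(1)[of j] B(3)[of i "B j"] by (simp add: l)
  qed
  \<comment> \<open>This is what minimality buys: the combination uses no basis element of degree
    above that of \<open>v\<close>. With \<open>n\<close> least and positive, the constant term
    avoids the span of the first n - 1 vectors, so \<open>v\<close> was a competitor when
    \<open>B (n - 1)\<close> was chosen; earlier basis elements have no larger degree by
    \<open>deg_mono\<close>.\<close>
  have lead: "\<exists>c. (\<forall>j. c j \<in> Fq q) \<and> pair_nth v 0 = (\<Sum>j<4. pair_scale (c j) (l j)) \<and>
      (\<forall>j<4. c j \<noteq> 0 \<longrightarrow> sol_deg a b (B j) \<le> sol_deg a b v)"
    if v: "v \<in> sol a b" for v
  proof -
    define n where "n = (LEAST n. pair_nth v 0 \<in> Fq_span l n)"
    have in4: "pair_nth v 0 \<in> Fq_span l 4" using span4 sol_nth_0[OF v] by simp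
    then have n: "pair_nth v 0 \<in> Fq_span l n" unfolding n_def by (rule LeastI)
    have n4: "n \<le> 4" unfolding n_def using in4 by (rule Least_le)
    have nmin: "pair_nth v 0 \<notin> Fq_span l m" if "m < n" for m
      using that unfolding n_def by (rule not_less_Least)
    obtain c where c: "\<And>i. c i \<in> Fq q" "pair_nth v 0 = (\<Sum>i<n. pair_scale (c i) (l i))"
      using Fq_spanD[OF n] by metis
    have "sol_deg a b (B j) \<le> sol_deg a b v" if "j < n" for j
    proof -
      obtain m where m: "n = Suc m" using \<open>j < n\<close> by (cases n) auto
      have "sol_deg a b (B m) \<le> sol_deg a b v"
        using v nmin[of m] n4 m B(3)[of m v] by (simp add: l)
      moreover have "sol_deg a b (B j) \<le> sol_deg a b (B m)" using that m n4 by (intro deg_mono) auto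
      ultimately show ?thesis by simp
    qed
    moreover have "(\<Sum>i<n. pair_scale (c i) (l i)) = (\<Sum>j<4. pair_scale (if j < n then c j else 0) (l j))"
      using n4 by (intro sum.mono_neutral_cong_left) auto
    ultimately show ?thesis using c
      by (intro exI[of _ "\<lambda>j. if j < n then c j else 0"]) auto
  qed
  have ex: "\<exists>c. (\<forall>j. c j \<in> Fq_poly q) \<and> v = (\<Sum>j<4. pair_scale (fps_of_poly (c j)) (B j))"
    if "v \<in> sol_level a b J" for v J
    using that
  proof (induction J arbitrary: v)
    case 0
    then have "v = 0" by (rule sol_level_0)
    then show ?case by (intro exI[of _ "\<lambda>_. 0"]) (simp add: Fq_poly_def)
  next
    case (Suc J)
    have v: "v \<in> sol a b" using Suc.prems by (rule sol_level_sol)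
    have deg: "sol_deg a b v \<le> Suc J" using Suc.prems by (rule sol_deg_le)
    obtain c where c: "\<And>j. c j \<in> Fq q" "pair_nth v 0 = (\<Sum>j<4. pair_scale (c j) (l j))"
      "\<And>j. j < 4 \<Longrightarrow> c j \<noteq> 0 \<Longrightarrow> sol_deg a b (B j) \<le> sol_deg a b v" using lead[OF v] by metis
    define w where "w = v + (\<Sum>j<4. pair_scale (fps_const (- c j)) (B j))"
    have "pair_scale (fps_const (- c j)) (B j) \<in> sol_level a b (Suc J)" if "j < 4" for j
    proof (cases "c j = 0")
      case False
      then have "B j \<in> sol_level a b (Suc J)"
        using c(3)[of j] deg that B(1) by (intro sol_level_mono[OF sol_deg_level]) auto
      then show ?thesis using c(1) by (intro sol_level_const Fq_minus)
    qed (simp add: sol_level_def sol_zero)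
    then have w: "w \<in> sol_level a b (Suc J)"
      unfolding w_def using Suc.prems by (intro sol_level_add sol_level_sum) auto
    have "pair_nth w 0 = pair_nth v 0 + (\<Sum>j<4. pair_scale (- c j) (l j))"
      by (simp add: w_def pair_nth_add pair_nth_sum pair_nth_const l_def)
    then have "pair_nth w 0 = 0" by (simp add: c(2) pair_scale_minus_left sum_negf)
    then obtain w' where w': "w = pair_scale fps_X w'" using sol_div_X[of w a b] w sol_level_sol by metis
    then have "w' \<in> sol_level a b J" using w sol_level_X by simp
    from Suc.IH[OF this] obtain d where d: "\<And>j. d j \<in> Fq_poly q"
      "w' = (\<Sum>j<4. pair_scale (fps_of_poly (d j)) (B j))" by metis
    have "v = w - (\<Sum>j<4. pair_scale (fps_const (- c j)) (B j))" by (simp add: w_def)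
    also have "\<dots> = (\<Sum>j<4. pair_scale fps_X (pair_scale (fps_of_poly (d j)) (B j))) +
        (\<Sum>j<4. pair_scale (fps_const (c j)) (B j))"
      unfolding w' d(2) pair_scale_sum
      by (simp add: fps_const_neg[symmetric] pair_scale_minus_left sum_negf del: fps_const_neg)
    also have "\<dots> = (\<Sum>j<4. pair_scale (fps_of_poly (pCons (c j) (d j))) (B j))"
      unfolding sum.distrib[symmetric]
      by (intro sum.cong) (simp_all add: prod_eq_iff fps_of_poly_pCons algebra_simps)
    finally show ?case using c(1) d(1)
      by (intro exI[of _ "\<lambda>j. pCons (c j) (d j)"]) (simp add: Fq_poly_pCons)
  qed
  have indep: "\<forall>j<4. coeff (c j) k = 0"
    if "\<And>j. j < 4 \<Longrightarrow> c j \<in> Fq_poly q" "(\<Sum>j<4. pair_scale (fps_of_poly (c j)) (B j)) = 0" for c k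
    using that
  proof (induction k arbitrary: c)
    case (0 c)
    have n: "pair_nth (pair_scale (fps_of_poly f) v) 0 = pair_scale (coeff f 0) (pair_nth v 0)"
      for f :: "'c poly" and v by (simp add: pair_nth_def prod_eq_iff)
    have "pair_nth (\<Sum>j<4. pair_scale (fps_of_poly (c j)) (B j)) 0 = 0" using 0(2) by simp
    then have "(\<Sum>j<4. pair_scale (coeff (c j) 0) (l j)) = 0"
      by (simp only: pair_nth_sum n l_def)
    then show ?case using B(2) 0(1) unfolding l
      by (intro Fq_span_independent) (auto simp: Fq_poly_def)
  next
    case (Suc k c)
    have n: "pair_nth (pair_scale (fps_of_poly f) v) 0 = pair_scale (coeff f 0) (pair_nth v 0)"
      for f :: "'c poly" and v by (simp add: pair_nth_def prod_eq_iff)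
    have "pair_nth (\<Sum>j<4. pair_scale (fps_of_poly (c j)) (B j)) 0 = 0" using Suc.prems(2) by simp
    then have "(\<Sum>j<4. pair_scale (coeff (c j) 0) (l j)) = 0"
      by (simp only: pair_nth_sum n l_def)
    then have c0: "\<forall>j<4. coeff (c j) 0 = 0" using B(2) Suc.prems(1) unfolding l
      by (intro Fq_span_independent) (auto simp: Fq_poly_def)
    define d where "d j = poly_shift 1 (c j)" for j
    have cd: "c j = pCons 0 (d j)" if "j < 4" for j
      using c0 that by (auto simp: d_def poly_eq_iff coeff_pCons coeff_poly_shift split: nat.split)
    have "pair_scale fps_X (\<Sum>j<4. pair_scale (fps_of_poly (d j)) (B j)) =
       (\<Sum>j<4. pair_scale (fps_of_poly (c j)) (B j))"
      unfolding pair_scale_sum by (intro sum.cong) (auto simp: cd prod_eq_iff fps_of_poly_pCons)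
    then have "pair_scale fps_X (\<Sum>j<4. pair_scale (fps_of_poly (d j)) (B j)) = 0" using Suc.prems(2) by simp
    then have "(\<Sum>j<4. pair_scale (fps_of_poly (d j)) (B j)) = 0"
      by (simp add: prod_eq_iff)
    moreover have "d j \<in> Fq_poly q" if "j < 4" for j
      using Suc.prems(1)[OF that] cd[OF that] by (simp add: Fq_poly_pCons)
    ultimately have "\<forall>j<4. coeff (d j) k = 0" by (intro Suc.IH)
    then show ?case using cd by simp
  qed
  show ?thesis
  proof (intro exI[of _ B] conjI allI impI ballI)
    show "B j \<in> sol a b" if "j < 4" for j using B(1) that .
    fix v assume v: "v \<in> sol a b"
    obtain c where c: "\<And>j. c j \<in> Fq_poly q" "v = (\<Sum>j<4. pair_scale (fps_of_poly (c j)) (B j))"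
      using ex[OF sol_deg_level[OF v]] by metis
    show "\<exists>!c. c \<in> {..<4::nat} \<rightarrow>\<^sub>E Fq_poly q \<and> v = (\<Sum>j<4. pair_scale (fps_of_poly (c j)) (B j))"
    proof (rule ex1I[of _ "restrict c {..<4}"])
      show "restrict c {..<4} \<in> {..<4} \<rightarrow>\<^sub>E Fq_poly q \<and>
        v = (\<Sum>j<4. pair_scale (fps_of_poly (restrict c {..<4} j)) (B j))"
      proof
        show "restrict c {..<4} \<in> {..<4} \<rightarrow>\<^sub>E Fq_poly q" using c(1) by auto
        show "v = (\<Sum>j<4. pair_scale (fps_of_poly (restrict c {..<4} j)) (B j))"
          unfolding c(2) by (intro sum.cong) auto
      qed
      fix d assume d: "d \<in> {..<4} \<rightarrow>\<^sub>E Fq_poly q \<and> v = (\<Sum>j<4. pair_scale (fps_of_poly (d j)) (B j))"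
      have "(\<Sum>j<4. pair_scale (fps_of_poly (d j + - c j)) (B j)) =
          (\<Sum>j<4. pair_scale (fps_of_poly (d j)) (B j)) - (\<Sum>j<4. pair_scale (fps_of_poly (c j)) (B j))"
        by (simp add: sum_subtractf pair_scale_diff_left fps_of_poly_diff)
      then have z: "(\<Sum>j<4. pair_scale (fps_of_poly (d j + - c j)) (B j)) = 0" unfolding conjunct2[OF d, symmetric] c(2)[symmetric] by simp
      have dP: "d \<in> {..<4} \<rightarrow>\<^sub>E Fq_poly q" using d by (rule conjunct1)
      have "\<forall>j<4. coeff (d j + - c j) k = 0" for k
        using dP c(1) by (intro indep[OF _ z] Fq_poly_add Fq_poly_minus) auto
      then have "d j = c j" if "j < 4" for j using that by (simp add: poly_eq_iff)
      then show "d = restrict c {..<4}" using dP by (intro ext) (auto simp: PiE_def extensional_def)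
    qed
  qed
qed

subsection \<open>Skew polynomials and the module \<open>M(A)\<close>\<close>

lemma skew_mult_bound:
  assumes "degree f \<le> I" "degree g \<le> J"
  shows "skew_mult f g = (\<Sum>i\<le>I. \<Sum>j\<le>J. monom (coeff f i * coeff g j ^ (q ^ i)) (i + j))"
proof -
  have "skew_mult f g = (\<Sum>i\<le>degree f. \<Sum>j\<le>J. monom (coeff f i * coeff g j ^ (q ^ i)) (i + j))"
    unfolding skew_mult_def using assms(2)
    by (intro sum.cong refl sum.mono_neutral_left) (auto simp: coeff_eq_0 zero_power)
  also have "\<dots> = (\<Sum>i\<le>I. \<Sum>j\<le>J. monom (coeff f i * coeff g j ^ (q ^ i)) (i + j))"
    using assms(1) by (intro sum.mono_neutral_left) (auto simp: coeff_eq_0)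
  finally show ?thesis .
qed

lemma skew_mult_add_left: "skew_mult (f + f') g = skew_mult f g + skew_mult f' g"
proof -
  let ?I = "max (degree f) (degree f')"
  have "degree (f + f') \<le> ?I" by (rule degree_add_le_max)
  then show ?thesis
    by (simp add: skew_mult_bound[of _ ?I g "degree g"] sum.distrib[symmetric] distrib_right add_monom)
qed

lemma skew_mult_add_right: "skew_mult f (g + g') = skew_mult f g + skew_mult f g'"
proof -
  let ?J = "max (degree g) (degree g')"
  have "degree (g + g') \<le> ?J" by (rule degree_add_le_max)
  then show ?thesis
    by (simp add: skew_mult_bound[of f "degree f" _ ?J] sum.distrib[symmetric] distrib_left frob_add add_monom)
qed

lemma skew_mult_monom: "skew_mult (monom c i) (monom d j) = monom (c * d ^ (q ^ i)) (i + j)"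
proof -
  have "skew_mult (monom c i) (monom d j) =
    (\<Sum>i'\<le>i. \<Sum>j'\<le>j. monom (coeff (monom c i) i' * coeff (monom d j) j' ^ (q ^ i')) (i' + j'))"
    by (rule skew_mult_bound) (rule degree_monom_le)+
  also have "\<dots> = (\<Sum>i'\<le>i. if i' = i then (\<Sum>j'\<le>j. if j' = j then monom (c * d ^ (q ^ i)) (i + j) else 0) else 0)"
  proof (rule sum.cong[OF refl])
    fix i'
    have "(\<Sum>j'\<le>j. monom (c * coeff (monom d j) j' ^ (q ^ i)) (i + j')) =
      (\<Sum>j'\<le>j. if j' = j then monom (c * d ^ (q ^ i)) (i + j) else 0)"
      by (intro sum.cong refl) (auto simp: zero_power)
    then show "(\<Sum>j'\<le>j. monom (coeff (monom c i) i' * coeff (monom d j) j' ^ (q ^ i')) (i' + j')) =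
      (if i' = i then (\<Sum>j'\<le>j. if j' = j then monom (c * d ^ (q ^ i)) (i + j) else 0) else 0)"
      by simp
  qed
  finally show ?thesis by simp
qed

lemma skew_mult_zero [simp]: "skew_mult 0 g = 0" "skew_mult f 0 = 0"
  by (simp_all add: skew_mult_def zero_power)

lemma skew_mult_const: "skew_mult [:c:] f = smult c f"
  by (auto simp: skew_mult_def poly_eq_iff coeff_sum coeff_eq_0)

lemma M_const_smult: "M_const c m = (\<chi> i. smult c (m $ i))"
  by (simp add: M_const_def skew_mult_const)

lemma M_tau_add: "M_tau (m + m') = M_tau m + M_tau m'"
  by (simp add: M_tau_def vec_eq_iff skew_mult_add_right)

lemma M_T_add: "M_T A (m + m') = M_T A m + M_T A m'"
  by (simp add: M_T_def vec_eq_iff skew_mult_add_left sum.distrib)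

lemma M_const_add: "M_const c (m + m') = M_const c m + M_const c m'"
  by (simp add: M_const_smult vec_eq_iff smult_add_right)

definition M_monom :: "2 \<Rightarrow> 'c \<Rightarrow> nat \<Rightarrow> 'c poly^2"
  where "M_monom j c n = axis j (monom c n)"

lemma M_monom_zero [simp]: "M_monom j 0 n = 0"
  by (simp add: M_monom_def vec_eq_iff axis_def)

lemma M_const_monom: "M_const c (M_monom j d n) = M_monom j (c * d) n"
  by (simp add: M_monom_def M_const_smult vec_eq_iff axis_def smult_monom)

lemma M_tau_monom: "M_tau (M_monom j d n) = M_monom j (d ^ q) (Suc n)"
  by (simp add: M_monom_def M_tau_def vec_eq_iff axis_def skew_mult_monom)

abbreviation offdiag :: "'c \<Rightarrow> 'c \<Rightarrow> 'c^2^2"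
  where "offdiag a b \<equiv> vector [vector [0, a], vector [b, 0]]"

lemma M_T_monom:
  "M_T (offdiag a b) (M_monom 1 c n) =
    M_monom 1 (c * \<theta> ^ q ^ n) n + M_monom 2 (c * a ^ q ^ n) (Suc n) + M_monom 1 c (Suc (Suc n))"
  "M_T (offdiag a b) (M_monom 2 c n) =
    M_monom 2 (c * \<theta> ^ q ^ n) n + M_monom 1 (c * b ^ q ^ n) (Suc n) + M_monom 2 c (Suc (Suc n))"
  unfolding monom_0[symmetric]
  by (simp_all add: M_T_def M_monom_def vec_eq_iff axis_def T_matrix_def sum_2 forall_2
      monom_0[symmetric] skew_mult_add_right skew_mult_monom numeral_2_eq_2)

lemma M_monom_induct:
  assumes "P 0" "\<And>m m'. P m \<Longrightarrow> P m' \<Longrightarrow> P (m + m')" "\<And>j c n. P (M_monom j c n)"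
  shows "P m"
proof -
  have "P (axis j p)" for j p
  proof -
    have "axis j p = (\<Sum>n\<le>degree p. M_monom j (coeff p n) n)"
      by (subst poly_as_sum_of_monoms[symmetric]) (auto simp: vec_eq_iff axis_def M_monom_def)
    moreover have "P (\<Sum>n\<in>S. M_monom j (coeff p n) n)" for S
      using assms by (induction S rule: infinite_finite_induct) auto
    ultimately show ?thesis by simp
  qed
  moreover have "m = axis 1 (m $ 1) + axis 2 (m $ 2)" by (simp add: vec_eq_iff axis_def forall_2)
  ultimately show ?thesis using assms(2) by metis
qed

text \<open>The formula for T applied to \<open>\<tau>\<^sup>n e\<^sub>j\<close> expresses
  \<open>\<tau>\<^sup>n\<^sup>+\<^sup>2 e\<^sub>j\<close> by lower powers, so two consecutive
  exponents are carried along. This is generation by four elements over polynomials in T, the form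
  in which scalars can be moved across the tensor sign.\<close>

lemma M_generators_induct:
  assumes add: "\<And>m m'. P m \<Longrightarrow> P m' \<Longrightarrow> P (m + m')"
    and const: "\<And>c m. P m \<Longrightarrow> P (M_const c m)"
    and T: "\<And>m. P m \<Longrightarrow> P (M_T (offdiag a b) m)"
    and gen: "\<And>j. P (M_monom j 1 0)" "\<And>j. P (M_monom j 1 1)"
  shows "P m"
proof (rule M_monom_induct)
  have diff: "P (m - m')" if "P m" "P m'" for m m'
    using add[OF that(1) const[OF that(2), of "-1"]] by (simp add: M_const_smult vec_eq_iff plus_vec_def minus_vec_def)
  show "P 0" using const[OF gen(1)[of 1], of 0] by (simp add: M_const_monom)
  have "\<forall>j c. P (M_monom j c n) \<and> P (M_monom j c (Suc n))" for n
  proof (induction n)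
    case 0
    have "P (M_monom j c 0)" "P (M_monom j c 1)" for j c
      using const[OF gen(1)[of j], of c] const[OF gen(2)[of j], of c] by (simp_all add: M_const_monom)
    then show ?case by simp
  next
    case (Suc n)
    have "P (M_monom j c (Suc (Suc n)))" for j c
    proof (cases "j = 1")
      case True
      have "M_monom 1 c (Suc (Suc n)) = M_T (offdiag a b) (M_monom 1 c n) -
          M_monom 1 (c * \<theta> ^ q ^ n) n - M_monom 2 (c * a ^ q ^ n) (Suc n)"
        unfolding M_T_monom by simp
      then show ?thesis using Suc T diff True by auto
    next
      case False
      then have "j = 2" using exhaust_2 by blast
      have "M_monom 2 c (Suc (Suc n)) = M_T (offdiag a b) (M_monom 2 c n) -
          M_monom 2 (c * \<theta> ^ q ^ n) n - M_monom 1 (c * b ^ q ^ n) (Suc n)"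
        unfolding M_T_monom by simp
      then show ?thesis using Suc T diff \<open>j = 2\<close> by auto
    qed
    then show ?case using Suc by simp
  qed
  then show "P (M_monom j c n)" for j c n by blast
qed (rule add)

subsection \<open>Coordinates\<close>

lemma tate_tau_nth [simp]: "fps_nth (tate_tau f) i = fps_nth f i ^ q"
  by (simp add: tate_tau_def)

lemma tate_tau_add: "tate_tau (f + g) = tate_tau f + tate_tau g"
  by (simp add: fps_eq_iff frob_q_add)

lemma tate_tau_zero [simp]: "tate_tau 0 = 0"
  by (simp add: fps_eq_iff zero_power)

lemma tate_tau_one [simp]: "tate_tau 1 = 1"
  by (simp add: fps_eq_iff zero_power)

lemma tate_tau_const: "tate_tau (fps_const c) = fps_const (c ^ q)"
  by (simp add: fps_eq_iff zero_power)

lemma tate_tau_X: "tate_tau fps_X = fps_X"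
  by (simp add: fps_eq_iff fps_X_def zero_power)

lemma tate_tau_mult: "tate_tau (f * g) = tate_tau f * tate_tau g"
  by (simp add: fps_eq_iff fps_mult_nth frob_q_sum power_mult_distrib)

text \<open>
  \<open>((u\<^sub>1, u\<^sub>2), (v\<^sub>1, v\<^sub>2))\<close> stands for \<open>u\<^sub>1 e\<^sub>1 + u\<^sub>2 e\<^sub>2 + v\<^sub>1 \<tau> e\<^sub>1 + v\<^sub>2 \<tau> e\<^sub>2\<close>. The formula for \<open>\<tau>\<close> in these
  coordinates comes from \<open>\<tau>\<^sup>2 e\<^sub>* = (T - \<theta>) e\<^sub>* - A \<tau> e\<^sub>*\<close>.
\<close>

type_synonym 'd crd = "('d fps \<times> 'd fps) \<times> ('d fps \<times> 'd fps)"

definition crd_scale :: "'c fps \<Rightarrow> 'c crd \<Rightarrow> 'c crd"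
  where "crd_scale f w = (pair_scale f (fst w), pair_scale f (snd w))"

definition crd_tau :: "'c \<Rightarrow> 'c \<Rightarrow> 'c crd \<Rightarrow> 'c crd"
  where "crd_tau a b w =
    (((fps_X - fps_const \<theta>) * tate_tau (fst (snd w)), (fps_X - fps_const \<theta>) * tate_tau (snd (snd w))),
     (tate_tau (fst (fst w)) - fps_const b * tate_tau (snd (snd w)),
      tate_tau (snd (fst w)) - fps_const a * tate_tau (fst (snd w))))"

lemma crd_eq_iff: "w = w' \<longleftrightarrow> fst (fst w) = fst (fst w') \<and> snd (fst w) = snd (fst w') \<and>
    fst (snd w) = fst (snd w') \<and> snd (snd w) = snd (snd (w' :: 'c crd))"
  by (auto simp: prod_eq_iff)

lemma crd_scale_add: "crd_scale (f + g) w = crd_scale f w + crd_scale g w"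
  and crd_scale_add_right: "crd_scale f (w + w') = crd_scale f w + crd_scale f w'"
  and crd_scale_mult: "crd_scale (f * g) w = crd_scale f (crd_scale g w)"
  and crd_scale_minus: "crd_scale f (- w) = - crd_scale f w"
  by (simp_all add: crd_eq_iff crd_scale_def algebra_simps)

lemma crd_scale_zero [simp]: "crd_scale 0 w = 0" "crd_scale f 0 = 0" "crd_scale 1 w = w"
  by (simp_all add: crd_eq_iff crd_scale_def)

lemma crd_scale_sum_left: "crd_scale (sum h I) w = (\<Sum>i\<in>I. crd_scale (h i) w)"
  by (induction I rule: infinite_finite_induct) (simp_all add: crd_scale_add)

lemma crd_tau_add: "crd_tau a b (w + w') = crd_tau a b w + crd_tau a b w'"
  by (simp add: crd_eq_iff crd_tau_def tate_tau_add algebra_simps)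

lemma crd_tau_zero [simp]: "crd_tau a b 0 = 0"
  by (simp add: crd_eq_iff crd_tau_def)

lemma crd_tau_minus: "crd_tau a b (- w) = - crd_tau a b w"
  using crd_tau_add[of a b w "- w"] by (simp add: eq_neg_iff_add_eq_0 add.commute)

lemma crd_tau_scale: "crd_tau a b (crd_scale f w) = crd_scale (tate_tau f) (crd_tau a b w)"
  by (simp add: crd_eq_iff crd_tau_def crd_scale_def tate_tau_mult algebra_simps)

definition unit_crd :: "2 \<Rightarrow> 'c crd"
  where "unit_crd j = (if j = 1 then ((1, 0), 0) else ((0, 1), 0))"

text \<open>The coordinates of \<open>\<tau>\<^sup>n e\<^sub>j\<close>. Iterating the semilinear map
  makes compatibility with \<tau> automatic and leaves only compatibility with T to be
  proved.\<close>

definition monom_crd :: "'c \<Rightarrow> 'c \<Rightarrow> 2 \<Rightarrow> nat \<Rightarrow> 'c crd"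
  where "monom_crd a b j n = (crd_tau a b ^^ n) (unit_crd j)"

lemma monom_crd_Suc: "monom_crd a b j (Suc n) = crd_tau a b (monom_crd a b j n)"
  by (simp add: monom_crd_def)

lemma monom_crd_0: "monom_crd a b 1 0 = ((1, 0), (0, 0))" "monom_crd a b 2 0 = ((0, 1), (0, 0))"
  by (simp_all add: monom_crd_def unit_crd_def zero_prod_def)

lemma monom_crd_1: "monom_crd a b 1 (Suc 0) = ((0, 0), (1, 0))" "monom_crd a b 2 (Suc 0) = ((0, 0), (0, 1))"
  by (simp_all add: monom_crd_Suc monom_crd_0 crd_tau_def)

text \<open>At n = 0 this is the formula defining \<open>crd_tau\<close>. Applying
  \<open>crd_tau\<close>, which commutes with T and raises constants to the power q, leads from n to
  n + 1.\<close>

lemma monom_crd_T: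
  "crd_scale fps_X (monom_crd a b 1 n) = crd_scale (fps_const (\<theta> ^ q ^ n)) (monom_crd a b 1 n) +
    crd_scale (fps_const (a ^ q ^ n)) (monom_crd a b 2 (Suc n)) + monom_crd a b 1 (Suc (Suc n)) \<and>
   crd_scale fps_X (monom_crd a b 2 n) = crd_scale (fps_const (\<theta> ^ q ^ n)) (monom_crd a b 2 n) +
    crd_scale (fps_const (b ^ q ^ n)) (monom_crd a b 1 (Suc n)) + monom_crd a b 2 (Suc (Suc n))"
proof (induction n)
  case 0
  show ?case
    by (simp add: monom_crd_1 monom_crd_0 monom_crd_Suc[of a b _ "Suc 0"] crd_tau_def crd_scale_def pair_scale_def)
next
  case (Suc n)
  have p: "(c ^ q ^ n) ^ q = c ^ q ^ Suc n" for c :: 'c by (simp add: power_mult[symmetric] mult.commute)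
  show ?case
    using arg_cong[OF conjunct1[OF Suc], of "crd_tau a b"] arg_cong[OF conjunct2[OF Suc], of "crd_tau a b"]
    by (simp only: crd_tau_add crd_tau_scale tate_tau_X tate_tau_const p monom_crd_Suc[symmetric])
qed

definition poly_crd :: "'c \<Rightarrow> 'c \<Rightarrow> 2 \<Rightarrow> 'c poly \<Rightarrow> 'c crd"
  where "poly_crd a b j p = (\<Sum>n\<le>degree p. crd_scale (fps_const (coeff p n)) (monom_crd a b j n))"

definition crd :: "'c \<Rightarrow> 'c \<Rightarrow> 'c poly^2 \<Rightarrow> 'c crd"
  where "crd a b m = poly_crd a b 1 (m $ 1) + poly_crd a b 2 (m $ 2)"

lemma poly_crd_bound: "degree p \<le> N \<Longrightarrow>
    poly_crd a b j p = (\<Sum>n\<le>N. crd_scale (fps_const (coeff p n)) (monom_crd a b j n))"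
  unfolding poly_crd_def by (intro sum.mono_neutral_left) (auto simp: coeff_eq_0)

lemma poly_crd_add: "poly_crd a b j (p + p') = poly_crd a b j p + poly_crd a b j p'"
proof -
  let ?N = "max (degree p) (degree p')"
  have "degree (p + p') \<le> ?N" by (rule degree_add_le_max)
  then show ?thesis
    by (simp add: poly_crd_bound[of _ ?N] sum.distrib[symmetric] crd_scale_add[symmetric])
qed

lemma poly_crd_monom: "poly_crd a b j (monom c n) = crd_scale (fps_const c) (monom_crd a b j n)"
proof -
  have "poly_crd a b j (monom c n) = (\<Sum>k\<le>n. if k = n then crd_scale (fps_const c) (monom_crd a b j n) else 0)"
    unfolding poly_crd_bound[OF degree_monom_le] by (intro sum.cong) auto
  then show ?thesis by simp
qed

lemma crd_add: "crd a b (m + m') = crd a b m + crd a b m'"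
  by (simp add: crd_def poly_crd_add)

lemma crd_zero [simp]: "crd a b 0 = 0"
  by (simp add: crd_def poly_crd_def)

lemma crd_monom: "crd a b (M_monom j c n) = crd_scale (fps_const c) (monom_crd a b j n)"
proof -
  have "poly_crd a b i 0 = 0" for i by (simp add: poly_crd_def)
  then show ?thesis using exhaust_2[of j]
    by (auto simp: crd_def M_monom_def axis_def poly_crd_monom)
qed

lemma crd_const: "crd a b (M_const c m) = crd_scale (fps_const c) (crd a b m)"
proof (induction m rule: M_monom_induct)
  case 1
  have "M_const c 0 = 0" by (simp add: M_const_smult vec_eq_iff)
  then show ?case by simp
next
  case (3 j d n)
  then show ?case by (simp add: M_const_monom crd_monom crd_scale_mult[symmetric])
qed (simp add: M_const_add crd_add crd_scale_add_right)

lemma crd_M_tau: "crd a b (M_tau m) = crd_tau a b (crd a b m)"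
proof (induction m rule: M_monom_induct)
  case 1
  have "M_tau 0 = 0" by (simp add: M_tau_def vec_eq_iff)
  then show ?case by simp
next
  case (3 j d n)
  then show ?case by (simp add: M_tau_monom crd_monom crd_tau_scale tate_tau_const monom_crd_Suc)
qed (simp add: M_tau_add crd_add crd_tau_add)

lemma crd_M_T: "crd a b (M_T (offdiag a b) m) = crd_scale fps_X (crd a b m)"
proof (induction m rule: M_monom_induct)
  case 1
  have "M_T (offdiag a b) 0 = 0" by (simp add: M_T_def vec_eq_iff)
  then show ?case by simp
next
  case (3 j c n)
  have com: "crd_scale fps_X (crd_scale (fps_const c) w) = crd_scale (fps_const c) (crd_scale fps_X w)" for w
    by (simp add: crd_scale_mult[symmetric] mult.commute)
  show ?case
    using exhaust_2[of j] monom_crd_T[of a b n]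
    by (auto simp: M_T_monom crd_add crd_monom com crd_scale_add_right fps_const_mult[symmetric] crd_scale_mult
        simp del: fps_const_mult)
qed (simp add: M_T_add crd_add crd_scale_add_right)

lemma crd_M_poly: "crd a b (M_poly (offdiag a b) g m) = crd_scale (fps_of_poly g) (crd a b m)"
proof -
  have sum: "crd a b (sum h I) = (\<Sum>i\<in>I. crd a b (h i))" for h and I :: "nat set"
    by (induction I rule: infinite_finite_induct) (simp_all add: crd_add)
  have pow: "crd a b ((M_T (offdiag a b) ^^ k) m) = crd_scale (fps_X ^ k) (crd a b m)" for k
    by (induction k) (simp_all add: crd_M_T crd_scale_mult)
  have "crd a b (M_poly (offdiag a b) g m) =
     (\<Sum>k\<le>degree g. crd_scale (fps_const (coeff g k) * fps_X ^ k) (crd a b m))"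
    by (simp add: M_poly_def sum crd_const pow crd_scale_mult)
  also have "\<dots> = crd_scale (fps_of_poly (\<Sum>k\<le>degree g. monom (coeff g k) k)) (crd a b m)"
    by (simp add: fps_of_poly_sum fps_of_poly_monom crd_scale_sum_left)
  finally show ?thesis by (simp add: poly_as_sum_of_monoms)
qed

subsection \<open>The tensor product in coordinates\<close>

lemma tate_iff: "f \<in> tate \<longleftrightarrow> null_seq (fps_nth f)"
  by (simp add: tate_def tendsto_infinity_iff null_seq_def)

lemma tate_poly_apply: "tate_poly g f = fps_of_poly g * f"
  by (simp add: tate_poly_def)

lemma tate_add: "f \<in> tate \<Longrightarrow> g \<in> tate \<Longrightarrow> f + g \<in> tate"
  by (simp add: tate_iff fps_nth_add_fun null_seq_add)

lemma tate_zero [simp]: "0 \<in> tate"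
  by (simp add: tate_iff null_seq_def)

lemma tate_const_mult: "f \<in> tate \<Longrightarrow> fps_const c * f \<in> tate"
  by (simp add: tate_iff fps_nth_const_mult_fun null_seq_const_mult)

lemma tate_minus: "f \<in> tate \<Longrightarrow> - f \<in> tate"
  using tate_const_mult[of f "-1"] by (simp add: fps_const_neg[symmetric] del: fps_const_neg)

lemma tate_X_mult: "f \<in> tate \<Longrightarrow> fps_X * f \<in> tate"
  by (simp add: tate_iff fps_nth_X_mult null_seq_shift)

lemma tate_poly_tate: "f \<in> tate \<Longrightarrow> tate_poly g f \<in> tate"
proof (induction g)
  case (pCons c g)
  have "tate_poly (pCons c g) f = fps_const c * f + fps_X * tate_poly g f"
    by (simp add: tate_poly_apply fps_of_poly_pCons algebra_simps)
  then show ?case using pCons by (simp add: tate_add tate_const_mult tate_X_mult)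
qed (simp add: tate_poly_apply)

lemma tate_tau_tate: "f \<in> tate \<Longrightarrow> tate_tau f \<in> tate"
proof -
  assume f: "f \<in> tate"
  have "null_seq (\<lambda>i. fps_nth f i ^ q)" unfolding null_seq_def
  proof
    fix r
    obtain N where N: "\<And>n. n \<ge> N \<Longrightarrow> fps_nth f n \<in> val_ball (max 0 r)"
      using f unfolding tate_iff null_seq_def by meson
    have "max 0 r \<le> real q * max 0 r" using q_real mult_right_mono[of 1 "real q" "max 0 r"] by simp
    then have "r \<le> real q * max 0 r" by linarith
    then show "\<exists>N. \<forall>n\<ge>N. fps_nth f n ^ q \<in> val_ball r"
      using ball_mono[OF ball_power[OF N q_pos]] by blast
  qed
  then show ?thesis by (simp add: tate_iff tate_tau_def Abs_fps_inverse)
qed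

definition crd_tate :: "'c crd set"
  where "crd_tate = {w. fst (fst w) \<in> tate \<and> snd (fst w) \<in> tate \<and> fst (snd w) \<in> tate \<and> snd (snd w) \<in> tate}"

lemma crd_scale_tate_poly: "crd_scale (tate_poly g f) w = crd_scale f (crd_scale (fps_of_poly g) w)"
  by (simp add: tate_poly_apply crd_scale_mult[symmetric] mult.commute)

lemma crd_tate_add: "w \<in> crd_tate \<Longrightarrow> w' \<in> crd_tate \<Longrightarrow> w + w' \<in> crd_tate"
  by (simp add: crd_tate_def tate_add)

lemma crd_tate_minus: "w \<in> crd_tate \<Longrightarrow> - w \<in> crd_tate"
  by (simp add: crd_tate_def tate_minus)

lemma crd_tate_zero [simp]: "0 \<in> crd_tate"
  by (simp add: crd_tate_def)

lemma crd_tate_sum: "(\<And>i. i \<in> I \<Longrightarrow> h i \<in> crd_tate) \<Longrightarrow> sum h I \<in> crd_tate"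
  by (induction I rule: infinite_finite_induct) (simp_all add: crd_tate_add)

lemma crd_tate_tau:
  assumes "w \<in> crd_tate"
  shows "crd_tau a b w \<in> crd_tate"
proof -
  have d: "f - g \<in> tate" if "f \<in> tate" "g \<in> tate" for f g
    using tate_add[OF that(1) tate_minus[OF that(2)]] by simp
  show ?thesis using assms
    by (auto simp: crd_tate_def crd_tau_def left_diff_distrib intro!: d tate_const_mult tate_X_mult tate_tau_tate)
qed

text \<open>The series \<open>f\<close> is kept arbitrary, so that a constant or T acting on
  \<open>m\<close> can be absorbed into it.\<close>

lemma crd_scale_tate: "f \<in> tate \<Longrightarrow> crd_scale f (crd a b m) \<in> crd_tate"
proof (induction m arbitrary: f rule: M_generators_induct[where a = a and b = b])
  case (1 m m')
  then show ?case by (simp add: crd_add crd_scale_add_right crd_tate_add)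
next
  case (2 c m)
  then have "crd_scale (fps_const c * f) (crd a b m) \<in> crd_tate" by (simp add: tate_const_mult)
  then show ?case by (simp add: crd_const crd_scale_mult[symmetric] mult.commute)
next
  case (3 m)
  then have "crd_scale (fps_X * f) (crd a b m) \<in> crd_tate" by (simp add: tate_X_mult)
  then show ?case by (simp add: crd_M_T crd_scale_mult[symmetric] mult.commute)
next
  case (4 j)
  then show ?case using exhaust_2[of j]
    by (auto simp: crd_monom monom_crd_0 crd_scale_def pair_scale_def crd_tate_def)
next
  case (5 j)
  then show ?case using exhaust_2[of j]
    by (auto simp: crd_monom monom_crd_1 crd_scale_def pair_scale_def crd_tate_def)
qed

type_synonym 'd frag_fps = "(('d poly^2) \<times> 'd fps) \<Rightarrow>\<^sub>0 int"

abbreviation "FG \<equiv> free_Abelian_group (UNIV \<times> tate) :: 'c frag_fps monoid"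

abbreviation ker_rel :: "'c \<Rightarrow> 'c \<Rightarrow> 'c frag_fps set"
  where "ker_rel a b \<equiv> tensor_kernel (M_poly (offdiag a b)) tate_poly tate"

text \<open>The homomorphism that will identify the tensor product with \<open>crd_tate\<close>: by
  \<open>ker_rel_iff\<close> its kernel on \<open>FG\<close> is exactly the subgroup of tensor
  relations.\<close>

definition frag_crd :: "'c \<Rightarrow> 'c \<Rightarrow> 'c frag_fps \<Rightarrow> 'c crd"
  where "frag_crd a b x = (\<Sum>k\<in>Poly_Mapping.keys x.
     crd_scale (of_int (Poly_Mapping.lookup x k)) (crd_scale (snd k) (crd a b (fst k))))"

lemma frag_crd_superset:
  "finite K \<Longrightarrow> Poly_Mapping.keys x \<subseteq> K \<Longrightarrow> frag_crd a b x =
    (\<Sum>k\<in>K. crd_scale (of_int (Poly_Mapping.lookup x k)) (crd_scale (snd k) (crd a b (fst k))))"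
  unfolding frag_crd_def by (intro sum.mono_neutral_left) (auto simp: in_keys_iff)

lemma frag_crd_add: "frag_crd a b (x + y) = frag_crd a b x + frag_crd a b y"
proof -
  let ?K = "Poly_Mapping.keys x \<union> Poly_Mapping.keys y"
  have "Poly_Mapping.keys (x + y) \<subseteq> ?K" by (rule keys_add)
  then show ?thesis
    by (simp add: frag_crd_superset[of ?K] Poly_Mapping.lookup_add crd_scale_add sum.distrib)
qed

lemma frag_crd_zero [simp]: "frag_crd a b 0 = 0"
  by (simp add: frag_crd_def)

lemma frag_crd_minus: "frag_crd a b (- x) = - frag_crd a b x"
  using frag_crd_add[of a b x "- x"] by (simp add: eq_neg_iff_add_eq_0 add.commute)

lemma frag_crd_diff: "frag_crd a b (x - y) = frag_crd a b x - frag_crd a b y"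
  using frag_crd_add[of a b x "- y"] by (simp add: frag_crd_minus)

lemma frag_crd_of: "frag_crd a b (frag_of (m, f)) = crd_scale f (crd a b m)"
  by (simp add: frag_crd_def)

lemma FG_closed:
  "x \<in> carrier FG \<Longrightarrow> y \<in> carrier FG \<Longrightarrow> x + y \<in> carrier FG"
  "x \<in> carrier FG \<Longrightarrow> y \<in> carrier FG \<Longrightarrow> x - y \<in> carrier FG"
  "f \<in> tate \<Longrightarrow> frag_of (m, f) \<in> carrier FG"
  using keys_add[of x y] keys_diff[of x y] by auto

lemma FG_induct [consumes 1, case_names zero diff gen]:
  assumes "x \<in> carrier FG" "P 0"
    "\<And>x y. x \<in> carrier FG \<Longrightarrow> y \<in> carrier FG \<Longrightarrow> P x \<Longrightarrow> P y \<Longrightarrow> P (x - y)"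
    "\<And>m f. f \<in> tate \<Longrightarrow> P (frag_of (m, f))"
  shows "P x"
  using assms(1) unfolding carrier_free_Abelian_group_iff
  by (rule free_Abelian_group_induct) (use assms(2-4) in auto)

lemma frag_crd_tate: "x \<in> carrier FG \<Longrightarrow> frag_crd a b x \<in> crd_tate"
proof (induction x rule: FG_induct)
  case (diff x y)
  then show ?case using crd_tate_add[OF diff(3) crd_tate_minus[OF diff(4)]] by (simp add: frag_crd_diff)
qed (simp_all add: frag_crd_of crd_scale_tate)

lemma tensor_relations_carrier:
  "tensor_relations (M_poly (offdiag a b)) tate_poly tate \<subseteq> carrier FG"
  unfolding tensor_relations_def by (auto intro!: FG_closed tate_add tate_poly_tate simp del: carrier_free_Abelian_group_iff)

lemma ker_rel_subgroup: "subgroup (ker_rel a b) FG"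
  unfolding tensor_kernel_def
  by (intro group.generate_is_subgroup tensor_relations_carrier) simp

lemma ker_rel_carrier: "x \<in> ker_rel a b \<Longrightarrow> x \<in> carrier FG"
  using subgroup.subset[OF ker_rel_subgroup] by blast

lemma ker_rel_add: "x \<in> ker_rel a b \<Longrightarrow> y \<in> ker_rel a b \<Longrightarrow> x + y \<in> ker_rel a b"
  using subgroup.m_closed[OF ker_rel_subgroup] by simp

lemma ker_rel_minus: "x \<in> ker_rel a b \<Longrightarrow> - x \<in> ker_rel a b"
  using subgroup.m_inv_closed[OF ker_rel_subgroup, of x a b] ker_rel_carrier[of x a b] by simp

lemma ker_rel_diff: "x \<in> ker_rel a b \<Longrightarrow> y \<in> ker_rel a b \<Longrightarrow> x - y \<in> ker_rel a b"
  using ker_rel_add[OF _ ker_rel_minus] by simp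

lemma ker_rel_crd: "x \<in> ker_rel a b \<Longrightarrow> frag_crd a b x = 0"
  unfolding tensor_kernel_def
proof (induction rule: generate.induct)
  case (incl x)
  then show ?case unfolding tensor_relations_def
    by (auto simp: frag_crd_diff frag_crd_of crd_add crd_scale_add crd_scale_add_right crd_M_poly
        tate_poly_apply crd_scale_mult[symmetric] mult.commute)
next
  case (inv x)
  then have "frag_crd a b x = 0" unfolding tensor_relations_def
    by (auto simp: frag_crd_diff frag_crd_of crd_add crd_scale_add crd_scale_add_right crd_M_poly
        tate_poly_apply crd_scale_mult[symmetric] mult.commute)
  moreover have "x \<in> carrier FG" using inv tensor_relations_carrier by blast
  ultimately show ?case by (simp add: frag_crd_minus)
qed (simp_all add: frag_crd_add)

lemma ker_rel_bilinear:
  "f \<in> tate \<Longrightarrow> frag_of (m + m', f) - frag_of (m, f) - frag_of (m', f) \<in> ker_rel a b"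
  "f \<in> tate \<Longrightarrow> f' \<in> tate \<Longrightarrow> frag_of (m, f + f') - frag_of (m, f) - frag_of (m, f') \<in> ker_rel a b"
  "f \<in> tate \<Longrightarrow> frag_of (M_poly (offdiag a b) g m, f) - frag_of (m, tate_poly g f) \<in> ker_rel a b"
  unfolding tensor_kernel_def tensor_relations_def by (rule generate.incl; blast)+

text \<open>A section of \<open>frag_crd\<close>. It is additive only modulo the relations, and even
  \<open>crd_rep 0\<close> is a nonzero formal sum.\<close>

definition crd_rep :: "'c crd \<Rightarrow> 'c frag_fps"
  where "crd_rep w = frag_of (M_monom 1 1 0, fst (fst w)) + frag_of (M_monom 2 1 0, snd (fst w)) +
     frag_of (M_monom 1 1 1, fst (snd w)) + frag_of (M_monom 2 1 1, snd (snd w))"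

lemma crd_rep_carrier: "w \<in> crd_tate \<Longrightarrow> crd_rep w \<in> carrier FG"
  unfolding crd_rep_def crd_tate_def
  by (auto intro!: FG_closed simp del: carrier_free_Abelian_group_iff)

lemma frag_crd_rep: "frag_crd a b (crd_rep w) = w"
  by (simp add: crd_rep_def frag_crd_add frag_crd_of crd_monom monom_crd_0 monom_crd_1 crd_eq_iff
      crd_scale_def pair_scale_def)

lemma crd_rep_add:
  assumes "w \<in> crd_tate" "w' \<in> crd_tate"
  shows "crd_rep (w + w') - crd_rep w - crd_rep w' \<in> ker_rel a b"
proof -
  have "(frag_of (M_monom 1 1 0, fst (fst w) + fst (fst w')) - frag_of (M_monom 1 1 0, fst (fst w)) - frag_of (M_monom 1 1 0, fst (fst w'))) +
     (frag_of (M_monom 2 1 0, snd (fst w) + snd (fst w')) - frag_of (M_monom 2 1 0, snd (fst w)) - frag_of (M_monom 2 1 0, snd (fst w'))) +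
     (frag_of (M_monom 1 1 1, fst (snd w) + fst (snd w')) - frag_of (M_monom 1 1 1, fst (snd w)) - frag_of (M_monom 1 1 1, fst (snd w'))) +
     (frag_of (M_monom 2 1 1, snd (snd w) + snd (snd w')) - frag_of (M_monom 2 1 1, snd (snd w)) - frag_of (M_monom 2 1 1, snd (snd w'))) \<in> ker_rel a b"
    using assms by (intro ker_rel_add ker_rel_bilinear) (auto simp: crd_tate_def)
  then show ?thesis by (simp add: crd_rep_def algebra_simps)
qed

lemma crd_rep_zero: "crd_rep 0 \<in> ker_rel a b"
  using ker_rel_minus[OF crd_rep_add[of 0 0 a b]] by simp

lemma frag_of_zero_ker: "frag_of (m, 0) \<in> ker_rel a b"
  using ker_rel_minus[OF ker_rel_bilinear(2)[of 0 0 m a b]] by simp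

text \<open>Every pure tensor reduces to the four generators: constants and T pass from
  \<open>m\<close> to \<open>f\<close> by the relations, hence \<open>f\<close> is arbitrary in the
  induction. At a generator the two sides differ only by tensors with second factor 0, because
  \<open>crd_rep\<close> always has four summands.\<close>

lemma frag_of_ker: "f \<in> tate \<Longrightarrow> frag_of (m, f) - crd_rep (crd_scale f (crd a b m)) \<in> ker_rel a b"
proof (induction m arbitrary: f rule: M_generators_induct[where a = a and b = b])
  case (1 m m')
  let ?w = "crd_scale f (crd a b m)" and ?w' = "crd_scale f (crd a b m')"
  have "(frag_of (m + m', f) - frag_of (m, f) - frag_of (m', f)) +
     (frag_of (m, f) - crd_rep ?w) + (frag_of (m', f) - crd_rep ?w') - (crd_rep (?w + ?w') - crd_rep ?w - crd_rep ?w')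
     \<in> ker_rel a b"
    using 1(3) by (intro ker_rel_diff[OF ker_rel_add[OF ker_rel_add]] ker_rel_bilinear(1) 1(1,2)
      crd_rep_add crd_scale_tate)
  then show ?case by (simp add: crd_add crd_scale_add_right algebra_simps)
next
  case (2 c m)
  have M: "M_const c m = M_poly (offdiag a b) [:c:] m" by (simp add: M_poly_def)
  have "(frag_of (M_poly (offdiag a b) [:c:] m, f) - frag_of (m, tate_poly [:c:] f)) +
      (frag_of (m, tate_poly [:c:] f) - crd_rep (crd_scale (tate_poly [:c:] f) (crd a b m))) \<in> ker_rel a b"
    using 2 by (intro ker_rel_add ker_rel_bilinear(3) 2(1) tate_poly_tate)
  then show ?case
    by (simp add: M crd_M_poly crd_scale_tate_poly)
next
  case (3 m)
  have "M_const 0 m + M_const 1 (M_T (offdiag a b) m) = M_T (offdiag a b) m"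
    by (simp add: M_const_smult vec_eq_iff)
  then have M: "M_T (offdiag a b) m = M_poly (offdiag a b) [:0, 1:] m" by (simp add: M_poly_def)
  have "(frag_of (M_poly (offdiag a b) [:0, 1:] m, f) - frag_of (m, tate_poly [:0, 1:] f)) +
      (frag_of (m, tate_poly [:0, 1:] f) - crd_rep (crd_scale (tate_poly [:0, 1:] f) (crd a b m))) \<in> ker_rel a b"
    using 3 by (intro ker_rel_add ker_rel_bilinear(3) 3(1) tate_poly_tate)
  then show ?case
    by (simp add: M crd_M_poly crd_scale_tate_poly del: fps_of_poly_fps_X)
next
  case (4 j)
  have "- (frag_of (M_monom 2 1 0, 0) + frag_of (M_monom 1 1 1, 0) + frag_of (M_monom 2 1 1, 0)) \<in> ker_rel a b"
    "- (frag_of (M_monom 1 1 0, 0) + frag_of (M_monom 1 1 1, 0) + frag_of (M_monom 2 1 1, 0)) \<in> ker_rel a b"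
    by (intro ker_rel_minus ker_rel_add frag_of_zero_ker)+
  then show ?case using exhaust_2[of j]
    by (auto simp: crd_monom monom_crd_0 crd_scale_def pair_scale_def crd_rep_def algebra_simps)
next
  case (5 j)
  have "- (frag_of (M_monom 1 1 0, 0) + frag_of (M_monom 2 1 0, 0) + frag_of (M_monom 2 1 1, 0)) \<in> ker_rel a b"
    "- (frag_of (M_monom 1 1 0, 0) + frag_of (M_monom 2 1 0, 0) + frag_of (M_monom 1 1 1, 0)) \<in> ker_rel a b"
    by (intro ker_rel_minus ker_rel_add frag_of_zero_ker)+
  then show ?case using exhaust_2[of j]
    by (auto simp: crd_monom monom_crd_1 crd_scale_def pair_scale_def crd_rep_def algebra_simps)
qed

lemma rep_frag_crd: "x \<in> carrier FG \<Longrightarrow> x - crd_rep (frag_crd a b x) \<in> ker_rel a b"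
proof (induction x rule: FG_induct)
  case zero
  then show ?case using ker_rel_minus[OF crd_rep_zero] by simp
next
  case (diff x y)
  have t: "frag_crd a b x \<in> crd_tate" "frag_crd a b y \<in> crd_tate" using diff by (simp_all only: frag_crd_tate)
  have "crd_rep ((frag_crd a b x - frag_crd a b y) + frag_crd a b y) -
     crd_rep (frag_crd a b x - frag_crd a b y) - crd_rep (frag_crd a b y) \<in> ker_rel a b"
    using crd_tate_add[OF t(1) crd_tate_minus[OF t(2)]] t by (intro crd_rep_add) simp_all
  from ker_rel_add[OF ker_rel_diff[OF diff(3) diff(4)] this]
  show ?case by (simp add: frag_crd_diff algebra_simps)
next
  case (gen m f)
  then show ?case by (simp add: frag_crd_of frag_of_ker)
qed

lemma ker_rel_iff: "x \<in> ker_rel a b \<longleftrightarrow> x \<in> carrier FG \<and> frag_crd a b x = 0"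
proof
  assume "x \<in> carrier FG \<and> frag_crd a b x = 0"
  then have "(x - crd_rep 0) + crd_rep 0 \<in> ker_rel a b"
    using rep_frag_crd[of x a b] by (intro ker_rel_add crd_rep_zero) simp
  then show "x \<in> ker_rel a b" by simp
qed (use ker_rel_crd ker_rel_carrier in blast)

section \<open>Cosets as fibres of the coordinate map\<close>

definition crd_class :: "'c \<Rightarrow> 'c \<Rightarrow> 'c crd \<Rightarrow> 'c frag_fps set"
  where "crd_class a b w = {x \<in> carrier FG. frag_crd a b x = w}"

lemma coset_eq_class:
  assumes "x \<in> carrier FG"
  shows "ker_rel a b #>\<^bsub>FG\<^esub> x = crd_class a b (frag_crd a b x)"
proof
  show "ker_rel a b #>\<^bsub>FG\<^esub> x \<subseteq> crd_class a b (frag_crd a b x)"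
    using assms FG_closed(1) ker_rel_carrier
    by (auto simp: r_coset_def crd_class_def frag_crd_add ker_rel_crd simp del: carrier_free_Abelian_group_iff)
  show "crd_class a b (frag_crd a b x) \<subseteq> ker_rel a b #>\<^bsub>FG\<^esub> x"
  proof
    fix z assume "z \<in> crd_class a b (frag_crd a b x)"
    then have "z - x \<in> ker_rel a b" unfolding ker_rel_iff
      using assms FG_closed(2) by (simp add: crd_class_def frag_crd_diff del: carrier_free_Abelian_group_iff)
    then show "z \<in> ker_rel a b #>\<^bsub>FG\<^esub> x" unfolding r_coset_def by force
  qed
qed

lemma crd_class_coset: "w \<in> crd_tate \<Longrightarrow> crd_class a b w = ker_rel a b #>\<^bsub>FG\<^esub> crd_rep w"
  using coset_eq_class[OF crd_rep_carrier, of w a b] by (simp add: frag_crd_rep)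

lemma crd_class_inj: "w \<in> crd_tate \<Longrightarrow> crd_class a b w = crd_class a b w' \<Longrightarrow> w = w'"
proof -
  assume w: "w \<in> crd_tate" and eq: "crd_class a b w = crd_class a b w'"
  have "crd_rep w \<in> crd_class a b w" unfolding crd_class_def using crd_rep_carrier[OF w] frag_crd_rep[of a b w] by simp
  then show "w = w'" unfolding eq by (simp add: crd_class_def frag_crd_rep)
qed

lemma carrier_M_tate: "carrier (M_tate (offdiag a b)) = crd_class a b ` crd_tate"
proof -
  have "carrier (M_tate (offdiag a b)) = (\<lambda>x. ker_rel a b #>\<^bsub>FG\<^esub> x) ` carrier FG"
    by (simp add: M_tate_def tensor_group_def carrier_FactGroup)
  also have "\<dots> = (\<lambda>x. crd_class a b (frag_crd a b x)) ` carrier FG"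
    by (intro image_cong refl coset_eq_class)
  also have "\<dots> = crd_class a b ` crd_tate"
  proof
    show "(\<lambda>x. crd_class a b (frag_crd a b x)) ` carrier FG \<subseteq> crd_class a b ` crd_tate"
      using frag_crd_tate by blast
    show "crd_class a b ` crd_tate \<subseteq> (\<lambda>x. crd_class a b (frag_crd a b x)) ` carrier FG"
    proof (rule image_subsetI)
      fix w :: "'c crd" assume "w \<in> crd_tate"
      then show "crd_class a b w \<in> (\<lambda>x. crd_class a b (frag_crd a b x)) ` carrier FG"
        by (intro image_eqI[of _ _ "crd_rep w"] crd_rep_carrier) (simp_all add: frag_crd_rep)
    qed
  qed
  finally show ?thesis .
qed

lemma M_tate_comm_group: "comm_group (M_tate (offdiag a b))"
  unfolding M_tate_def tensor_group_def
  by (rule comm_group.abelian_FactGroup[OF abelian_free_Abelian_group ker_rel_subgroup])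

lemma M_tate_mult:
  assumes "w \<in> crd_tate" "w' \<in> crd_tate"
  shows "crd_class a b w \<otimes>\<^bsub>M_tate (offdiag a b)\<^esub> crd_class a b w' = crd_class a b (w + w')"
proof -
  have n: "normal (ker_rel a b) FG"
    by (rule comm_group.subgroup_imp_normal[OF abelian_free_Abelian_group ker_rel_subgroup])
  note c = crd_rep_carrier[OF assms(1)] crd_rep_carrier[OF assms(2)]
  have "crd_class a b w \<otimes>\<^bsub>M_tate (offdiag a b)\<^esub> crd_class a b w' =
      ker_rel a b #>\<^bsub>FG\<^esub> (crd_rep w + crd_rep w')"
    using normal.rcos_sum[OF n c] assms by (simp add: M_tate_def tensor_group_def crd_class_coset)
  then show ?thesis using coset_eq_class[OF FG_closed(1)[OF c]] by (simp add: frag_crd_add frag_crd_rep)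
qed

lemma M_tate_one: "\<one>\<^bsub>M_tate (offdiag a b)\<^esub> = crd_class a b 0"
  by (auto simp: M_tate_def tensor_group_def crd_class_def ker_rel_iff simp del: carrier_free_Abelian_group_iff)

lemma M_tate_finprod:
  assumes "\<And>i. i < n \<Longrightarrow> w i \<in> crd_tate"
  shows "finprod (M_tate (offdiag a b)) (\<lambda>i. crd_class a b (w i)) {..<n::nat} = crd_class a b (\<Sum>i<n. w i)"
  using assms
proof (induction n)
  case 0
  interpret comm_group "M_tate (offdiag a b)" by (rule M_tate_comm_group)
  show ?case by (simp add: M_tate_one)
next
  case (Suc n)
  interpret comm_group "M_tate (offdiag a b)" by (rule M_tate_comm_group)
  have "finprod (M_tate (offdiag a b)) (\<lambda>i. crd_class a b (w i)) (insert n {..<n}) =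
    crd_class a b (w n) \<otimes>\<^bsub>M_tate (offdiag a b)\<^esub> finprod (M_tate (offdiag a b)) (\<lambda>i. crd_class a b (w i)) {..<n}"
    using Suc.prems by (intro finprod_insert) (auto simp: carrier_M_tate)
  also have "\<dots> = crd_class a b (w n + (\<Sum>i<n. w i))"
    using Suc by (subst M_tate_mult[symmetric]) (auto intro!: crd_tate_sum)
  finally show ?case by (simp add: lessThan_Suc add.commute)
qed

text \<open>An induced map is recognised on coordinates as an additive map \<open>L\<close>, with
  agreement checked on pure tensors alone. The union defining \<open>tensor_map\<close> runs over a
  nonempty fibre all of whose members yield the same coset.\<close>

lemma tensor_map_class:
  assumes L: "\<And>w w'. L (w - w') = L w - L w'"
    and \<psi>: "\<And>f. f \<in> tate \<Longrightarrow> \<psi> f \<in> tate"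
    and comp: "\<And>m f. f \<in> tate \<Longrightarrow> crd_scale (\<psi> f) (crd a b (\<phi> m)) = L (crd_scale f (crd a b m))"
    and w: "w \<in> crd_tate"
  shows "tensor_map (M_poly (offdiag a b)) tate_poly tate \<phi> \<psi> (crd_class a b w) = crd_class a b (L w)"
proof -
  define E where "E = frag_extend (\<lambda>(m, f). frag_of (\<phi> m, \<psi> f) :: 'c frag_fps)"
  have L0: "L 0 = 0" using L[of 0 0] by simp
  have E: "E x \<in> carrier FG \<and> frag_crd a b (E x) = L (frag_crd a b x)" if "x \<in> carrier FG" for x
    using that
  proof (induction x rule: FG_induct)
    case (diff x y)
    then show ?case
      using FG_closed(2)[of "E x" "E y"]
      by (simp add: E_def frag_extend_diff frag_crd_diff L del: carrier_free_Abelian_group_iff)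
  next
    case (gen m f)
    then show ?case using \<psi> comp FG_closed(3)
      by (simp add: E_def frag_crd_of del: carrier_free_Abelian_group_iff)
  qed (simp add: E_def L0)
  have "ker_rel a b #>\<^bsub>FG\<^esub> E x = crd_class a b (L w)" if "x \<in> crd_class a b w" for x
    using coset_eq_class[of "E x" a b] E[of x] that
    by (simp add: crd_class_def del: carrier_free_Abelian_group_iff)
  moreover have "crd_rep w \<in> crd_class a b w"
    using w crd_rep_carrier by (simp add: crd_class_def frag_crd_rep del: carrier_free_Abelian_group_iff)
  ultimately show ?thesis unfolding tensor_map_def E_def[symmetric] by blast
qed

lemma M_tate_tau_class:
  "w \<in> crd_tate \<Longrightarrow> M_tate_tau (offdiag a b) (crd_class a b w) = crd_class a b (crd_tau a b w)"
  unfolding M_tate_tau_def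
proof (rule tensor_map_class)
  show "crd_tau a b (v - v') = crd_tau a b v - crd_tau a b v'" for v v'
    using crd_tau_add[of a b v "- v'"] by (simp add: crd_tau_minus)
qed (simp_all add: tate_tau_tate crd_M_tau crd_tau_scale)

lemma M_tate_poly_class:
  "w \<in> crd_tate \<Longrightarrow> M_tate_poly (offdiag a b) g (crd_class a b w) = crd_class a b (crd_scale (fps_of_poly g) w)"
  unfolding M_tate_poly_def
proof (rule tensor_map_class)
  show "crd_scale (fps_of_poly g) (v - v') = crd_scale (fps_of_poly g) v - crd_scale (fps_of_poly g) v'" for v v'
    using crd_scale_add_right[of _ v "- v'"] by (simp add: crd_scale_minus)
  show "crd_scale (tate_poly g f) (crd a b (id m)) = crd_scale (fps_of_poly g) (crd_scale f (crd a b m))" for m f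
    by (simp add: tate_poly_apply crd_scale_mult)
qed (rule tate_poly_tate)

subsection \<open>Invariant elements\<close>

text \<open>Invariance forces the coordinates at \<open>e\<^sub>1, e\<^sub>2\<close>: they are T -
  \<theta> times the twisted coordinates at
  \<open>\<tau> e\<^sub>1, \<tau> e\<^sub>2\<close>.\<close>

definition sol_crd :: "'c fps \<times> 'c fps \<Rightarrow> 'c crd"
  where "sol_crd v = (((fps_X - fps_const \<theta>) * tate_tau (fst v), (fps_X - fps_const \<theta>) * tate_tau (snd v)), v)"

lemma snd_sol_crd [simp]: "snd (sol_crd v) = v"
  by (simp add: sol_crd_def)

text \<open>Coefficient comparison: the factor T contributes the \<open>q\<^sup>2\<close>-th power
  of the preceding coefficient, which is missing at index 0.\<close>

lemma sol_iff:
  "v \<in> sol a b \<longleftrightarrow> fst v \<in> tate \<and> snd v \<in> tate \<and>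
    fst v = (fps_X - fps_const (\<theta> ^ q)) * tate_tau (tate_tau (fst v)) - fps_const b * tate_tau (snd v) \<and>
    snd v = (fps_X - fps_const (\<theta> ^ q)) * tate_tau (tate_tau (snd v)) - fps_const a * tate_tau (fst v)"
proof -
  have eq: "f = (fps_X - fps_const (\<theta> ^ q)) * tate_tau (tate_tau f) - fps_const c * tate_tau g \<longleftrightarrow>
    (\<forall>i. \<theta> ^ q * fps_nth f i ^ q\<^sup>2 + c * fps_nth g i ^ q + fps_nth f i = (if i = 0 then 0 else fps_nth f (i - 1) ^ q\<^sup>2))"
    for f g :: "'c fps" and c
  proof -
    have N: "fps_nth ((fps_X - fps_const (\<theta> ^ q)) * tate_tau (tate_tau f) - fps_const c * tate_tau g) i =
      (if i = 0 then 0 else fps_nth f (i - 1) ^ q\<^sup>2) - \<theta> ^ q * fps_nth f i ^ q\<^sup>2 - c * fps_nth g i ^ q" for i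
      using frob_comp[of 1 1 2] by (cases i) (simp_all add: left_diff_distrib)
    have move: "x = r - y - z \<longleftrightarrow> y + z + x = r" for x y z r :: 'c
      by (auto simp: algebra_simps)
    show ?thesis unfolding fps_eq_iff N move ..
  qed
  show ?thesis unfolding sol_def sys_solution_def mem_Collect_eq eq tate_iff by blast
qed

lemma tate_tau_X_minus_theta:
  "tate_tau ((fps_X - fps_const \<theta>) * f) = (fps_X - fps_const (\<theta> ^ q)) * tate_tau f"
proof -
  have "tate_tau (fps_X - fps_const \<theta>) = fps_X - fps_const (\<theta> ^ q)"
    by (simp add: fps_eq_iff frob_q_diff fps_X_def zero_power)
  then show ?thesis by (simp add: tate_tau_mult)
qed

lemma crd_tau_fixed_iff:
  "w \<in> crd_tate \<and> crd_tau a b w = w \<longleftrightarrow> (\<exists>v\<in>sol a b. w = sol_crd v)"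
proof -
  obtain u1 u2 v1 v2 where w: "w = ((u1, u2), (v1, v2))" by (metis prod.exhaust)
  have "crd_tau a b w = w \<longleftrightarrow>
    (fps_X - fps_const \<theta>) * tate_tau v1 = u1 \<and> (fps_X - fps_const \<theta>) * tate_tau v2 = u2 \<and>
    tate_tau u1 - fps_const b * tate_tau v2 = v1 \<and> tate_tau u2 - fps_const a * tate_tau v1 = v2"
    by (simp add: w crd_tau_def)
  also have "\<dots> \<longleftrightarrow> (fps_X - fps_const \<theta>) * tate_tau v1 = u1 \<and> (fps_X - fps_const \<theta>) * tate_tau v2 = u2 \<and>
    (fps_X - fps_const (\<theta> ^ q)) * tate_tau (tate_tau v1) - fps_const b * tate_tau v2 = v1 \<and>
    (fps_X - fps_const (\<theta> ^ q)) * tate_tau (tate_tau v2) - fps_const a * tate_tau v1 = v2"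
    unfolding tate_tau_X_minus_theta[symmetric] by (intro conj_cong refl) simp_all
  finally have fixed: "crd_tau a b w = w \<longleftrightarrow> \<dots>" .
  have d: "f - g \<in> tate" if "f \<in> tate" "g \<in> tate" for f g
    using tate_add[OF that(1) tate_minus[OF that(2)]] by simp
  have u: "(fps_X - fps_const \<theta>) * tate_tau f \<in> tate" if "f \<in> tate" for f
    using that unfolding left_diff_distrib by (intro d tate_X_mult tate_const_mult tate_tau_tate)
  have sol_crd: "w = sol_crd v \<longleftrightarrow> v = (v1, v2) \<and> (fps_X - fps_const \<theta>) * tate_tau v1 = u1 \<and> (fps_X - fps_const \<theta>) * tate_tau v2 = u2" for v
    by (cases v) (auto simp: w sol_crd_def)
  have sol: "(\<exists>v\<in>sol a b. w = sol_crd v) \<longleftrightarrow>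
    (v1, v2) \<in> sol a b \<and> (fps_X - fps_const \<theta>) * tate_tau v1 = u1 \<and> (fps_X - fps_const \<theta>) * tate_tau v2 = u2"
    unfolding sol_crd by auto
  have tate: "w \<in> crd_tate \<longleftrightarrow> u1 \<in> tate \<and> u2 \<in> tate \<and> v1 \<in> tate \<and> v2 \<in> tate"
    by (simp add: w crd_tate_def)
  \<comment> \<open>A propositional regrouping. That u1 and u2 are Tate series follows from the
    equations expressing them through v1 and v2.\<close>
  have taut: "((U1 \<and> U2 \<and> V1 \<and> V2) \<and> (E1 \<and> E2 \<and> G1 \<and> G2)) = ((V1 \<and> V2 \<and> H1 \<and> H2) \<and> E1 \<and> E2)"
    if "V1 \<Longrightarrow> E1 \<Longrightarrow> U1" "V2 \<Longrightarrow> E2 \<Longrightarrow> U2" "G1 = H1" "G2 = H2" for U1 U2 V1 V2 E1 E2 G1 G2 H1 H2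
    using that by blast
  show ?thesis unfolding fixed sol tate unfolding sol_iff fst_conv snd_conv
    by (rule taut; (rule eq_commute | (erule subst, rule u)))
qed

lemma H1_eq: "H1 (offdiag a b) = (\<lambda>v. crd_class a b (sol_crd v)) ` sol a b"
proof -
  have "M_tate_tau (offdiag a b) (crd_class a b w) = crd_class a b w \<longleftrightarrow> crd_tau a b w = w"
    if "w \<in> crd_tate" for w
    using crd_class_inj[OF crd_tate_tau[OF that], of a b a b w] M_tate_tau_class[OF that] by auto
  then have "H1 (offdiag a b) = crd_class a b ` {w. w \<in> crd_tate \<and> crd_tau a b w = w}"
    unfolding H1_def carrier_M_tate by blast
  also have "\<dots> = (\<lambda>v. crd_class a b (sol_crd v)) ` sol a b"
    unfolding crd_tau_fixed_iff by auto
  finally show ?thesis .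
qed

lemma sol_crd_tate: "v \<in> sol a b \<Longrightarrow> sol_crd v \<in> crd_tate"
  using crd_tau_fixed_iff[of "sol_crd v" a b] by blast

lemma sol_crd_scale: "g \<in> Fq_poly q \<Longrightarrow> crd_scale (fps_of_poly g) (sol_crd v) = sol_crd (pair_scale (fps_of_poly g) v)"
proof -
  assume g: "g \<in> Fq_poly q"
  then have "tate_tau (fps_of_poly g) = fps_of_poly g"
    by (simp add: fps_eq_iff Fq_poly_def Fq_frob)
  then show ?thesis by (simp add: sol_crd_def crd_scale_def pair_scale_def tate_tau_mult mult.left_commute)
qed

lemma sol_crd_sum: "sol_crd (sum h I) = (\<Sum>i\<in>I. sol_crd (h i))"
proof -
  have "sol_crd (v + w) = sol_crd v + sol_crd w" for v w
    by (simp add: sol_crd_def tate_tau_add distrib_left)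
  moreover have "sol_crd 0 = 0" by (simp add: sol_crd_def crd_eq_iff)
  ultimately show ?thesis by (induction I rule: infinite_finite_induct) simp_all
qed

text \<open>The map taking v to \<open>crd_class a b (sol_crd v)\<close> is a bijection from
  \<open>sol a b\<close> onto \<open>H1\<close>, and it is linear over polynomials with coefficients
  in \<open>Fq q\<close> because \<tau> fixes those. It therefore carries the basis of solutions to
  a basis of \<open>H1\<close>.\<close>

lemma uniformizable_of_liftable:
  assumes "liftable a b"
  shows "uniformizable (offdiag a b)"
proof -
  obtain B where B: "\<And>j. j < 4 \<Longrightarrow> B j \<in> sol a b"
    "\<And>v. v \<in> sol a b \<Longrightarrow> \<exists>!c. c \<in> {..<4::nat} \<rightarrow>\<^sub>E Fq_poly q \<and>
       v = (\<Sum>j<4. pair_scale (fps_of_poly (c j)) (B j))"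
  proof -
    from sol_basis[OF assms] obtain B where B: "(\<forall>j<4. B j \<in> sol a b) \<and> (\<forall>v\<in>sol a b. \<exists>!c. c \<in> {..<4::nat} \<rightarrow>\<^sub>E Fq_poly q \<and>
       v = (\<Sum>j<4. pair_scale (fps_of_poly (c j)) (B j)))" ..
    show thesis by (rule that[of B]) (use B in \<open>simp_all only:\<close>)
  qed
  define \<beta> where "\<beta> j = crd_class a b (sol_crd (B j))" for j
  have comb: "finprod (M_tate (offdiag a b)) (\<lambda>i. M_tate_poly (offdiag a b) (c i) (\<beta> i)) {..<4} =
      crd_class a b (sol_crd (\<Sum>j<4. pair_scale (fps_of_poly (c j)) (B j)))"
    if c: "c \<in> {..<4::nat} \<rightarrow>\<^sub>E Fq_poly q" for c
  proof -
    interpret comm_group "M_tate (offdiag a b)" by (rule M_tate_comm_group)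
    have cl: "M_tate_poly (offdiag a b) (c i) (\<beta> i) =
        crd_class a b (sol_crd (pair_scale (fps_of_poly (c i)) (B i)))" if "i < 4" for i
      using B(1)[OF that] PiE_mem[OF c, of i] that
      by (simp add: \<beta>_def M_tate_poly_class sol_crd_tate sol_crd_scale)
    have t: "sol_crd (pair_scale (fps_of_poly (c i)) (B i)) \<in> crd_tate" if "i < 4" for i
      using B(1)[OF that] PiE_mem[OF c, of i] that by (intro sol_crd_tate[of _ a b] sol_poly) auto
    have "finprod (M_tate (offdiag a b)) (\<lambda>i. M_tate_poly (offdiag a b) (c i) (\<beta> i)) {..<4} =
        finprod (M_tate (offdiag a b)) (\<lambda>i. crd_class a b (sol_crd (pair_scale (fps_of_poly (c i)) (B i)))) {..<4}"
      by (intro finprod_cong') (auto simp: cl carrier_M_tate t)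
    also have "\<dots> = crd_class a b (\<Sum>i<4. sol_crd (pair_scale (fps_of_poly (c i)) (B i)))"
      by (rule M_tate_finprod) (rule t)
    finally show ?thesis by (simp add: sol_crd_sum)
  qed
  have "H1_basis (offdiag a b) 4 \<beta>" unfolding H1_basis_def
  proof (intro conjI ballI)
    show "\<beta> \<in> {..<4} \<rightarrow> H1 (offdiag a b)" using B(1) by (auto simp: \<beta>_def H1_eq)
    fix x assume "x \<in> H1 (offdiag a b)"
    then obtain v where v: "v \<in> sol a b" "x = crd_class a b (sol_crd v)" by (auto simp: H1_eq)
    have eq: "x = finprod (M_tate (offdiag a b)) (\<lambda>i. M_tate_poly (offdiag a b) (c i) (\<beta> i)) {..<4} \<longleftrightarrow>
        v = (\<Sum>j<4. pair_scale (fps_of_poly (c j)) (B j))"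
      if c: "c \<in> {..<4::nat} \<rightarrow>\<^sub>E Fq_poly q" for c
      unfolding comb[OF c] v(2)
    proof
      let ?s = "\<Sum>j<4. pair_scale (fps_of_poly (c j)) (B j)"
      assume "crd_class a b (sol_crd v) = crd_class a b (sol_crd ?s)"
      then have "sol_crd v = sol_crd ?s" by (rule crd_class_inj[OF sol_crd_tate[OF v(1)]])
      then have "snd (sol_crd v) = snd (sol_crd ?s)" by (rule arg_cong)
      then show "v = ?s" by (simp only: snd_sol_crd)
    qed (rule arg_cong)
    show "\<exists>!c. c \<in> {..<4} \<rightarrow>\<^sub>E Fq_poly q \<and>
        x = finprod (M_tate (offdiag a b)) (\<lambda>i. M_tate_poly (offdiag a b) (c i) (\<beta> i)) {..<4}"
    proof -
      have "(c \<in> {..<4} \<rightarrow>\<^sub>E Fq_poly q \<and>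
          x = finprod (M_tate (offdiag a b)) (\<lambda>i. M_tate_poly (offdiag a b) (c i) (\<beta> i)) {..<4}) \<longleftrightarrow>
        (c \<in> {..<4} \<rightarrow>\<^sub>E Fq_poly q \<and> v = (\<Sum>j<4. pair_scale (fps_of_poly (c j)) (B j)))" for c
        by (intro conj_cong refl eq)
      then show ?thesis using B(2)[OF v(1)] by (simp only:)
    qed
  qed
  then show ?thesis unfolding uniformizable_def H1_free_of_rank_def by blast
qed

end

theorem proposition6p2:
  fixes q :: nat and \<theta> :: "'c::field" and ord :: "'c \<Rightarrow> ereal" and a12 a21 :: 'c
  assumes "C_infinity q \<theta> ord"
    and "ord a12 > ereal (- (real q ^ 2 / (real q - 1)))"
    and "ord a21 > ereal (- (real q ^ 2 / (real q - 1)))"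
  shows "C_infinity.uniformizable q \<theta> ord
           (vector [vector [0, a12], vector [a21, 0]] :: 'c^2^2)"
  using C_infinity.uniformizable_of_liftable[OF assms(1) C_infinity.liftable_of_ord[OF assms]] .

end
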